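(* Let $G$ be an infinite discrete group with a finite generating set $S$, and let $\mu$ be a symmetric probability measure on $G$, i.e. $\mu(g)=\mu(g^{-1})$, supported in $S$ (hence finitely supported) and whose support generates $G$. Let $k\ge1$ be an integer. Suppose that the Markov operator $P_\mu$ on $\ell^2(G)$ has spectrum contained in $(a,1]\subset[-1,1]$ with $(1-a)/2<2^{-1+1/k}$. Assume further that $G$ has polynomial volume growth: $V(n)\asymp n^d$ for some $d$. Define $$\mu_k:=\delta_e-(\delta_e-\mu)^{*k}.$$ Then there exist constants $C_6,c_6>0$ such that for all integers $n\ge1$ and all $g\in G$, $$|\mu_k^{(n)}(g)|\le\frac{C_6}{V(n^{1/2k})}\exp\left(-c_6\left(\frac{|g|}{n^{1/2k}}\right)^{2k/(2k-1)}\right).$$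
   Context: $P_\mu(u,v)=\mu(u^{-1}v)$ is the transition kernel of the random walk on $G$ driven by $\mu$, acting on $\ell^2(G)$ (counting measure) by $P_\mu f(u)=\sum_{v}P_\mu(u,v)f(v)$. The graph structure on $G$ has an edge between $u$ and $v$ iff $\mu(u^{-1}v)>0$; $d_G$ is the shortest-path distance, $e$ the identity and $|g|=d_G(e,g)$. $V(t)$ is the number of elements of the ball of radius $t$, $V(t)=\#\{g\in G:|g|<t\}$, and $V(n)\asymp n^d$ means that the ratio is bounded above and below by positive constants for $n\ge 1$ large. $*$ is convolution on $G$, $\nu^{*k}$ and $\nu^{(n)}$ denote convolution powers, and $\delta_e$ is the point mass at $e$. The exponent $1/2k$ means $1/(2k)$. *)

theory Defs
  imports
    "HOL-Algebra.Generated_Groups"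
    "HOL-Probability.Probability_Mass_Function"
    "HOL-Library.Landau_Symbols"
begin

section \<open>Random walk kernel and word metric\<close>

definition walk_kernel :: "('a, 'b) monoid_scheme \<Rightarrow> 'a pmf \<Rightarrow> 'a \<Rightarrow> 'a \<Rightarrow> real" where
  "walk_kernel G \<mu> u v = pmf \<mu> (inv\<^bsub>G\<^esub> u \<otimes>\<^bsub>G\<^esub> v)"

definition walk_edges :: "('a, 'b) monoid_scheme \<Rightarrow> 'a pmf \<Rightarrow> ('a \<times> 'a) set" where
  "walk_edges G \<mu> = {(u, v). u \<in> carrier G \<and> v \<in> carrier G \<and> walk_kernel G \<mu> u v > 0}"

text \<open>The relation power \<open>E ^^ n\<close> relates the endpoints of edge paths of length \<open>n\<close>, so the
  least such \<open>n\<close> is the shortest-path distance. It is only meaningful when a path exists, which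
  is the case for all pairs as soon as the support of the symmetric \<open>\<mu>\<close> generates \<open>G\<close>.\<close>

definition graph_dist :: "('a, 'b) monoid_scheme \<Rightarrow> 'a pmf \<Rightarrow> 'a \<Rightarrow> 'a \<Rightarrow> nat" where
  "graph_dist G \<mu> u v = (LEAST n. (u, v) \<in> walk_edges G \<mu> ^^ n)"

definition word_length :: "('a, 'b) monoid_scheme \<Rightarrow> 'a pmf \<Rightarrow> 'a \<Rightarrow> nat" where
  "word_length G \<mu> g = graph_dist G \<mu> \<one>\<^bsub>G\<^esub> g"

definition ball_card :: "('a, 'b) monoid_scheme \<Rightarrow> 'a pmf \<Rightarrow> real \<Rightarrow> nat" where
  "ball_card G \<mu> t = card {g \<in> carrier G. real (word_length G \<mu> g) < t}"


section \<open>The Markov operator on the Hilbert space of square-summable functions\<close>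

text \<open>Elements of \<open>\<ell>\<^sup>2(G)\<close> are functions on the whole type that vanish off the carrier, so that
  equality of functions is equality on \<open>G\<close>. The scalars are complex, as usual for spectra.\<close>

definition ell2 :: "('a, 'b) monoid_scheme \<Rightarrow> ('a \<Rightarrow> complex) set" where
  "ell2 G = {f. (\<forall>x. x \<notin> carrier G \<longrightarrow> f x = 0) \<and>
                (\<lambda>x. (cmod (f x))\<^sup>2) summable_on carrier G}"

definition ell2_norm :: "('a, 'b) monoid_scheme \<Rightarrow> ('a \<Rightarrow> complex) \<Rightarrow> real" where
  "ell2_norm G f = sqrt (\<Sum>\<^sub>\<infinity>x\<in>carrier G. (cmod (f x))\<^sup>2)"

definition markov_op ::
  "('a, 'b) monoid_scheme \<Rightarrow> 'a pmf \<Rightarrow> ('a \<Rightarrow> complex) \<Rightarrow> ('a \<Rightarrow> complex)" where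
  "markov_op G \<mu> f u =
     (if u \<in> carrier G
      then (\<Sum>\<^sub>\<infinity>v\<in>carrier G. complex_of_real (walk_kernel G \<mu> u v) * f v) else 0)"

text \<open>\<open>z\<close> is outside the spectrum of \<open>T\<close> iff \<open>z - T\<close> has a bounded two-sided inverse \<open>R\<close> on
  \<open>\<ell>\<^sup>2(G)\<close>. Linearity of \<open>R\<close> need not be required: a two-sided inverse of a linear map is linear.\<close>

definition ell2_spectrum ::
  "('a, 'b) monoid_scheme \<Rightarrow> (('a \<Rightarrow> complex) \<Rightarrow> ('a \<Rightarrow> complex)) \<Rightarrow> complex set" where
  "ell2_spectrum G T = {z. \<not> (\<exists>R.
     (\<forall>f\<in>ell2 G. R f \<in> ell2 G) \<and>
     (\<exists>B. \<forall>f\<in>ell2 G. ell2_norm G (R f) \<le> B * ell2_norm G f) \<and>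
     (\<forall>f\<in>ell2 G. R (\<lambda>x. z * f x - T f x) = f) \<and>
     (\<forall>f\<in>ell2 G. (\<lambda>x. z * R f x - T (R f) x) = f))}"


section \<open>Convolution\<close>

definition conv ::
  "('a, 'b) monoid_scheme \<Rightarrow> ('a \<Rightarrow> real) \<Rightarrow> ('a \<Rightarrow> real) \<Rightarrow> 'a \<Rightarrow> real" where
  "conv G f h g = (\<Sum>\<^sub>\<infinity>x\<in>carrier G. f x * h (inv\<^bsub>G\<^esub> x \<otimes>\<^bsub>G\<^esub> g))"

definition point_mass :: "('a, 'b) monoid_scheme \<Rightarrow> 'a \<Rightarrow> real" where
  "point_mass G = indicator {\<one>\<^bsub>G\<^esub>}"

primrec conv_pow :: "('a, 'b) monoid_scheme \<Rightarrow> ('a \<Rightarrow> real) \<Rightarrow> nat \<Rightarrow> 'a \<Rightarrow> real" where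
  "conv_pow G f 0 = point_mass G"
| "conv_pow G f (Suc n) = conv G f (conv_pow G f n)"

definition mu_k :: "('a, 'b) monoid_scheme \<Rightarrow> 'a pmf \<Rightarrow> nat \<Rightarrow> 'a \<Rightarrow> real" where
  "mu_k G \<mu> k =
     (\<lambda>g. point_mass G g - conv_pow G (\<lambda>x. point_mass G x - pmf \<mu> x) k g)"

end

theory Submission
  imports Defs "HOL-Library.Poly_Mapping"
begin

text \<open>
  Write $L = 1 - P_\mu$, so that the convolution powers of $\mu_k$ are $K_n = (1 - L^k)^n \delta_e$. The spectral
  hypothesis gives $0 \le L \le b$ with $b^k < 2$, whence $1 - L^k$ is a contraction and
  $\|K_{n+1}\|^2 \le \|K_n\|^2 - (2 - b^k) \langle L^k K_n, K_n \rangle$. Averaging $K_n$ over balls by right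
  translations, which commute with $L$, yields a Nash inequality for $K_n$ that needs no bound on
  $\|K_n\|_1$ (the measure $\mu_k$ is signed), and log-convexity of the moments of $L$ transfers it
  from $L$ to $L^k$. This proves $\|K_n\|^2 \le C n^{-d/(2k)}$.

  For the off-diagonal decay, $(1 - L^k)^n = \sum_j a_j T_{|j|}(1 - 2L/b)$ with Chebyshev polynomials $T_j$
  of norm at most 1 and propagation $j$, as in the Varopoulos--Carne formula. The $a_j$ are the coefficients of the
  Laurent polynomial $(1 - (b (2 - z - 1/z) / 4)^k)^n$, and estimating it on the circles $|z| = e^s$ gives
  $|a_j| \le C n^{-1/(2k)} \exp (C n s^{2k} - |j| s)$. Optimising in $s$ bounds the mass that
  $(1 - L^k)^n$ moves over distance $r$, and a dyadic iteration in $n$ combines this with the on-diagonal decay.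
\<close>

section \<open>The inner product space of finitely supported functions\<close>

\<comment> \<open>The space of finitely supported functions is not complete, and no spectral theorem
  is applied to it. Since \<open>\<mu>\<close> has finite support, polynomials in \<open>Lap\<close>
  preserve this space, and the spectral hypothesis enters only as a lower bound for the quadratic
  form of \<open>P\<close>. Spectral integrals are replaced by Cauchy-Schwarz for positive forms and
  by Pell's identity. The same type, indexed by \<open>int\<close>, supplies the Laurent
  polynomials. All estimates are therefore l^2 estimates; pointwise bounds come last, from an inner
  product of two halves of the walk. The hypothesis on \<open>a\<close> amounts to
  \<open>1 - a < 2^(1/k)\<close>. The resulting gap \<open>2 - b^k\<close> is used twice: as
  dissipation in the on-diagonal argument, and to make the symbol smaller than 1 in modulus at
  \<open>z = -1\<close>, where it equals \<open>1 - b^k\<close>.\<close>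
alias lookup = Poly_Mapping.lookup
alias keys = Poly_Mapping.keys
alias single = Poly_Mapping.single
alias map_key = Poly_Mapping.map_key

instantiation poly_mapping :: (type, real_vector) real_vector
begin

lift_definition scaleR_poly_mapping :: "real \<Rightarrow> ('a \<Rightarrow>\<^sub>0 'b) \<Rightarrow> 'a \<Rightarrow>\<^sub>0 'b"
  is "\<lambda>c f x. c *\<^sub>R f x"
  by (erule rev_finite_subset) auto

instance
  by standard (transfer; simp add: fun_eq_iff scaleR_add_right scaleR_add_left)+

end

lemma lookup_scaleR [simp]: "lookup (c *\<^sub>R f) x = c *\<^sub>R lookup f x"
  by transfer simp

instantiation poly_mapping :: (type, real_inner) real_inner
begin

definition inner_poly_mapping :: "('a \<Rightarrow>\<^sub>0 'b) \<Rightarrow> ('a \<Rightarrow>\<^sub>0 'b) \<Rightarrow> real" where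
  "inner_poly_mapping f g = (\<Sum>x\<in>keys f. inner (lookup f x) (lookup g x))"

definition norm_poly_mapping :: "('a \<Rightarrow>\<^sub>0 'b) \<Rightarrow> real" where
  "norm_poly_mapping f = sqrt (inner f f)"

definition dist_poly_mapping :: "('a \<Rightarrow>\<^sub>0 'b) \<Rightarrow> ('a \<Rightarrow>\<^sub>0 'b) \<Rightarrow> real" where
  "dist_poly_mapping f g = norm (f - g)"

definition sgn_poly_mapping :: "('a \<Rightarrow>\<^sub>0 'b) \<Rightarrow> 'a \<Rightarrow>\<^sub>0 'b" where
  "sgn_poly_mapping f = inverse (norm f) *\<^sub>R f"

definition uniformity_poly_mapping :: "(('a \<Rightarrow>\<^sub>0 'b) \<times> ('a \<Rightarrow>\<^sub>0 'b)) filter" where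
  "uniformity_poly_mapping = (INF e\<in>{0 <..}. principal {(x, y). dist x y < e})"

definition open_poly_mapping :: "('a \<Rightarrow>\<^sub>0 'b) set \<Rightarrow> bool" where
  "open_poly_mapping U \<longleftrightarrow> (\<forall>x\<in>U. eventually (\<lambda>(x', y). x' = x \<longrightarrow> y \<in> U) uniformity)"

lemma inner_poly_mapping_superset:
  fixes f g :: "'a \<Rightarrow>\<^sub>0 'b"
  assumes "finite S" "keys f \<subseteq> S"
  shows "inner f g = (\<Sum>x\<in>S. inner (lookup f x) (lookup g x))"
  unfolding inner_poly_mapping_def
  by (rule sum.mono_neutral_left) (use assms in \<open>auto simp: in_keys_iff\<close>)

instance
proof
  fix f g h :: "'a \<Rightarrow>\<^sub>0 'b" and r :: real
  have fin: "finite (keys f \<union> keys g \<union> keys h)" by simp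
  show "inner f g = inner g f"
    by (subst (1 2) inner_poly_mapping_superset[OF fin]) (auto simp: inner_commute)
  show "inner (f + g) h = inner f h + inner g h"
    using keys_add[of f g]
    by (subst (1 2 3) inner_poly_mapping_superset[OF fin])
      (auto simp: lookup_add inner_add_left sum.distrib)
  show "inner (r *\<^sub>R f) g = r * inner f g"
    by (subst (1 2) inner_poly_mapping_superset[OF fin])
      (auto simp: sum_distrib_left in_keys_iff)
  show "0 \<le> inner f f"
    unfolding inner_poly_mapping_def by (rule sum_nonneg) auto
  show "inner f f = 0 \<longleftrightarrow> f = 0"
    unfolding inner_poly_mapping_def
    by (subst sum_nonneg_eq_0_iff) (auto simp: in_keys_iff intro!: poly_mapping_eqI)
qed (auto simp: norm_poly_mapping_def dist_poly_mapping_def sgn_poly_mapping_def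
    uniformity_poly_mapping_def open_poly_mapping_def)

end

lemma norm_poly_mapping_superset:
  fixes f :: "'a \<Rightarrow>\<^sub>0 real"
  assumes "finite S" "keys f \<subseteq> S"
  shows "(norm f)\<^sup>2 = (\<Sum>x\<in>S. (lookup f x)\<^sup>2)"
  by (simp add: power2_norm_eq_inner inner_poly_mapping_superset[OF assms])
    (simp add: power2_eq_square)

lemma inner_single_right [simp]:
  fixes f :: "'a \<Rightarrow>\<^sub>0 real"
  shows "inner f (single x c) = lookup f x * c"
  by (subst inner_commute) (auto simp: inner_poly_mapping_def)

lemma norm_single [simp]: "norm (single x c :: 'a \<Rightarrow>\<^sub>0 real) = \<bar>c\<bar>"
  by (simp add: norm_eq_sqrt_inner real_sqrt_mult_self)

section \<open>Cut-offs and composition with bijections\<close>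

lift_definition restr :: "'a set \<Rightarrow> ('a \<Rightarrow>\<^sub>0 'b::zero) \<Rightarrow> 'a \<Rightarrow>\<^sub>0 'b"
  is "\<lambda>S f x. if x \<in> S then f x else 0"
  by (erule rev_finite_subset) auto

lemma lookup_restr: "lookup (restr S f) x = (if x \<in> S then lookup f x else 0)"
  by transfer simp

lemma linear_restr: "linear (restr S :: ('a \<Rightarrow>\<^sub>0 'b::real_vector) \<Rightarrow> _)"
  by (rule linearI) (auto intro!: poly_mapping_eqI simp: lookup_restr lookup_add)

lemma restr_add_compl: "restr S f + restr (- S) f = (f :: 'a \<Rightarrow>\<^sub>0 'b::monoid_add)"
  by (rule poly_mapping_eqI) (auto simp: lookup_restr lookup_add)

lemma norm_restr_mono:
  fixes f :: "'a \<Rightarrow>\<^sub>0 real"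
  assumes "S \<subseteq> T"
  shows "norm (restr S f) \<le> norm (restr T f)"
proof -
  have "(norm (restr S f))\<^sup>2 \<le> (norm (restr T f))\<^sup>2"
    by (subst (1 2) norm_poly_mapping_superset[of "keys f"])
      (use assms in \<open>auto simp: lookup_restr in_keys_iff intro!: sum_mono split: if_splits\<close>)
  then show ?thesis by (simp add: power2_le_iff_abs_le)
qed

lemma norm_restr_le:
  fixes f :: "'a \<Rightarrow>\<^sub>0 real"
  shows "norm (restr S f) \<le> norm f"
proof -
  have "restr UNIV f = f" by (rule poly_mapping_eqI) (simp add: lookup_restr)
  then show ?thesis using norm_restr_mono[of S UNIV f] by simp
qed

lemma linear_map_key: "inj p \<Longrightarrow> linear (map_key p :: ('a \<Rightarrow>\<^sub>0 'b::real_vector) \<Rightarrow> _)"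
  by (rule linearI) (auto intro!: poly_mapping_eqI simp: map_key.rep_eq lookup_add)

lemma inner_map_key_bij:
  fixes f g :: "'a \<Rightarrow>\<^sub>0 real"
  assumes "bij p"
  shows "inner (map_key p f) (map_key p g) = inner f g"
proof -
  have inj: "inj p" using assms by (rule bij_is_inj)
  have im: "keys f = p ` keys (map_key p f)"
    using bij_is_surj[OF assms] by (auto simp: keys_map_key[OF inj])
  show ?thesis
    unfolding inner_poly_mapping_def im
    by (subst sum.reindex) (auto simp: map_key.rep_eq[OF inj] intro: inj_on_subset[OF inj])
qed

lemma norm_map_key_bij:
  fixes f :: "'a \<Rightarrow>\<^sub>0 real"
  shows "bij p \<Longrightarrow> norm (map_key p f) = norm f"
  by (simp add: norm_eq_sqrt_inner inner_map_key_bij)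

section \<open>Positive bounded operators and Chebyshev polynomials\<close>

lemma poly_mapping_sum_single: "f = (\<Sum>x\<in>keys f. single x (lookup f x))"
  by (rule poly_mapping_eqI)
    (auto simp: lookup_sum lookup_single when_def in_keys_iff sum.delta' split: if_splits)

text \<open>Point masses span the space. Identities that are linear in a Laurent polynomial are
  thereby checked on monomials.\<close>

lemma linear_eq_on_single:
  fixes F H :: "('i \<Rightarrow>\<^sub>0 real) \<Rightarrow> 'v::real_vector"
  assumes "linear F" "linear H" "\<And>i. F (single i 1) = H (single i 1)"
  shows "F c = H c"
proof -
  have *: "single i a = a *\<^sub>R single i (1::real)" for i :: 'i and a
    by (rule poly_mapping_eqI) (simp add: lookup_single when_def)
  have "F (\<Sum>x\<in>keys c. single x (lookup c x)) = H (\<Sum>x\<in>keys c. single x (lookup c x))"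
    by (subst (1 2) *)
      (simp add: linear_sum[OF assms(1)] linear_sum[OF assms(2)]
        linear_cmul[OF assms(1)] linear_cmul[OF assms(2)] assms(3))
  then show ?thesis using poly_mapping_sum_single[of c] by simp
qed

text \<open>With \<open>g j = z powi j\<close> this evaluates a Laurent polynomial; with
  \<open>g j = T (nat |j|) x\<close> it applies to \<open>x\<close> the operator with Chebyshev
  coefficients \<open>c\<close>.\<close>

definition lin_ext :: "('i \<Rightarrow> 'v::real_vector) \<Rightarrow> ('i \<Rightarrow>\<^sub>0 real) \<Rightarrow> 'v" where
  "lin_ext g c = (\<Sum>j\<in>keys c. lookup c j *\<^sub>R g j)"

lemma lin_ext_superset:
  "finite S \<Longrightarrow> keys c \<subseteq> S \<Longrightarrow> lin_ext g c = (\<Sum>j\<in>S. lookup c j *\<^sub>R g j)"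
  unfolding lin_ext_def by (rule sum.mono_neutral_left) (auto simp: in_keys_iff)

lemma linear_lin_ext: "linear (lin_ext (g :: 'i \<Rightarrow> 'v::real_vector))"
proof (rule linearI)
  fix c d :: "'i \<Rightarrow>\<^sub>0 real" and r :: real
  have fin: "finite (keys c \<union> keys d)" by simp
  show "lin_ext g (c + d) = lin_ext g c + lin_ext g d"
    using keys_add[of c d]
    by (subst (1 2 3) lin_ext_superset[OF fin])
      (auto simp: lookup_add scaleR_add_left sum.distrib)
  show "lin_ext g (r *\<^sub>R c) = r *\<^sub>R lin_ext g c"
    by (subst (1 2) lin_ext_superset[OF fin])
      (auto simp: scaleR_sum_right in_keys_iff)
qed

lemma lin_ext_single [simp]: "lin_ext g (single j a) = a *\<^sub>R g j"
  by (simp add: lin_ext_def)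

text \<open>The polynomial \<open><T (x + t y), x + t y>\<close> in \<open>t\<close> is nonnegative,
  so its discriminant is not positive. Since \<open>T\<close> may have a kernel, a vanishing leading
  coefficient is treated apart.\<close>

lemma psd_Cauchy_Schwarz:
  fixes T :: "'v::real_inner \<Rightarrow> 'v"
  assumes lin: "linear T" and sym: "\<And>x y. inner (T x) y = inner x (T y)"
    and pos: "\<And>x. 0 \<le> inner (T x) x"
  shows "(inner (T x) y)\<^sup>2 \<le> inner (T x) x * inner (T y) y"
proof -
  define p q r where "p = inner (T x) x" and "q = inner (T x) y" and "r = inner (T y) y"
  have q': "inner (T y) x = q"
    unfolding q_def using sym[of x y] by (simp add: inner_commute)
  have *: "0 \<le> p + 2 * t * q + t\<^sup>2 * r" for t
  proof -
    have "0 \<le> inner (T (x + t *\<^sub>R y)) (x + t *\<^sub>R y)" by (rule pos)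
    also have "\<dots> = p + 2 * t * q + t\<^sup>2 * r"
      by (simp add: linear_add[OF lin] linear_cmul[OF lin] inner_add_left inner_add_right q'
          p_def[symmetric] q_def[symmetric] r_def[symmetric])
        (simp add: algebra_simps power2_eq_square)
    finally show ?thesis .
  qed
  have r: "r \<ge> 0" using pos[of y] by (simp add: r_def)
  have "q\<^sup>2 \<le> p * r"
  proof (cases "r = 0")
    case True
    have "q = 0"
    proof (rule ccontr)
      assume "q \<noteq> 0"
      \<comment> \<open>With \<open>r = 0\<close> the expression is affine in \<open>t\<close>, and
        this \<open>t\<close> gives it the value -1.\<close>
      then show False using *[of "- (p + 1) / (2 * q)"] True by (simp add: field_simps)
    qed
    then show ?thesis using True by simp
  next
    case False
    then show ?thesis using *[of "- q / r"] r
      by (simp add: field_simps power2_eq_square)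
  qed
  then show ?thesis by (simp add: p_def q_def r_def)
qed

text \<open>The ratios \<open>m (Suc j) / m j\<close> are nondecreasing, so each is at least
  \<open>m 1 / m 0\<close>, and \<open>k\<close> of them multiply to the claim. The product form in
  \<open>step\<close> also covers vanishing moments.\<close>

lemma log_convex_power_le:
  fixes m :: "nat \<Rightarrow> real"
  assumes nonneg: "\<And>j. 0 \<le> m j" and conv: "\<And>j. (m (Suc j))\<^sup>2 \<le> m j * m (Suc (Suc j))"
  shows "m 1 ^ Suc k \<le> m (Suc k) * m 0 ^ k"
proof -
  have step: "m 1 * m j \<le> m 0 * m (Suc j)" for j
  proof (induction j)
    case 0
    then show ?case by simp
  next
    case (Suc j)
    have "m (Suc j) * (m 1 * m (Suc j)) = m 1 * (m (Suc j))\<^sup>2"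
      by (simp add: power2_eq_square)
    also have "\<dots> \<le> m 1 * (m j * m (Suc (Suc j)))"
      by (intro mult_left_mono conv nonneg)
    also have "\<dots> \<le> (m 0 * m (Suc j)) * m (Suc (Suc j))"
      using mult_right_mono[OF Suc nonneg[of "Suc (Suc j)"]] by (simp add: mult.assoc)
    finally have "m (Suc j) * (m 1 * m (Suc j)) \<le> m (Suc j) * (m 0 * m (Suc (Suc j)))"
      by (simp add: mult_ac)
    then show ?case
      using nonneg[of "Suc j"] nonneg[of 0] nonneg[of "Suc (Suc j)"]
      by (cases "m (Suc j) = 0") (auto simp: mult_le_cancel_left)
  qed
  show ?thesis
  proof (induction k)
    case 0
    then show ?case by simp
  next
    case (Suc k)
    have "m 1 ^ Suc (Suc k) = m 1 * m 1 ^ Suc k" by simp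
    also have "\<dots> \<le> m 1 * (m (Suc k) * m 0 ^ k)"
      by (rule mult_left_mono[OF Suc nonneg])
    also have "\<dots> = (m 1 * m (Suc k)) * m 0 ^ k" by simp
    also have "\<dots> \<le> (m 0 * m (Suc (Suc k))) * m 0 ^ k"
      by (intro mult_right_mono step zero_le_power nonneg)
    finally show ?case by (simp add: mult_ac)
  qed
qed

lemma nat_even_or_odd:
  obtains i where "j = i + i" | i where "j = Suc (i + i)"
  using parity_cases[of j] by (metis evenE mult_2 oddE Suc_eq_plus1)

section \<open>Moments of a positive bounded operator\<close>

text \<open>Interpreted twice: for the Laplacian, and for \<open>P - m\<close> with bound 2 when the
  bottom of the spectrum is located.\<close>

locale positive_operator =
  fixes L :: "'v::real_inner \<Rightarrow> 'v" and b :: real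
  assumes linear_L: "linear L"
    and sym: "inner (L x) y = inner x (L y)"
    and pos: "0 \<le> inner (L x) x"
    and upper: "inner (L x) x \<le> b * inner x x"
    and b_pos: "0 < b"
begin

lemmas L_simps = linear_add[OF linear_L] linear_diff[OF linear_L] linear_cmul[OF linear_L]
  linear_0[OF linear_L] linear_neg[OF linear_L]

lemma linear_L_power: "linear (L ^^ j)"
proof (induction j)
  case 0
  then show ?case by (simp add: linear_iff)
next
  case (Suc j)
  then show ?case using linear_compose[OF Suc linear_L] by (simp add: o_def)
qed

lemma inner_L_power: "inner ((L ^^ (i + j)) x) y = inner ((L ^^ i) x) ((L ^^ j) y)"
proof (induction j arbitrary: y)
  case 0
  then show ?case by simp
next
  case (Suc j)
  have "inner ((L ^^ (i + Suc j)) x) y = inner ((L ^^ (i + j)) x) (L y)"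
    by (simp add: sym)
  also have "\<dots> = inner ((L ^^ i) x) ((L ^^ j) (L y))" by (rule Suc)
  finally show ?case by (simp add: funpow_swap1)
qed

text \<open>In the spectral theorem this is the integral of \<open>t^j\<close> against the spectral
  measure of \<open>x\<close>.\<close>

definition moment :: "'v \<Rightarrow> nat \<Rightarrow> real" where
  "moment x j = inner ((L ^^ j) x) x"

lemma moment_double: "moment x (i + i) = (norm ((L ^^ i) x))\<^sup>2"
  by (simp add: moment_def inner_L_power power2_norm_eq_inner)

lemma moment_Suc_double: "moment x (Suc (i + i)) = inner (L ((L ^^ i) x)) ((L ^^ i) x)"
  unfolding moment_def using inner_L_power[of "Suc i" i x x] by simp

text \<open>With half of the factors moved to the right, even moments are squared norms and odd ones
  are values of the form of \<open>L\<close>. The inequalities between consecutive moments rest on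
  this parity split.\<close>

lemma moment_nonneg: "0 \<le> moment x j"
proof (cases j rule: nat_even_or_odd)
  case (1 i)
  then show ?thesis by (simp add: moment_double)
next
  case (2 i)
  then show ?thesis by (simp add: moment_Suc_double pos)
qed

text \<open>This is \<open>L^2 \<le> b L\<close>. Cauchy-Schwarz for the form of \<open>L\<close> at
  \<open>x\<close> and \<open>L x\<close>, with \<open>upper\<close> at \<open>L x\<close>, leaves a
  common factor \<open>|L x|^2\<close> to cancel.\<close>

lemma norm_L_le: "(norm (L x))\<^sup>2 \<le> b * inner (L x) x"
proof -
  have "(inner (L x) (L x))\<^sup>2 \<le> inner (L x) x * inner (L (L x)) (L x)"
    by (rule psd_Cauchy_Schwarz[OF linear_L sym pos])
  also have "\<dots> \<le> inner (L x) x * (b * inner (L x) (L x))"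
    by (rule mult_left_mono[OF upper pos])
  finally have "inner (L x) (L x) * inner (L x) (L x) \<le> inner (L x) (L x) * (b * inner (L x) x)"
    by (simp add: power2_eq_square mult_ac)
  then have "inner (L x) (L x) \<le> b * inner (L x) x"
    using pos[of x] b_pos
    by (cases "L x = 0") (auto simp: mult_le_cancel_left)
  then show ?thesis by (simp add: power2_norm_eq_inner)
qed

lemma moment_Suc_le: "moment x (Suc j) \<le> b * moment x j"
proof (cases j rule: nat_even_or_odd)
  case (1 i)
  then show ?thesis
    using upper[of "(L ^^ i) x"]
    by (simp only: moment_double moment_Suc_double power2_norm_eq_inner)
next
  case (2 i)
  have "moment x (Suc j) = (norm (L ((L ^^ i) x)))\<^sup>2"
    using moment_double[of x "Suc i"] 2 by simp
  then show ?thesis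
    using norm_L_le[of "(L ^^ i) x"] 2 by (simp only: moment_Suc_double)
qed

lemma moment_add_le: "moment x (i + j) \<le> b ^ j * moment x i"
proof (induction j)
  case 0
  then show ?case by simp
next
  case (Suc j)
  have "moment x (i + Suc j) \<le> b * moment x (i + j)" using moment_Suc_le by simp
  also have "\<dots> \<le> b * (b ^ j * moment x i)" using Suc b_pos by simp
  finally show ?case by (simp add: mult_ac)
qed

text \<open>Cauchy-Schwarz between \<open>L^i x\<close> and \<open>L^(i+1) x\<close>, for the inner
  product if \<open>j = 2 i\<close> and for the form of \<open>L\<close> if
  \<open>j = 2 i + 1\<close>.\<close>

lemma moment_log_convex: "(moment x (Suc j))\<^sup>2 \<le> moment x j * moment x (Suc (Suc j))"
proof (cases j rule: nat_even_or_odd)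
  case (1 i)
  have "moment x (Suc (Suc (i + i))) = (norm ((L ^^ Suc i) x))\<^sup>2"
    using moment_double[of x "Suc i"] by simp
  moreover have "(inner (L ((L ^^ i) x)) ((L ^^ i) x))\<^sup>2
      \<le> (norm ((L ^^ i) x))\<^sup>2 * (norm ((L ^^ Suc i) x))\<^sup>2"
    using Cauchy_Schwarz_ineq[of "(L ^^ Suc i) x" "(L ^^ i) x"]
    by (simp add: power2_norm_eq_inner mult.commute)
  ultimately show ?thesis unfolding 1 by (simp only: moment_double moment_Suc_double)
next
  case (2 i)
  let ?y = "(L ^^ i) x"
  have "moment x (Suc j) = inner (L ?y) (L ?y)"
    using moment_double[of x "Suc i"] 2 by (simp add: power2_norm_eq_inner)
  moreover have "moment x (Suc (Suc j)) = inner (L (L ?y)) (L ?y)"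
    using moment_Suc_double[of x "Suc i"] 2 by simp
  ultimately show ?thesis
    using psd_Cauchy_Schwarz[OF linear_L sym pos, of ?y "L ?y"]
    unfolding 2 by (simp add: moment_Suc_double)
qed

text \<open>Jensen's inequality for the spectral measure and the function \<open>t^k\<close>. It
  converts a lower bound for the form of \<open>L\<close> into one for the form of
  \<open>L^k\<close>.\<close>

lemma moment_power_le:
  assumes "1 \<le> k"
  shows "(inner (L x) x) ^ k \<le> moment x k * ((norm x)\<^sup>2) ^ (k - 1)"
  using log_convex_power_le[of "moment x" "k - 1", OF moment_nonneg moment_log_convex] assms
  by (simp add: moment_def power2_norm_eq_inner)

section \<open>The operator 1 - L^k\<close>

definition A :: "nat \<Rightarrow> 'v \<Rightarrow> 'v" where
  "A k x = x - (L ^^ k) x"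

lemma linear_A: "linear (A k)"
  by (rule linearI)
    (simp_all add: A_def linear_add[OF linear_L_power] linear_cmul[OF linear_L_power] algebra_simps)

lemma sym_L_power: "inner ((L ^^ j) x) y = inner x ((L ^^ j) y)"
  using inner_L_power[of 0 j x y] by simp

lemma sym_A: "inner (A k x) y = inner x (A k y)"
  by (simp add: A_def inner_diff_left inner_diff_right sym_L_power)

lemma sym_A_power: "inner ((A k ^^ n) x) y = inner x ((A k ^^ n) y)"
proof (induction n arbitrary: y)
  case 0
  then show ?case by simp
next
  case (Suc n)
  have "inner ((A k ^^ Suc n) x) y = inner ((A k ^^ n) x) (A k y)" by (simp add: sym_A)
  also have "\<dots> = inner x ((A k ^^ n) (A k y))" by (rule Suc)
  finally show ?case by (simp add: funpow_swap1)
qed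

lemma linear_A_power: "linear (A k ^^ n)"
proof (induction n)
  case 0
  then show ?case by (simp add: linear_iff)
next
  case (Suc n)
  then show ?case using linear_compose[OF Suc linear_A] by (simp add: o_def)
qed

text \<open>The square expands to \<open>m_0 - 2 m_k + m_(2k)\<close>, and
  \<open>m_(2k) \<le> b^k m_k\<close>.\<close>

lemma norm_A_le: "(norm (A k x))\<^sup>2 \<le> (norm x)\<^sup>2 - (2 - b ^ k) * moment x k"
proof -
  have "(norm (A k x))\<^sup>2 = (norm x)\<^sup>2 - 2 * moment x k + moment x (k + k)"
    unfolding moment_double
    by (simp add: A_def power2_norm_eq_inner moment_def inner_diff_left inner_diff_right inner_commute)
  then show ?thesis using moment_add_le[of x k k] by (simp add: algebra_simps)
qed

lemma norm_A_contraction: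
  assumes "b ^ k \<le> 2"
  shows "norm ((A k ^^ n) x) \<le> norm x"
proof (induction n)
  case 0
  then show ?case by simp
next
  case (Suc n)
  have "0 \<le> (2 - b ^ k) * moment ((A k ^^ n) x) k"
    using assms moment_nonneg by simp
  then have "(norm ((A k ^^ Suc n) x))\<^sup>2 \<le> (norm ((A k ^^ n) x))\<^sup>2"
    using norm_A_le[of k "(A k ^^ n) x"] unfolding funpow.simps o_apply by linarith
  then have "norm ((A k ^^ Suc n) x) \<le> norm ((A k ^^ n) x)"
    by (rule power2_le_imp_le) simp
  then show ?case using Suc by linarith
qed

section \<open>Chebyshev polynomials of the operator\<close>

text \<open>The affine function of \<open>L\<close> that carries \<open>[0, b]\<close> onto
  \<open>[-1, 1]\<close>.\<close>

definition Q :: "'v \<Rightarrow> 'v" where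
  "Q x = x - (2 / b) *\<^sub>R L x"

definition D :: "'v \<Rightarrow> 'v" where
  "D x = x - Q (Q x)"

text \<open>For \<open>Q = cos \<phi>\<close> these are the addition formulas for
  \<open>cos ((n + 1) \<phi>)\<close> and \<open>sin ((n + 1) \<phi>) / sin \<phi>\<close>. Carrying
  both sequences lets the quadratic identity that bounds \<open>T n\<close> go through by
  induction.\<close>

primrec cheb :: "nat \<Rightarrow> 'v \<Rightarrow> 'v \<times> 'v" where
  "cheb 0 x = (x, 0)"
| "cheb (Suc n) x = (Q (fst (cheb n x)) - D (snd (cheb n x)), Q (snd (cheb n x)) + fst (cheb n x))"

definition T :: "nat \<Rightarrow> 'v \<Rightarrow> 'v" where
  "T n x = fst (cheb n x)"

lemma linear_Q: "linear Q"
  by (rule linearI) (simp_all add: Q_def L_simps algebra_simps)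

lemma linear_D: "linear D"
  by (rule linearI) (simp_all add: D_def linear_add[OF linear_Q] linear_cmul[OF linear_Q] algebra_simps)

lemma sym_Q: "inner (Q x) y = inner x (Q y)"
  by (simp add: Q_def inner_diff_left inner_diff_right sym)

text \<open>\<open>D\<close> is positive because \<open>Q\<close> is a contraction, which is
  \<open>norm_L_le\<close> rewritten.\<close>

lemma D_nonneg: "0 \<le> inner (D x) x"
proof -
  have "inner (D x) x = inner x x - inner (Q x) (Q x)"
    by (simp add: D_def inner_diff_left sym_Q)
  also have "\<dots> = (4 / b\<^sup>2) * (b * inner (L x) x - inner (L x) (L x))"
    using b_pos by (simp add: Q_def inner_diff_left inner_diff_right
        inner_commute field_simps power2_eq_square)
  also have "\<dots> \<ge> 0" using norm_L_le[of x] by (simp add: power2_norm_eq_inner)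
  finally show ?thesis .
qed

text \<open>The two components of \<open>cheb n x\<close> are $T_n(Q)x$ and $U_{n-1}(Q)x$, for which Pell's identity
  $T_n^2 + (1 - Q^2) U_{n-1}^2 = 1$ holds.\<close>

lemma cheb_Pell: "(norm (fst (cheb n x)))\<^sup>2 + inner (D (snd (cheb n x))) (snd (cheb n x)) = (norm x)\<^sup>2"
proof (induction n)
  case 0
  then show ?case by (simp add: linear_0[OF linear_D])
next
  case (Suc n)
  define t u where "t = fst (cheb n x)" and "u = snd (cheb n x)"
  have "inner t (Q u) = inner u (Q t)" "inner t (Q (Q (Q u))) = inner u (Q (Q (Q t)))"
    by (subst inner_commute, simp add: sym_Q)+
  then have "(norm (Q t - D u))\<^sup>2 + inner (D (Q u + t)) (Q u + t) = (norm t)\<^sup>2 + inner (D u) u"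
    by (simp add: power2_norm_eq_inner D_def inner_diff_left inner_diff_right inner_add_left
        inner_add_right linear_add[OF linear_Q] linear_diff[OF linear_Q] sym_Q inner_commute)
  then show ?case using Suc by (simp add: t_def u_def)
qed

lemma norm_T_le: "norm (T n x) \<le> norm x"
proof -
  have "(norm (T n x))\<^sup>2 \<le> (norm x)\<^sup>2"
    using cheb_Pell[of n x] D_nonneg[of "snd (cheb n x)"] unfolding T_def by linarith
  then show ?thesis by (rule power2_le_imp_le) simp
qed

lemma T_0 [simp]: "T 0 x = x"
  by (simp add: T_def)

lemma T_1 [simp]: "T (Suc 0) x = Q x"
  by (simp add: T_def linear_0[OF linear_D])

text \<open>The second component is eliminated through \<open>D = 1 - Q^2\<close>.\<close>

lemma T_Suc_Suc: "T (Suc (Suc n)) x = 2 *\<^sub>R Q (T (Suc n) x) - T n x"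
proof -
  define t u where "t = fst (cheb n x)" and "u = snd (cheb n x)"
  have "Q (Q t - D u) - D (Q u + t) = 2 *\<^sub>R Q (Q t - D u) - t"
    by (simp add: D_def linear_add[OF linear_Q] linear_diff[OF linear_Q] scaleR_2)
  then show ?thesis by (simp add: T_def t_def u_def)
qed

text \<open>Indexing by \<open>|j|\<close> makes the recurrence valid for every integer, including
  \<open>j = 0\<close>, where both neighbours are \<open>T 1\<close>. Sending \<open>z^j\<close> to
  \<open>T (nat |j|)\<close> thus turns multiplication by \<open>(z + 1/z) / 2\<close> into
  \<open>Q\<close>.\<close>

lemma Q_T: "Q (T (nat \<bar>j\<bar>) x) = (1 / 2) *\<^sub>R (T (nat \<bar>j + 1\<bar>) x + T (nat \<bar>j - 1\<bar>) x)" for j :: int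
proof -
  have nn: "Q (T (nat \<bar>j\<bar>) x) = (1 / 2) *\<^sub>R (T (nat \<bar>j + 1\<bar>) x + T (nat \<bar>j - 1\<bar>) x)" if "j \<ge> 0" for j :: int
  proof (cases "j = 0")
    case True
    then show ?thesis by (simp add: scaleR_2[symmetric])
  next
    case False
    define n where "n = nat (j - 1)"
    have j: "nat \<bar>j\<bar> = Suc n" "nat \<bar>j + 1\<bar> = Suc (Suc n)" "nat \<bar>j - 1\<bar> = n"
      using that False by (auto simp: n_def)
    show ?thesis unfolding j by (simp add: T_Suc_Suc)
  qed
  show ?thesis
  proof (cases "j \<ge> 0")
    case True
    then show ?thesis by (rule nn)
  next
    case False
    have e: "\<bar>- j + 1\<bar> = \<bar>j - 1\<bar>" "\<bar>- j - 1\<bar> = \<bar>j + 1\<bar>" "\<bar>- j\<bar> = \<bar>j\<bar>" by auto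
    have "0 \<le> - j" using False by simp
    then show ?thesis using nn[of "- j"] unfolding e by (simp only: add.commute)
  qed
qed

lemma L_T: "L (T (nat \<bar>j\<bar>) x)
  = (b / 2) *\<^sub>R T (nat \<bar>j\<bar>) x - (b / 4) *\<^sub>R T (nat \<bar>j + 1\<bar>) x - (b / 4) *\<^sub>R T (nat \<bar>j - 1\<bar>) x" for j :: int
proof -
  have *: "L y = (b / 2) *\<^sub>R y - (b / 2) *\<^sub>R Q y" for y
    using b_pos by (simp add: Q_def scaleR_diff_right)
  show ?thesis by (simp add: * [of "T (nat \<bar>j\<bar>) x"] Q_T scaleR_add_right)
qed

end

section \<open>Laurent polynomials\<close>

lemma scaleR_conv_mult: "r *\<^sub>R c = single 0 r * (c :: 'i::monoid_add \<Rightarrow>\<^sub>0 real)"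
  by (subst mult_map_scale_conv_mult[symmetric], rule poly_mapping_eqI) (simp add: map.rep_eq when_def)

lemma mult_scaleR_poly_mapping: "d * (r *\<^sub>R c) = r *\<^sub>R (d * (c :: 'i::comm_monoid_add \<Rightarrow>\<^sub>0 real))"
  by (simp add: scaleR_conv_mult mult_ac)

lemma linear_mult_left_poly_mapping: "linear (\<lambda>c. d * (c :: 'i::comm_monoid_add \<Rightarrow>\<^sub>0 real))"
  by (rule linearI) (simp_all add: algebra_simps mult_scaleR_poly_mapping)

text \<open>The image of \<open>L = (b/2) (1 - Q)\<close> when \<open>Q\<close> becomes
  \<open>(z + 1/z) / 2\<close>.\<close>

definition laurent_symbol :: "real \<Rightarrow> int \<Rightarrow>\<^sub>0 real" where
  "laurent_symbol b = single 0 (b / 2) - single 1 (b / 4) - single (-1) (b / 4)"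

definition laurent_coeffs :: "real \<Rightarrow> nat \<Rightarrow> nat \<Rightarrow> int \<Rightarrow>\<^sub>0 real" where
  "laurent_coeffs b k n = (1 - laurent_symbol b ^ k) ^ n"

lemma symbol_mult_single:
  "laurent_symbol b * single j 1 = single j (b / 2) - single (j + 1) (b / 4) - single (j - 1) (b / 4)"
  by (simp add: laurent_symbol_def left_diff_distrib mult_single add.commute)

context positive_operator
begin

lemma lin_ext_symbol_mult:
  "lin_ext (\<lambda>j. T (nat \<bar>j\<bar>) x) (laurent_symbol b * c) = L (lin_ext (\<lambda>j. T (nat \<bar>j\<bar>) x) c)"
proof (rule linear_eq_on_single[where c = c])
  show "linear (\<lambda>c. lin_ext (\<lambda>j. T (nat \<bar>j\<bar>) x) (laurent_symbol b * c))"
    using linear_compose[OF linear_mult_left_poly_mapping linear_lin_ext] by (simp add: o_def)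
  show "linear (\<lambda>c. L (lin_ext (\<lambda>j. T (nat \<bar>j\<bar>) x) c))"
    using linear_compose[OF linear_lin_ext linear_L] by (simp add: o_def)
  show "lin_ext (\<lambda>j. T (nat \<bar>j\<bar>) x) (laurent_symbol b * single i 1)
      = L (lin_ext (\<lambda>j. T (nat \<bar>j\<bar>) x) (single i 1))" for i
    by (simp add: symbol_mult_single linear_diff[OF linear_lin_ext] L_T)
qed

lemma lin_ext_symbol_power_mult:
  "lin_ext (\<lambda>j. T (nat \<bar>j\<bar>) x) (laurent_symbol b ^ k * c)
    = (L ^^ k) (lin_ext (\<lambda>j. T (nat \<bar>j\<bar>) x) c)"
  by (induction k) (simp_all add: mult.assoc lin_ext_symbol_mult)

text \<open>Terms \<open>j\<close> and \<open>-j\<close> carry the same operator but stay separate,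
  so that the coefficients are those of a power of a Laurent polynomial and can be estimated on
  circles.\<close>

lemma A_power_eq_lin_ext: "(A k ^^ n) x = lin_ext (\<lambda>j. T (nat \<bar>j\<bar>) x) (laurent_coeffs b k n)"
proof (induction n)
  case 0
  have "lin_ext (\<lambda>j. T (nat \<bar>j\<bar>) x) (single 0 1) = x" by (subst lin_ext_single) simp
  then show ?case by (simp add: laurent_coeffs_def)
next
  case (Suc n)
  have "laurent_coeffs b k (Suc n) = laurent_coeffs b k n - laurent_symbol b ^ k * laurent_coeffs b k n"
    by (simp add: laurent_coeffs_def algebra_simps)
  then show ?case
    using Suc by (simp add: linear_diff[OF linear_lin_ext] lin_ext_symbol_power_mult A_def)
qed

end

lemma keys_mult_int_bound:
  fixes c d :: "int \<Rightarrow>\<^sub>0 real"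
  assumes "keys c \<subseteq> {-p..p}" "keys d \<subseteq> {-q..q}"
  shows "keys (c * d) \<subseteq> {-(p + q)..p + q}"
  using keys_mult[of c d] assms by fastforce

lemma keys_power_int_bound:
  fixes c :: "int \<Rightarrow>\<^sub>0 real"
  assumes "keys c \<subseteq> {-p..p}"
  shows "keys (c ^ n) \<subseteq> {-(int n * p)..int n * p}"
proof (induction n)
  case 0
  then show ?case by simp
next
  case (Suc n)
  show ?case using keys_mult_int_bound[OF assms Suc] by (simp add: algebra_simps)
qed

text \<open>The degree bound tells how many roots of unity separate the coefficients, and makes
  tails beyond \<open>n k\<close> empty.\<close>

lemma keys_laurent_coeffs: "keys (laurent_coeffs b k n) \<subseteq> {- int (n * k)..int (n * k)}"
proof -
  have "keys (laurent_symbol b) \<subseteq> {-1..1}"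
    by (auto simp: in_keys_iff laurent_symbol_def lookup_minus lookup_single when_def split: if_splits)
  from keys_power_int_bound[OF this, of k]
  have "keys (laurent_symbol b ^ k) \<subseteq> {- int k..int k}" by simp
  then have "keys (1 - laurent_symbol b ^ k) \<subseteq> {- int k..int k}"
    by (auto simp: in_keys_iff lookup_minus lookup_one when_def split: if_splits)
  from keys_power_int_bound[OF this, of n] show ?thesis by (simp add: laurent_coeffs_def)
qed

section \<open>Evaluation on circles and recovery of coefficients\<close>

definition laurent_eval :: "complex \<Rightarrow> (int \<Rightarrow>\<^sub>0 real) \<Rightarrow> complex" where
  "laurent_eval z = lin_ext (\<lambda>j. z powi j)"

lemma linear_laurent_eval: "linear (laurent_eval z)"
  unfolding laurent_eval_def by (rule linear_lin_ext)

lemma laurent_eval_single: "laurent_eval z (single j a) = of_real a * z powi j"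
  by (simp add: laurent_eval_def scaleR_conv_of_real)

lemma laurent_eval_one [simp]: "laurent_eval z 1 = 1"
  using laurent_eval_single[of z 0 1] by simp

lemma laurent_eval_mult:
  assumes "z \<noteq> 0"
  shows "laurent_eval z (c * d) = laurent_eval z c * laurent_eval z d"
proof (rule linear_eq_on_single[where c = d])
  show "linear (\<lambda>d. laurent_eval z (c * d))"
    using linear_compose[OF linear_mult_left_poly_mapping linear_laurent_eval] by (simp add: o_def)
  show "linear (\<lambda>d. laurent_eval z c * laurent_eval z d)"
    by (rule linearI)
      (simp_all add: linear_add[OF linear_laurent_eval] linear_cmul[OF linear_laurent_eval] algebra_simps)
  fix j
  show "laurent_eval z (c * single j 1) = laurent_eval z c * laurent_eval z (single j 1)"
  proof (rule linear_eq_on_single[where c = c])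
    show "linear (\<lambda>c. laurent_eval z (c * single j 1))"
      using linear_compose[OF linear_mult_left_poly_mapping[of "single j 1"] linear_laurent_eval[of z]]
      by (simp add: o_def mult.commute)
    show "linear (\<lambda>c. laurent_eval z c * laurent_eval z (single j 1))"
      by (rule linearI)
        (simp_all add: linear_add[OF linear_laurent_eval] linear_cmul[OF linear_laurent_eval] algebra_simps)
    fix i
    show "laurent_eval z (single i 1 * single j 1) = laurent_eval z (single i 1) * laurent_eval z (single j 1)"
      using assms by (simp add: mult_single laurent_eval_single power_int_add)
  qed
qed

lemma laurent_eval_power:
  assumes "z \<noteq> 0"
  shows "laurent_eval z (c ^ n) = laurent_eval z c ^ n"
  by (induction n) (simp_all add: laurent_eval_mult[OF assms])

lemma laurent_eval_coeffs:
  assumes "z \<noteq> 0"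
  shows "laurent_eval z (laurent_coeffs b k n) = (1 - (b / 2 - b / 4 * (z + 1 / z)) ^ k) ^ n"
proof -
  have "laurent_eval z (laurent_symbol b) = b / 2 - b / 4 * (z + 1 / z)"
    by (simp only: laurent_symbol_def linear_diff[OF linear_laurent_eval] laurent_eval_single)
      (simp add: power_int_minus inverse_eq_divide distrib_left)
  then show ?thesis
    by (simp add: laurent_coeffs_def laurent_eval_power[OF assms] linear_diff[OF linear_laurent_eval])
qed

text \<open>A geometric sum whose ratio \<open>q\<close> satisfies \<open>q^M = 1\<close>. If
  \<open>q = 1\<close>, then \<open>M\<close> divides \<open>m\<close>, which forces
  \<open>m = 0\<close>.\<close>

lemma sum_roots_of_unity:
  fixes M :: nat and m :: int
  assumes "0 < M" "\<bar>m\<bar> < int M"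
  shows "(\<Sum>l<M. cis (2 * pi * real l / real M) powi m) = (if m = 0 then of_nat M else 0)"
proof (cases "m = 0")
  case True
  then show ?thesis by simp
next
  case False
  define q where "q = cis (2 * pi * real_of_int m / real M)"
  have pow: "cis (2 * pi * real l / real M) powi m = q ^ l" for l
    by (simp add: q_def Complex.DeMoivre cis_power_int mult_ac)
  have qM: "q ^ M = 1"
    using assms by (simp add: q_def Complex.DeMoivre)
  have "q \<noteq> 1"
  proof
    assume "q = 1"
    then have "cos (2 * pi * real_of_int m / real M) = 1"
      by (simp add: q_def complex_eq_iff)
    then obtain i :: int where "2 * pi * real_of_int m / real M = real_of_int i * 2 * pi"
      using cos_one_2pi_int by auto
    then have "real_of_int m = real_of_int i * real M"
      using assms by (simp add: field_simps)
    then have "m = i * int M"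
      by (metis of_int_eq_iff of_int_mult of_int_of_nat_eq)
    then show False
      using assms False by (simp add: abs_mult)
  qed
  then show ?thesis
    using geometric_sum[OF \<open>q \<noteq> 1\<close>, of M] qM False by (simp add: pow)
qed

text \<open>Cauchy's coefficient formula, with \<open>M\<close> equally spaced points instead of an
  integral over the circle of radius \<open>r\<close>. It is exact: two exponents differ by at most
  \<open>2 p < M\<close>, so there is no aliasing.\<close>

lemma laurent_lookup_eq:
  fixes c :: "int \<Rightarrow>\<^sub>0 real"
  assumes keys: "keys c \<subseteq> {-int p..int p}" and M: "2 * p < M" and j: "j \<in> keys c" and r: "0 < r"
  shows "of_real (lookup c j * r powi j * real M)
    = (\<Sum>l<M. laurent_eval (of_real r * cis (2 * pi * real l / real M)) c
          * cis (2 * pi * real l / real M) powi (- j))"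
proof -
  define w where "w l = cis (2 * pi * real l / real M)" for l :: nat
  have w0: "w l \<noteq> 0" for l by (simp add: w_def)
  have split: "w l powi (i - j) = w l powi i * w l powi (- j)" for l i
    using power_int_add[of "w l" i "- j"] w0 by simp
  have "(\<Sum>l<M. laurent_eval (of_real r * w l) c * w l powi (- j))
      = (\<Sum>l<M. \<Sum>i\<in>keys c. of_real (lookup c i * r powi i) * w l powi (i - j))"
    unfolding laurent_eval_def lin_ext_def sum_distrib_right scaleR_conv_of_real
    by (intro sum.cong refl) (simp add: power_int_mult_distrib split mult_ac)
  also have "\<dots> = (\<Sum>i\<in>keys c. of_real (lookup c i * r powi i) * (\<Sum>l<M. w l powi (i - j)))"
    by (subst sum.swap) (simp add: sum_distrib_left)
  also have "\<dots> = (\<Sum>i\<in>keys c. of_real (lookup c i * r powi i) * (if i = j then of_nat M else 0))"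
  proof (rule sum.cong[OF refl])
    fix i assume "i \<in> keys c"
    then have "i \<in> {-int p..int p}" "j \<in> {-int p..int p}" using keys j by auto
    then have "\<bar>i - j\<bar> < int M" using M by auto
    then show "of_real (lookup c i * r powi i) * (\<Sum>l<M. w l powi (i - j))
      = of_real (lookup c i * r powi i) * (if i = j then of_nat M else (0::complex))"
      using M sum_roots_of_unity[of M "i - j"] by (simp add: w_def)
  qed
  also have "\<dots> = of_real (lookup c j * r powi j * real M)"
  proof -
    have "(\<Sum>i\<in>keys c. of_real (lookup c i * r powi i) * (if i = j then of_nat M else (0::complex)))
        = (\<Sum>i\<in>keys c. if i = j then of_real (lookup c j * r powi j * real M) else 0)"
      by (rule sum.cong) auto
    then show ?thesis using j by simp
  qed
  finally show ?thesis by (simp add: w_def)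
qed

lemma abs_laurent_lookup_le:
  fixes c :: "int \<Rightarrow>\<^sub>0 real"
  assumes keys: "keys c \<subseteq> {-int p..int p}" and M: "2 * p < M" and r: "0 < r"
  shows "\<bar>lookup c j\<bar> * r powi j * real M
    \<le> (\<Sum>l<M. norm (laurent_eval (of_real r * cis (2 * pi * real l / real M)) c))"
proof (cases "j \<in> keys c")
  case True
  have "\<bar>lookup c j\<bar> * r powi j * real M = norm (complex_of_real (lookup c j * r powi j * real M))"
    using r by (simp add: norm_mult norm_power_int abs_mult)
  also have "\<dots> \<le> (\<Sum>l<M. norm (laurent_eval (of_real r * cis (2 * pi * real l / real M)) c
          * cis (2 * pi * real l / real M) powi (- j)))"
    unfolding laurent_lookup_eq[OF keys M True r] by (rule norm_sum)
  finally show ?thesis by (simp add: norm_mult norm_power_int)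
next
  case False
  then show ?thesis by (simp add: in_keys_iff sum_nonneg)
qed

lemma norm_power_diff_le:
  fixes x y :: "'a::{real_normed_algebra_1,comm_ring_1}"
  assumes "norm x \<le> R" "norm y \<le> R"
  shows "norm (x ^ Suc n - y ^ Suc n) \<le> real (Suc n) * norm (x - y) * R ^ n"
proof (induction n)
  case 0
  then show ?case by simp
next
  case (Suc n)
  have R: "0 \<le> R" using assms(1) norm_ge_zero order_trans by blast
  have "x ^ Suc (Suc n) - y ^ Suc (Suc n) = x * (x ^ Suc n - y ^ Suc n) + (x - y) * y ^ Suc n"
    by (simp add: algebra_simps)
  also have "norm \<dots> \<le> norm x * norm (x ^ Suc n - y ^ Suc n) + norm (x - y) * norm (y ^ Suc n)"
    by (intro norm_triangle_le add_mono norm_mult_ineq)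
  also have "\<dots> \<le> R * (real (Suc n) * norm (x - y) * R ^ n) + norm (x - y) * R ^ Suc n"
  proof (intro add_mono mult_mono assms Suc R mult_nonneg_nonneg norm_ge_zero order_refl)
    have "norm (y ^ Suc n) \<le> norm y ^ Suc n" by (rule norm_power_ineq)
    also have "\<dots> \<le> R ^ Suc n" by (rule power_mono[OF assms(2)]) simp
    finally show "norm (y ^ Suc n) \<le> R ^ Suc n" .
  qed
  also have "\<dots> = real (Suc (Suc n)) * norm (x - y) * R ^ Suc n"
    by (simp add: algebra_simps)
  finally show ?case .
qed

lemma abs_exp_minus_one_le:
  assumes "\<bar>x\<bar> \<le> 1 / 2"
  shows "\<bar>exp x - 1\<bar> \<le> 2 * \<bar>x::real\<bar>"
  using exp_bound_lemma[of x] assms exp_ge_add_one_self[of x]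
  unfolding real_norm_def abs_exp_cancel by linarith

section \<open>Decay of the Chebyshev coefficients\<close>

text \<open>Since \<open>2 - z - 1/z = - (z^(1/2) - z^(-1/2))^2\<close>, the number
  \<open>\<zeta>\<close> is the sine of the complex half angle
  \<open>(\<theta> - \<i> s) / 2\<close>; the imaginary shift moves it by at most \<open>|s|\<close>
  from \<open>sin (\<theta> / 2)\<close>.\<close>

lemma symbol_eq_sin_squared:
  fixes s \<theta> b :: real and z :: complex
  defines "z \<equiv> complex_of_real (exp s) * cis \<theta>"
  obtains \<zeta> :: complex where "complex_of_real b / 2 - b / 4 * (z + 1 / z) = b * \<zeta>\<^sup>2"
    and "\<bar>s\<bar> \<le> 1 \<Longrightarrow> norm (\<zeta> - complex_of_real (sin (\<theta> / 2))) \<le> \<bar>s\<bar>"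
proof -
  define p u where "p = complex_of_real (exp (s / 2))" and "u = cis (\<theta> / 2)"
  define \<zeta> where "\<zeta> = (p * u - 1 / (p * u)) / (2 * \<i>)"
  have nz: "p \<noteq> 0" "u \<noteq> 0" by (simp_all add: p_def u_def)
  have z: "z = (p * u)\<^sup>2"
    by (simp add: z_def p_def u_def power_mult_distrib Complex.DeMoivre flip: of_real_power)
      (simp add: power2_eq_square flip: exp_add)
  have "complex_of_real b / 2 - b / 4 * (z + 1 / z) = b * \<zeta>\<^sup>2"
    unfolding z \<zeta>_def using nz by (simp add: field_simps power2_eq_square)
  moreover have "norm (\<zeta> - complex_of_real (sin (\<theta> / 2))) \<le> \<bar>s\<bar>" if s: "\<bar>s\<bar> \<le> 1"
  proof -
    have "u - 1 / u = 2 * \<i> * complex_of_real (sin (\<theta> / 2))"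
      by (simp add: u_def inverse_eq_divide[symmetric] cis_inverse complex_eq_iff)
    then have "\<zeta> - complex_of_real (sin (\<theta> / 2)) = ((p - 1) * u - (1 / p - 1) * (1 / u)) / (2 * \<i>)"
      using nz by (simp add: \<zeta>_def field_simps)
    also have "norm \<dots> \<le> (norm ((p - 1) * u) + norm ((1 / p - 1) * (1 / u))) / 2"
    proof -
      have "norm (x / (2 * \<i>)) = norm x / 2" for x :: complex
        by (simp add: norm_divide norm_mult)
      then show ?thesis by (simp only:) (intro divide_right_mono norm_triangle_ineq4, simp)
    qed
    also have "\<dots> = (\<bar>exp (s / 2) - 1\<bar> + \<bar>exp (- s / 2) - 1\<bar>) / 2"
    proof -
      have "1 / p - 1 = complex_of_real (exp (- s / 2) - 1)" "p - 1 = complex_of_real (exp (s / 2) - 1)"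
        by (simp_all add: p_def exp_minus inverse_eq_divide)
      then show ?thesis
        by (simp only: norm_mult norm_of_real norm_divide) (simp add: u_def)
    qed
    also have "\<dots> \<le> (2 * \<bar>s / 2\<bar> + 2 * \<bar>- s / 2\<bar>) / 2"
      using s by (intro divide_right_mono add_mono abs_exp_minus_one_le) auto
    finally show ?thesis by simp
  qed
  ultimately show ?thesis using that by blast
qed

text \<open>If \<open>1 - B y\<close> is negative, then \<open>B y - 1 \<le> 1 - (2 - B) y\<close>
  because \<open>y \<le> 1\<close>. Here \<open>B < 2\<close> gives a strict gain at
  \<open>y = 1\<close>, that is, at \<open>z = -1\<close>.\<close>

lemma abs_one_minus_le:
  fixes B y :: real
  assumes "0 < B" "B < 2" "0 \<le> y" "y \<le> 1"
  shows "\<bar>1 - B * y\<bar> \<le> 1 - min B (2 - B) * y"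
proof -
  have "min B (2 - B) * y \<le> B * y" using assms by (intro mult_right_mono) auto
  moreover have "(min B (2 - B) + B) * y \<le> 2 * 1"
    using assms by (intro mult_mono) auto
  ultimately show ?thesis by (auto simp: algebra_simps abs_if)
qed

text \<open>On the circle of radius \<open>exp s\<close> the argument \<open>\<zeta>\<close> of the symbol is within \<open>\<bar>s\<bar>\<close> of the real number
  \<open>t = sin (\<theta> / 2)\<close>: the error term \<open>\<bar>s\<bar> (\<bar>t\<bar> + \<bar>s\<bar>) ^ (2 k - 1)\<close> is absorbed by \<open>t ^ (2 k)\<close> when
  \<open>\<bar>t\<bar>\<close> is large compared to \<open>\<bar>s\<bar>\<close>, and is of order \<open>\<bar>s\<bar> ^ (2 k)\<close> otherwise.\<close>

lemma symbol_bound: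
  fixes b :: real and k :: nat
  assumes b: "0 < b" "b ^ k < 2" and k: "1 \<le> k"
  obtains c C where "0 < c" "0 < C"
    "\<And>s \<theta>. \<bar>s\<bar> \<le> 1 \<Longrightarrow>
      norm (1 - (complex_of_real b / 2 - b / 4 * (complex_of_real (exp s) * cis \<theta>
          + 1 / (complex_of_real (exp s) * cis \<theta>))) ^ k)
        \<le> exp (- c * \<bar>sin (\<theta> / 2)\<bar> ^ (2 * k) + C * \<bar>s\<bar> ^ (2 * k))"
proof -
  define B where "B = b ^ k"
  have B: "0 < B" "B < 2" using b by (simp_all add: B_def)
  define c0 where "c0 = min B (2 - B)"
  have c0: "0 < c0" using B by (simp add: c0_def)
  define n where "n = 2 * k - 1"
  have n: "2 * k = Suc n" using k by (simp add: n_def)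
  \<comment> \<open>When \<open>t\<close> exceeds \<open>M e\<close>, the error costs at most half
    of the gain \<open>c0\<close>; otherwise \<open>t + e\<close> is below \<open>(M + 1) e\<close>,
    the source of \<open>C\<close>.\<close>
  define M where "M = max 1 (2 * (B * real (Suc n) * 2 ^ n) / c0)"
  have M: "1 \<le> M" by (simp add: M_def)
  have "2 * (B * real (Suc n) * 2 ^ n) / c0 \<le> M" by (simp add: M_def)
  then have M': "B * real (Suc n) * 2 ^ n / M \<le> c0 / 2" using c0 M by (simp add: field_simps)
  define C where "C = B * real (Suc n) * (M + 1) ^ n"
  have C: "0 < C" using B M by (simp add: C_def)
  have main: "norm (1 - (complex_of_real b / 2 - b / 4 * (complex_of_real (exp s) * cis \<theta>
          + 1 / (complex_of_real (exp s) * cis \<theta>))) ^ k)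
        \<le> exp (- (c0 / 2) * \<bar>sin (\<theta> / 2)\<bar> ^ (2 * k) + C * \<bar>s\<bar> ^ (2 * k))"
    if s: "\<bar>s\<bar> \<le> 1" for s \<theta>
  proof -
    obtain \<zeta> :: complex where w: "complex_of_real b / 2 - b / 4 * (complex_of_real (exp s) * cis \<theta>
          + 1 / (complex_of_real (exp s) * cis \<theta>)) = b * \<zeta>\<^sup>2"
      and \<zeta>: "norm (\<zeta> - complex_of_real (sin (\<theta> / 2))) \<le> \<bar>s\<bar>"
      using symbol_eq_sin_squared[of b s \<theta>] s by metis
    define e t where "e = \<bar>s\<bar>" and "t = \<bar>sin (\<theta> / 2)\<bar>"
    have et: "0 \<le> e" "0 \<le> t" "t \<le> 1" by (simp_all add: e_def t_def)
    define y where "y = t ^ Suc n"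
    have y: "0 \<le> y" "y \<le> 1" unfolding y_def using et by (auto intro!: power_le_one simp del: power_Suc)
    have sin_pow: "complex_of_real (sin (\<theta> / 2)) ^ Suc n = of_real y"
      unfolding y_def t_def n[symmetric] by (simp add: power_mult flip: of_real_power)
    have nt: "norm (complex_of_real (sin (\<theta> / 2))) = t" by (simp only: norm_of_real t_def)
    have "norm \<zeta> \<le> norm (complex_of_real (sin (\<theta> / 2))) + norm (\<zeta> - complex_of_real (sin (\<theta> / 2)))"
      by (rule norm_triangle_sub)
    then have "norm \<zeta> \<le> t + e" using \<zeta> unfolding nt e_def by linarith
    moreover have "norm (complex_of_real (sin (\<theta> / 2))) \<le> t + e" using et nt by linarith
    ultimately have "norm (\<zeta> ^ Suc n - of_real y)
        \<le> real (Suc n) * norm (\<zeta> - complex_of_real (sin (\<theta> / 2))) * (t + e) ^ n"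
      unfolding sin_pow[symmetric] by (rule norm_power_diff_le)
    also have "\<dots> \<le> real (Suc n) * e * (t + e) ^ n"
      using \<zeta> et by (intro mult_right_mono mult_left_mono) (auto simp: e_def)
    finally have diff: "norm (\<zeta> ^ Suc n - of_real y) \<le> real (Suc n) * e * (t + e) ^ n" .
    have "1 - (of_real b * \<zeta>\<^sup>2) ^ k = of_real (1 - B * y) - of_real B * (\<zeta> ^ Suc n - of_real y)"
    proof -
      have "(\<zeta>\<^sup>2) ^ k = \<zeta> ^ Suc n" by (simp only: n[symmetric] power_mult)
      then show ?thesis by (simp add: B_def power_mult_distrib algebra_simps)
    qed
    also have "norm \<dots> \<le> \<bar>1 - B * y\<bar> + norm (complex_of_real B * (\<zeta> ^ Suc n - of_real y))"
      by (metis norm_triangle_ineq4 norm_of_real)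
    also have "\<dots> \<le> (1 - c0 * y) + B * (real (Suc n) * e * (t + e) ^ n)"
      unfolding norm_mult norm_of_real c0_def using B y diff abs_one_minus_le[of B y]
      by (intro add_mono mult_mono) auto
    finally have bound: "norm (1 - (of_real b * \<zeta>\<^sup>2) ^ k) \<le> 1 - c0 * y + B * (real (Suc n) * e * (t + e) ^ n)" .
    have "B * (real (Suc n) * e * (t + e) ^ n) \<le> c0 / 2 * y + C * e ^ Suc n"
    proof (cases "M * e \<le> t")
      case True
      have e: "e \<le> t / M" using True M by (simp add: field_simps)
      have "e \<le> t" using e M et True by (smt (verit) mult_le_cancel_right1)
      have "B * (real (Suc n) * e * (t + e) ^ n) \<le> B * (real (Suc n) * (t / M) * (2 * t) ^ n)"
        using B e et \<open>e \<le> t\<close> M by (intro mult_left_mono mult_mono power_mono) auto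
      also have "\<dots> = B * real (Suc n) * 2 ^ n / M * y"
        by (simp add: y_def power_mult_distrib)
      also have "\<dots> \<le> c0 / 2 * y" by (rule mult_right_mono[OF M' y(1)])
      also have "\<dots> \<le> c0 / 2 * y + C * e ^ Suc n" using C et by simp
      finally show ?thesis .
    next
      case False
      have "B * (real (Suc n) * e * (t + e) ^ n) \<le> B * (real (Suc n) * e * ((M + 1) * e) ^ n)"
        using B et False by (intro mult_left_mono power_mono) (auto simp: algebra_simps)
      also have "\<dots> = C * e ^ Suc n"
        by (simp add: C_def power_mult_distrib)
      also have "\<dots> \<le> c0 / 2 * y + C * e ^ Suc n" using c0 y by simp
      finally show ?thesis .
    qed
    then have "norm (1 - (of_real b * \<zeta>\<^sup>2) ^ k) \<le> 1 + (- (c0 / 2) * y + C * e ^ Suc n)"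
      using bound by simp
    also have "\<dots> \<le> exp (- (c0 / 2) * y + C * e ^ Suc n)" by (rule exp_ge_add_one_self)
    finally show ?thesis unfolding w y_def t_def e_def n .
  qed
  show ?thesis by (rule that[of "c0 / 2" C]) (use c0 C main in auto)
qed

text \<open>On this interval \<open>x^2 \<le> 4\<close>, so the cubic Taylor remainder is at most
  \<open>2 x / 3\<close>.\<close>

lemma sin_ge_third:
  assumes "0 \<le> x" "x \<le> pi / 2"
  shows "x / 3 \<le> sin (x::real)"
proof -
  have "\<bar>sin x - (\<Sum>m<3. sin_coeff m * x ^ m)\<bar> \<le> inverse (fact 3) * \<bar>x\<bar> ^ 3"
    by (rule Maclaurin_sin_bound)
  then have "\<bar>sin x - x\<bar> \<le> x ^ 3 / 6"
    using assms by (simp add: numeral_3_eq_3 sin_coeff_Suc cos_coeff_Suc fact_numeral)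
  then have "x - x ^ 3 / 6 \<le> sin x" by linarith
  moreover have "x\<^sup>2 \<le> 2\<^sup>2" using assms pi_half_less_two by (intro power_mono) auto
  then have "x * x\<^sup>2 \<le> x * 4" using assms by (intro mult_left_mono) auto
  ultimately show ?thesis by (simp add: power3_eq_cube power2_eq_square)
qed

text \<open>\<open>pi > 3\<close> absorbs the loss in \<open>sin_ge_third\<close>. Decay of the
  symbol in \<open>sin (\<theta> / 2)\<close> becomes decay in the cyclic distance of the node
  \<open>l\<close> from 0.\<close>

lemma abs_sin_roots_ge:
  fixes l M :: nat
  assumes "l < M"
  shows "min (real l) (real M - real l) / real M \<le> \<bar>sin (pi * real l / real M)\<bar>"
proof -
  have *: "x / real M \<le> sin (pi * x / real M)" if "0 \<le> x" "x \<le> real M / 2" for x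
  proof -
    have "3 * (x / real M) \<le> pi * (x / real M)"
      using pi_gt3 that assms by (intro mult_right_mono) auto
    moreover have "(pi * x / real M) / 3 \<le> sin (pi * x / real M)"
    proof (rule sin_ge_third)
      have "pi * x \<le> pi * (real M / 2)" using that by (intro mult_left_mono) auto
      then show "pi * x / real M \<le> pi / 2" using assms by (simp add: field_simps)
    qed (use that in auto)
    ultimately show ?thesis by simp
  qed
  show ?thesis
  proof (cases "real l \<le> real M / 2")
    case True
    then show ?thesis using *[of "real l"] by (simp add: min_def abs_if)
  next
    case False
    have "sin (pi * (real M - real l) / real M) = sin (pi * real l / real M)"
      using sin_pi_minus[of "pi * real l / real M"] assms by (simp add: diff_divide_distrib right_diff_distrib)
    then show ?thesis using *[of "real M - real l"] False assms by (simp add: min_def abs_if)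
  qed
qed

lemma sum_exp_le:
  fixes \<beta> :: real
  assumes "0 < \<beta>"
  shows "(\<Sum>l<M. exp (- \<beta> * real l)) \<le> 1 + 1 / \<beta>"
proof -
  define q where "q = exp (- \<beta>)"
  have q: "0 < q" "q < 1" using assms by (auto simp: q_def)
  have pow: "exp (- \<beta> * real l) = q ^ l" for l
    by (simp add: q_def exp_of_nat_mult[symmetric] mult.commute)
  have "(\<Sum>l<M. exp (- \<beta> * real l)) = (1 - q ^ M) / (1 - q)"
    using q by (simp only: pow) (simp add: sum_gp_strict)
  also have "\<dots> \<le> 1 / (1 - q)" using q by (intro divide_right_mono) auto
  also have "\<dots> \<le> 1 + 1 / \<beta>"
  proof -
    have "(1 + \<beta>) * q \<le> 1"
      using exp_ge_add_one_self[of \<beta>] by (simp add: q_def exp_minus field_simps)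
    then show ?thesis using q assms by (simp add: field_simps)
  qed
  finally show ?thesis .
qed

lemma sum_exp_min_le:
  fixes \<beta> :: real
  assumes "0 < \<beta>"
  shows "(\<Sum>l<M. exp (- \<beta> * min (real l) (real M - real l))) \<le> 2 * (1 + 1 / \<beta>)"
proof -
  let ?S = "\<Sum>l<M. exp (- \<beta> * real l)"
  have "(\<Sum>l<M. exp (- \<beta> * min (real l) (real M - real l)))
      \<le> (\<Sum>l<M. exp (- \<beta> * real l) + exp (- \<beta> * (real M - real l)))"
    by (rule sum_mono) (auto simp: min_def)
  also have "\<dots> = ?S + (\<Sum>l<M. exp (- \<beta> * (real M - real l)))"
    by (rule sum.distrib)
  also have "(\<Sum>l<M. exp (- \<beta> * (real M - real l))) = (\<Sum>l<M. exp (- \<beta> * real (Suc l)))"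
    by (rule sum.reindex_bij_witness[of _ "\<lambda>l. M - Suc l" "\<lambda>l. M - Suc l"]) (auto simp: of_nat_diff)
  finally have "(\<Sum>l<M. exp (- \<beta> * min (real l) (real M - real l)))
      \<le> ?S + (\<Sum>l<M. exp (- \<beta> * real (Suc l)))" .
  moreover have "(\<Sum>l<M. exp (- \<beta> * real (Suc l))) \<le> ?S"
    by (rule sum_mono) (use assms in auto)
  ultimately have "(\<Sum>l<M. exp (- \<beta> * min (real l) (real M - real l))) \<le> ?S + ?S"
    by (meson add_left_mono order_trans)
  also have "\<dots> \<le> (1 + 1 / \<beta>) + (1 + 1 / \<beta>)" by (intro add_mono sum_exp_le assms)
  finally show ?thesis by simp
qed


text \<open>Weakens decay like \<open>exp (- y^m)\<close> to \<open>exp (1 - y)\<close>, which sums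
  geometrically over the nodes.\<close>

lemma le_power_plus_one:
  fixes y :: real
  assumes "0 \<le> y" "1 \<le> m"
  shows "y - 1 \<le> y ^ m"
proof (cases "y \<le> 1")
  case True
  then show ?thesis using assms by (smt (verit) zero_le_power)
next
  case False
  then show ?thesis using self_le_power[of y m] assms by auto
qed

text \<open>On the circle of radius \<open>exp s\<close> or \<open>exp (- s)\<close>, chosen by the
  sign of \<open>j\<close>, the power of the symbol concentrates where
  \<open>|sin (\<theta> / 2)|\<close> is of order \<open>n^(-1/(2k))\<close>. The average over the
  nodes yields this factor, the radius yields \<open>exp (- |j| s)\<close>.\<close>

lemma laurent_coeffs_bound:
  fixes b :: real and k :: nat
  assumes b: "0 < b" "b ^ k < 2" and k: "1 \<le> k"
  obtains C where "0 < C"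
    "\<And>n j s. 0 \<le> s \<Longrightarrow> s \<le> 1 \<Longrightarrow> \<bar>lookup (laurent_coeffs b k n) j\<bar>
      \<le> C * real (Suc n) powr (- 1 / (2 * real k)) * exp (C * real (Suc n) * s ^ (2 * k) - real_of_int \<bar>j\<bar> * s)"
proof -
  obtain c C0 where c: "0 < c" and C0: "0 < C0" and sym: "\<And>s \<theta>. \<bar>s\<bar> \<le> 1 \<Longrightarrow>
      norm (1 - (complex_of_real b / 2 - b / 4 * (complex_of_real (exp s) * cis \<theta>
          + 1 / (complex_of_real (exp s) * cis \<theta>))) ^ k)
        \<le> exp (- c * \<bar>sin (\<theta> / 2)\<bar> ^ (2 * k) + C0 * \<bar>s\<bar> ^ (2 * k))"
    using symbol_bound[OF b k] by metis
  \<comment> \<open>The scaling with \<open>(a R)^(2k) = c N\<close>, which turns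
    \<open>c N t^(2k)\<close> into \<open>(a R t)^(2k)\<close>.\<close>
  define a where "a = c powr (1 / (2 * real k))"
  have a: "0 < a" using c by (simp add: a_def)
  define C where "C = max C0 (2 * exp (c + 1) * (1 + 1 / a))"
  have C: "0 < C" "C0 \<le> C" "2 * exp (c + 1) * (1 + 1 / a) \<le> C" using C0 by (auto simp: C_def)
  have "\<bar>lookup (laurent_coeffs b k n) j\<bar>
      \<le> C * real (Suc n) powr (- 1 / (2 * real k)) * exp (C * real (Suc n) * s ^ (2 * k) - real_of_int \<bar>j\<bar> * s)"
    if s: "0 \<le> s" "s \<le> 1" for n s and j :: int
  proof -
    define N where "N = real (Suc n)"
    have N: "1 \<le> N" by (simp add: N_def)
    define R where "R = N powr (1 / (2 * real k))"
    have R: "1 \<le> R" using N k by (simp add: R_def ge_one_powr_ge_zero)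
    have RN: "R \<le> N" using N k powr_mono[of "1 / (2 * real k)" 1 N] by (simp add: R_def)
    have aR: "(a * R) ^ (2 * k) = c * N"
      using c N k by (simp add: a_def R_def power_mult_distrib powr_power)
    \<comment> \<open>More than \<open>2 n k\<close> nodes for exact recovery, and at least
      \<open>N\<close> of them, so that \<open>1 / M\<close> is dominated by
      \<open>1 / R\<close>.\<close>
    define M where "M = 2 * (n * k) + Suc n"
    have M: "2 * (n * k) < M" "0 < M" by (simp_all add: M_def)
    have MN: "N \<le> real M" by (simp add: M_def N_def)
    define \<sigma> where "\<sigma> = (if 0 \<le> j then s else - s)"
    have \<sigma>: "\<bar>\<sigma>\<bar> = s" using s by (simp add: \<sigma>_def)
    have exp_j: "exp \<sigma> powi j = exp (real_of_int \<bar>j\<bar> * s)"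
      by (simp add: \<sigma>_def exp_power_int mult.commute)
    define E where "E = exp (C0 * N * s ^ (2 * k))"
    define \<beta> where "\<beta> = a * R / real M"
    have \<beta>: "0 < \<beta>" using a R M by (simp add: \<beta>_def)
    have circle: "norm (laurent_eval (complex_of_real (exp \<sigma>) * cis (2 * pi * real l / real M)) (laurent_coeffs b k n))
        \<le> E * exp (c + 1) * exp (- \<beta> * min (real l) (real M - real l))" if l: "l < M" for l
    proof -
      define t where "t = \<bar>sin (pi * real l / real M)\<bar>"
      have t: "0 \<le> t" "t \<le> 1" by (simp_all add: t_def)
      have "a * R * (min (real l) (real M - real l) / real M) \<le> a * R * t"
        unfolding t_def using a R by (intro mult_left_mono abs_sin_roots_ge l) auto
      then have "\<beta> * min (real l) (real M - real l) \<le> a * R * t"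
        by (simp add: \<beta>_def)
      also have "\<dots> \<le> (a * R * t) ^ (2 * k) + 1"
        using le_power_plus_one[of "a * R * t" "2 * k"] a R t k by simp
      also have "(a * R * t) ^ (2 * k) = c * N * t ^ (2 * k)"
        by (simp only: power_mult_distrib[of "a * R"] aR)
      \<comment> \<open>The symbol is raised to the power \<open>n\<close> only, whereas
        \<open>R\<close> is built from \<open>n + 1\<close>; the difference costs a factor of at
        most \<open>exp c\<close>.\<close>
      also have "c * N * t ^ (2 * k) = c * real n * t ^ (2 * k) + c * t ^ (2 * k)"
        by (simp add: N_def algebra_simps)
      also have "c * t ^ (2 * k) \<le> c * 1"
        using c t by (intro mult_left_mono power_le_one) auto
      finally have key: "\<beta> * min (real l) (real M - real l) \<le> c * real n * t ^ (2 * k) + c + 1" by simp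
      have "norm (laurent_eval (complex_of_real (exp \<sigma>) * cis (2 * pi * real l / real M)) (laurent_coeffs b k n))
          \<le> exp (- c * t ^ (2 * k) + C0 * s ^ (2 * k)) ^ n"
        using sym[of \<sigma> "2 * pi * real l / real M"] s \<sigma>
        by (subst laurent_eval_coeffs) (auto simp: norm_power t_def intro!: power_mono)
      also have "\<dots> = exp (- (c * real n * t ^ (2 * k)) + C0 * real n * s ^ (2 * k))"
        by (simp add: exp_of_nat_mult[symmetric] algebra_simps)
      also have "\<dots> \<le> exp ((c + 1 - \<beta> * min (real l) (real M - real l)) + C0 * N * s ^ (2 * k))"
      proof -
        have "C0 * real n * s ^ (2 * k) \<le> C0 * N * s ^ (2 * k)"
          using C0 s by (intro mult_right_mono mult_left_mono) (auto simp: N_def)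
        then show ?thesis using key by simp
      qed
      also have "\<dots> = E * exp (c + 1) * exp (- \<beta> * min (real l) (real M - real l))"
        by (simp add: E_def exp_add[symmetric] algebra_simps)
      finally show ?thesis .
    qed
    have "\<bar>lookup (laurent_coeffs b k n) j\<bar> * exp \<sigma> powi j * real M
        \<le> (\<Sum>l<M. norm (laurent_eval (complex_of_real (exp \<sigma>) * cis (2 * pi * real l / real M)) (laurent_coeffs b k n)))"
      by (rule abs_laurent_lookup_le[OF keys_laurent_coeffs M(1)]) simp
    also have "\<dots> \<le> (\<Sum>l<M. E * exp (c + 1) * exp (- \<beta> * min (real l) (real M - real l)))"
      by (rule sum_mono) (use circle in auto)
    also have "\<dots> = E * exp (c + 1) * (\<Sum>l<M. exp (- \<beta> * min (real l) (real M - real l)))"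
      by (simp only: sum_distrib_left)
    also have "\<dots> \<le> E * exp (c + 1) * (2 * (1 + 1 / \<beta>))"
      by (rule mult_left_mono[OF sum_exp_min_le[OF \<beta>]]) (simp add: E_def)
    finally have "\<bar>lookup (laurent_coeffs b k n) j\<bar> * exp (real_of_int \<bar>j\<bar> * s)
        \<le> E * exp (c + 1) * (2 * (1 + 1 / \<beta>)) / real M"
      using M by (simp add: exp_j field_simps)
    also have "\<dots> = 2 * exp (c + 1) * E * (1 / real M + 1 / (a * R))"
      using M a R by (simp add: \<beta>_def field_simps)
    also have "\<dots> \<le> 2 * exp (c + 1) * E * (1 / R + 1 / (a * R))"
      using RN MN R by (intro mult_left_mono add_mono) (auto simp: E_def frac_le)
    also have "\<dots> = (2 * exp (c + 1) * (1 + 1 / a)) / R * E"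
      using a R by (simp add: field_simps)
    also have "\<dots> \<le> C / R * exp (C * N * s ^ (2 * k))"
      unfolding E_def using C C0 R N s by (intro mult_mono divide_right_mono) (auto intro!: mult_right_mono)
    finally have "\<bar>lookup (laurent_coeffs b k n) j\<bar> * exp (real_of_int \<bar>j\<bar> * s)
        \<le> C / R * exp (C * N * s ^ (2 * k))" .
    then have "\<bar>lookup (laurent_coeffs b k n) j\<bar>
        \<le> C / R * exp (C * N * s ^ (2 * k)) / exp (real_of_int \<bar>j\<bar> * s)"
      by (subst pos_le_divide_eq) simp_all
    also have "\<dots> = C * N powr (- 1 / (2 * real k)) * exp (C * N * s ^ (2 * k) - real_of_int \<bar>j\<bar> * s)"
      by (simp add: R_def powr_minus_divide exp_diff)
    finally show ?thesis by (simp add: N_def)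
  qed
  with C(1) show ?thesis using that by blast
qed

text \<open>Two geometric series, one for each sign of \<open>j\<close>, starting at the least
  integer above or equal to \<open>\<rho>\<close>; \<open>1 + 1/s \<le> 2/s\<close> because
  \<open>s \<le> 1\<close>.\<close>

lemma sum_exp_tail_le:
  fixes s \<rho> :: real
  assumes s: "0 < s" "s \<le> 1" and \<rho>: "0 \<le> \<rho>"
  shows "(\<Sum>j\<in>{j. \<bar>j\<bar> \<le> int p \<and> \<rho> \<le> real_of_int \<bar>j\<bar>}. exp (- (real_of_int \<bar>j\<bar> * s))) \<le> 4 / s * exp (- \<rho> * s)"
proof -
  define m where "m = nat \<lceil>\<rho>\<rceil>"
  have m: "\<rho> \<le> real m" using \<rho> by (simp add: m_def)
  let ?J = "{j::int. \<bar>j\<bar> \<le> int p \<and> \<rho> \<le> real_of_int \<bar>j\<bar>}"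
  let ?f = "\<lambda>j::int. exp (- (real_of_int \<bar>j\<bar> * s))"
  define P where "P = (\<lambda>l. int (m + l)) ` {..<Suc p}"
  define P' where "P' = (\<lambda>l. - int (m + l)) ` {..<Suc p}"
  have fin: "finite P" "finite P'" by (simp_all add: P_def P'_def)
  have sub: "?J \<subseteq> P \<union> P'"
  proof
    fix j assume j: "j \<in> ?J"
    then have "m \<le> nat \<bar>j\<bar>" by (simp add: m_def nat_le_eq_zle ceiling_le_iff)
    then have "nat \<bar>j\<bar> - m \<in> {..<Suc p}" "j = int (m + (nat \<bar>j\<bar> - m)) \<or> j = - int (m + (nat \<bar>j\<bar> - m))"
      using j by auto
    then show "j \<in> P \<union> P'" by (auto simp: P_def P'_def)
  qed
  have half: "(\<Sum>l<Suc p. exp (- (real (m + l) * s))) \<le> 2 / s * exp (- \<rho> * s)"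
  proof -
    have "(\<Sum>l<Suc p. exp (- (real (m + l) * s))) = exp (- (real m * s)) * (\<Sum>l<Suc p. exp (- s * real l))"
      unfolding sum_distrib_left by (rule sum.cong) (simp_all add: exp_add[symmetric] algebra_simps)
    also have "\<dots> \<le> exp (- \<rho> * s) * (1 + 1 / s)"
      using s m by (intro mult_mono sum_exp_le) (auto intro!: sum_nonneg simp del: sum.lessThan_Suc)
    also have "\<dots> \<le> exp (- \<rho> * s) * (2 / s)"
      using s by (intro mult_left_mono) (auto simp: field_simps)
    finally show ?thesis by (simp add: mult.commute)
  qed
  have "sum ?f ?J \<le> sum ?f (P \<union> P')" by (rule sum_mono2) (use fin sub in auto)
  also have "\<dots> \<le> sum ?f P + sum ?f P'"
    using fin by (simp add: sum_Un sum_nonneg)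
  also have "sum ?f P = (\<Sum>l<Suc p. exp (- (real (m + l) * s)))"
    unfolding P_def by (subst sum.reindex) (auto simp: inj_on_def)
  also have "sum ?f P' = (\<Sum>l<Suc p. exp (- (real (m + l) * s)))"
    unfolding P'_def by (subst sum.reindex) (auto simp: inj_on_def add.commute intro!: sum.cong)
  finally show ?thesis using half by (simp add: field_simps)
qed


text \<open>Up to constants, \<open>C0 N s^(2k) - \<rho> s\<close> is smallest at
  \<open>s = (\<rho> / N)^(1/(2k-1))\<close>, which is \<open>y^(1/(2k-1)) / R\<close> for
  \<open>y = \<rho> / R\<close>; the minimum is of order \<open>- y^(2k/(2k-1))\<close>. Summing
  over \<open>j\<close> gives a factor \<open>1 / s\<close>, whose \<open>R\<close> cancels the
  prefactor \<open>1 / R\<close>.\<close>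

lemma laurent_tail_bound:
  fixes b :: real and k :: nat
  assumes b: "0 < b" "b ^ k < 2" and k: "1 \<le> k"
  obtains C c where "0 < C" "0 < c"
    "\<And>n \<rho>. real (Suc n) powr (1 / (2 * real k)) \<le> \<rho> \<Longrightarrow>
      (\<Sum>j\<in>{j \<in> keys (laurent_coeffs b k n). \<rho> \<le> real_of_int \<bar>j\<bar>}. \<bar>lookup (laurent_coeffs b k n) j\<bar>)
        \<le> C * exp (- c * (\<rho> / real (Suc n) powr (1 / (2 * real k))) powr (2 * real k / (2 * real k - 1)))"
proof -
  obtain C0 where C0: "0 < C0" and coeff: "\<And>n j s. 0 \<le> s \<Longrightarrow> s \<le> 1 \<Longrightarrow>
      \<bar>lookup (laurent_coeffs b k n) j\<bar>
      \<le> C0 * real (Suc n) powr (- 1 / (2 * real k)) * exp (C0 * real (Suc n) * s ^ (2 * k) - real_of_int \<bar>j\<bar> * s)"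
    using laurent_coeffs_bound[OF b k] by metis
  \<comment> \<open>\<open>c \<le> 1/k\<close> will give \<open>s \<le> 1\<close>;
    \<open>C0 c \<le> 1/2\<close> keeps half of the gain \<open>c Y^(2k)\<close> after the loss
    \<open>C0 c^(2k) Y^(2k)\<close>.\<close>
  define c where "c = min 1 (1 / (2 * C0)) / real k"
  have c: "0 < c" "c \<le> 1 / real k" "c \<le> 1" "C0 * c \<le> 1 / 2"
  proof -
    show "0 < c" using C0 k by (simp add: c_def)
    show "c \<le> 1 / real k" using k by (simp add: c_def divide_right_mono)
    then show "c \<le> 1" using k by (smt (verit) divide_le_eq_1 of_nat_1 of_nat_le_iff)
    have "c \<le> min 1 (1 / (2 * C0)) / 1" unfolding c_def using k C0 by (intro divide_left_mono) auto
    then have "c \<le> 1 / (2 * C0)" by simp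
    then show "C0 * c \<le> 1 / 2" using C0 by (simp add: field_simps)
  qed
  define n where "n = 2 * k - 2"
  have n: "2 * k = Suc (Suc n)" and n': "2 * real k - 1 = real (Suc n)" using k by (auto simp: n_def)
  have cpow: "C0 * c ^ (2 * k) \<le> c / 2"
  proof -
    have "c ^ (2 * k) \<le> c ^ 2" using c k by (intro power_decreasing) auto
    then have "C0 * c ^ (2 * k) \<le> C0 * c ^ 2" using C0 by simp
    also have "\<dots> = (C0 * c) * c" by (simp add: power2_eq_square)
    also have "\<dots> \<le> 1 / 2 * c" using c by (intro mult_right_mono) auto
    finally show ?thesis by simp
  qed
  have main: "(\<Sum>j\<in>{j \<in> keys (laurent_coeffs b k m). \<rho> \<le> real_of_int \<bar>j\<bar>}. \<bar>lookup (laurent_coeffs b k m) j\<bar>)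
        \<le> 4 * C0 / c * exp (- (c / 2) * (\<rho> / real (Suc m) powr (1 / (2 * real k))) powr (2 * real k / (2 * real k - 1)))"
    if \<rho>: "real (Suc m) powr (1 / (2 * real k)) \<le> \<rho>" for m \<rho>
  \<comment> \<open>Beyond the degree \<open>m k\<close> the sum is empty; up to it the chosen
    \<open>s\<close> is at most 1.\<close>
  proof (cases "\<rho> \<le> real (m * k)")
    case False
    have "{j \<in> keys (laurent_coeffs b k m). \<rho> \<le> real_of_int \<bar>j\<bar>} = {}"
    proof (rule ccontr)
      assume "\<not> ?thesis"
      then obtain j where j: "j \<in> keys (laurent_coeffs b k m)" "\<rho> \<le> real_of_int \<bar>j\<bar>" by auto
      then have "j \<in> {- int (m * k)..int (m * k)}" using keys_laurent_coeffs[of b k m] by blast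
      then have "\<bar>j\<bar> \<le> int (m * k)" by (auto simp del: of_nat_mult)
      then have "real_of_int \<bar>j\<bar> \<le> real (m * k)" by linarith
      then show False using False j by linarith
    qed
    then show ?thesis using C0 c by (simp only: sum.empty) simp
  next
    case True
    define N where "N = real (Suc m)"
    define R where "R = N powr (1 / (2 * real k))"
    define y where "y = \<rho> / R"
    define Y where "Y = y powr (1 / real (Suc n))"
    have N: "1 \<le> N" by (simp add: N_def)
    have R: "1 \<le> R" using N k by (simp add: R_def ge_one_powr_ge_zero)
    have RN: "R ^ Suc (Suc n) = N" using N k by (simp add: R_def n[symmetric] powr_power)
    have y: "1 \<le> y" using \<rho> R by (simp add: y_def R_def N_def)
    have Y: "1 \<le> Y" using y by (simp add: Y_def ge_one_powr_ge_zero)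
    have Yy: "Y ^ Suc n = y" using y by (simp add: Y_def powr_power del: power_Suc)
    have Yg: "y powr (2 * real k / (2 * real k - 1)) = Y ^ Suc (Suc n)"
      unfolding n' n[symmetric] using y by (simp add: Y_def powr_power)
    have \<rho>_eq: "\<rho> = y * R" using R by (simp add: y_def)
    define s where "s = c * Y / R"
    have s0: "0 < s" using c Y R by (simp add: s_def)
    have "Y \<le> real k * R"
    proof -
      have "Y ^ Suc n * R \<le> real k * R ^ Suc n * R"
      proof -
        have "Y ^ Suc n * R \<le> real (m * k)" using True by (simp only: Yy \<rho>_eq)
        also have "\<dots> \<le> real k * N" by (simp add: N_def algebra_simps)
        also have "\<dots> = real k * R ^ Suc n * R" by (simp add: RN[symmetric] mult_ac)
        finally show ?thesis .
      qed
      then have "Y ^ Suc n \<le> real k * R ^ Suc n" using R by (simp add: mult_le_cancel_right)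
      also have "\<dots> \<le> real k ^ Suc n * R ^ Suc n"
        using k R self_le_power[of "real k" "Suc n"] by (intro mult_right_mono) auto
      finally have "Y ^ Suc n \<le> (real k * R) ^ Suc n" by (simp only: power_mult_distrib)
      then show ?thesis by (rule power_le_imp_le_base) (use R in simp)
    qed
    then have "s \<le> c * (real k * R) / R"
      unfolding s_def using c R by (intro divide_right_mono mult_left_mono) auto
    also have "\<dots> \<le> 1" using c R k by (simp add: field_simps)
    finally have s1: "s \<le> 1" .
    have \<rho>s: "\<rho> * s = c * Y ^ Suc (Suc n)"
      using R by (simp add: \<rho>_eq s_def Yy[symmetric])
    have Ns: "N * s ^ (2 * k) = c ^ (2 * k) * Y ^ Suc (Suc n)"
      using R by (simp add: RN[symmetric] s_def n power_divide power_mult_distrib del: power_Suc)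
    let ?J = "{j. \<bar>j\<bar> \<le> int (m * k) \<and> \<rho> \<le> real_of_int \<bar>j\<bar>}"
    have finJ: "finite ?J" by (rule finite_subset[of _ "{- int (m * k)..int (m * k)}"]) auto
    have "(\<Sum>j\<in>{j \<in> keys (laurent_coeffs b k m). \<rho> \<le> real_of_int \<bar>j\<bar>}. \<bar>lookup (laurent_coeffs b k m) j\<bar>)
        \<le> (\<Sum>j\<in>?J. \<bar>lookup (laurent_coeffs b k m) j\<bar>)"
    proof (rule sum_mono2[OF finJ])
      show "{j \<in> keys (laurent_coeffs b k m). \<rho> \<le> real_of_int \<bar>j\<bar>} \<subseteq> ?J"
      proof
        fix j assume j: "j \<in> {j \<in> keys (laurent_coeffs b k m). \<rho> \<le> real_of_int \<bar>j\<bar>}"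
        then have mem: "j \<in> keys (laurent_coeffs b k m)" and ge: "\<rho> \<le> real_of_int \<bar>j\<bar>" by simp_all
        have "j \<in> {- int (m * k)..int (m * k)}" by (rule subsetD[OF keys_laurent_coeffs mem])
        then have "\<bar>j\<bar> \<le> int (m * k)" by (auto simp del: of_nat_mult)
        with ge show "j \<in> ?J" by simp
      qed
    qed (rule abs_ge_zero)
    also have "\<dots> \<le> (\<Sum>j\<in>?J. C0 / R * exp (C0 * N * s ^ (2 * k)) * exp (- (real_of_int \<bar>j\<bar> * s)))"
    proof (rule sum_mono)
      fix j
      show "\<bar>lookup (laurent_coeffs b k m) j\<bar> \<le> C0 / R * exp (C0 * N * s ^ (2 * k)) * exp (- (real_of_int \<bar>j\<bar> * s))"
      proof -
        have "N powr (- 1 / (2 * real k)) = 1 / R" by (simp add: R_def powr_minus_divide)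
        moreover have "exp (C0 * N * s ^ (2 * k) - real_of_int \<bar>j\<bar> * s)
            = exp (C0 * N * s ^ (2 * k)) * exp (- (real_of_int \<bar>j\<bar> * s))"
          by (simp add: exp_add[symmetric])
        moreover have "\<bar>lookup (laurent_coeffs b k m) j\<bar>
            \<le> C0 * N powr (- 1 / (2 * real k)) * exp (C0 * N * s ^ (2 * k) - real_of_int \<bar>j\<bar> * s)"
          unfolding N_def using s0 s1 by (intro coeff) auto
        ultimately show ?thesis by (simp only: mult.assoc) simp
      qed
    qed
    also have "\<dots> = C0 / R * exp (C0 * N * s ^ (2 * k)) * (\<Sum>j\<in>?J. exp (- (real_of_int \<bar>j\<bar> * s)))"
      by (simp only: sum_distrib_left)
    also have "\<dots> \<le> C0 / R * exp (C0 * N * s ^ (2 * k)) * (4 / s * exp (- \<rho> * s))"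
      using C0 R y by (intro mult_left_mono sum_exp_tail_le s0 s1) (auto simp: \<rho>_eq)
    also have "\<dots> = 4 * C0 / (c * Y) * exp (C0 * (N * s ^ (2 * k)) - \<rho> * s)"
    proof -
      have Rs: "c * Y = R * s" using R by (simp add: s_def)
      have "exp (C0 * N * s ^ (2 * k)) * exp (- \<rho> * s) = exp (C0 * (N * s ^ (2 * k)) - \<rho> * s)"
        by (simp add: exp_add[symmetric] mult.assoc)
      then show ?thesis unfolding Rs by (simp add: field_simps)
    qed
    also have "\<dots> \<le> 4 * C0 / c * exp (- (c / 2) * Y ^ Suc (Suc n))"
    proof (rule mult_mono)
      have "c * 1 \<le> c * Y" using c Y by (intro mult_left_mono) auto
      then show "4 * C0 / (c * Y) \<le> 4 * C0 / c"
        using c C0 by (intro divide_left_mono) auto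
      have "(C0 * c ^ (2 * k)) * Y ^ Suc (Suc n) \<le> c / 2 * Y ^ Suc (Suc n)"
        using Y by (intro mult_right_mono cpow) auto
      then show "exp (C0 * (N * s ^ (2 * k)) - \<rho> * s) \<le> exp (- (c / 2) * Y ^ Suc (Suc n))"
        by (simp add: \<rho>s Ns mult.assoc)
    qed (use C0 c in auto)
    finally show ?thesis unfolding Yg[symmetric] y_def R_def N_def .
  qed
  show ?thesis by (rule that[OF _ _ main]) (use C0 c in simp_all)
qed

section \<open>The random walk and its word length\<close>

locale symmetric_walk = group G for G :: "('a, 'b) monoid_scheme" (structure) +
  fixes \<mu> :: "'a pmf"
  assumes mu_sym: "g \<in> carrier G \<Longrightarrow> pmf \<mu> g = pmf \<mu> (inv g)"
    and finite_support: "finite (set_pmf \<mu>)"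
    and support_subset: "set_pmf \<mu> \<subseteq> carrier G"
    and support_generates: "generate G (set_pmf \<mu>) = carrier G"
begin

lemma support_closed: "s \<in> set_pmf \<mu> \<Longrightarrow> s \<in> carrier G"
  using support_subset by blast

lemma inv_support: "s \<in> set_pmf \<mu> \<Longrightarrow> inv s \<in> set_pmf \<mu>"
  using mu_sym[of s] support_closed[of s] by (simp add: set_pmf_iff)

definition reach :: "nat \<Rightarrow> 'a \<Rightarrow> bool" where
  "reach n g \<longleftrightarrow> (\<one>, g) \<in> walk_edges G \<mu> ^^ n"

lemma reach_0: "reach 0 g \<longleftrightarrow> g = \<one>"
  by (auto simp: reach_def)

lemma reach_Suc: "reach (Suc n) g \<longleftrightarrow> (\<exists>h s. reach n h \<and> h \<in> carrier G \<and> s \<in> set_pmf \<mu> \<and> g = h \<otimes> s)"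
proof -
  have edge: "(h, g) \<in> walk_edges G \<mu> \<longleftrightarrow> h \<in> carrier G \<and> (\<exists>s\<in>set_pmf \<mu>. g = h \<otimes> s)" for h
  proof
    assume "(h, g) \<in> walk_edges G \<mu>"
    then have "h \<in> carrier G" "g \<in> carrier G" "inv h \<otimes> g \<in> set_pmf \<mu>"
      by (auto simp: walk_edges_def walk_kernel_def set_pmf_iff)
    then show "h \<in> carrier G \<and> (\<exists>s\<in>set_pmf \<mu>. g = h \<otimes> s)"
      by (intro conjI bexI[of _ "inv h \<otimes> g"]) (simp_all add: m_assoc[symmetric])
  next
    assume "h \<in> carrier G \<and> (\<exists>s\<in>set_pmf \<mu>. g = h \<otimes> s)"
    then obtain s where "h \<in> carrier G" "s \<in> set_pmf \<mu>" "g = h \<otimes> s" by blast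
    then show "(h, g) \<in> walk_edges G \<mu>"
      using support_closed[of s]
      by (auto simp: walk_edges_def walk_kernel_def m_assoc[symmetric] pmf_positive)
  qed
  show ?thesis unfolding reach_def relpow.simps relcomp_unfold mem_Collect_eq case_prod_conv edge by blast
qed

lemma reach_closed: "reach n g \<Longrightarrow> g \<in> carrier G"
  by (cases n) (auto simp: reach_0 reach_Suc support_closed)

lemma reach_mult: "reach m g \<Longrightarrow> reach n h \<Longrightarrow> reach (m + n) (g \<otimes> h)"
proof (induction n arbitrary: h)
  case 0
  then show ?case using reach_closed[of m g] by (simp add: reach_0)
next
  case (Suc n)
  then obtain h' s where h: "reach n h'" "h' \<in> carrier G" "s \<in> set_pmf \<mu>" "h = h' \<otimes> s"
    by (auto simp: reach_Suc)
  then show ?case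
    using Suc.IH[OF Suc.prems(1) h(1)] reach_closed[OF Suc.prems(1)] support_closed[OF h(3)]
    by (auto simp: reach_Suc m_assoc[symmetric])
qed

lemma reach_support: "s \<in> set_pmf \<mu> \<Longrightarrow> reach 1 s"
  using support_closed[of s] by (auto simp: reach_Suc reach_0)

lemma reach_inv: "reach n g \<Longrightarrow> reach n (inv g)"
proof (induction n arbitrary: g)
  case 0
  then show ?case by (simp add: reach_0)
next
  case (Suc n)
  then obtain h s where h: "reach n h" "h \<in> carrier G" "s \<in> set_pmf \<mu>" "g = h \<otimes> s"
    by (auto simp: reach_Suc)
  have "reach (1 + n) (inv s \<otimes> inv h)"
    by (intro reach_mult Suc.IH h reach_support inv_support)
  then show ?case using h support_closed[of s] by (simp add: inv_mult_group)
qed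

lemma reach_exists: "g \<in> carrier G \<Longrightarrow> \<exists>n. reach n g"
proof -
  assume "g \<in> carrier G"
  then have "g \<in> generate G (set_pmf \<mu>)" by (simp add: support_generates)
  then show ?thesis
  proof (induction rule: generate.induct)
    case one
    then show ?case using reach_0 by blast
  next
    case (incl h)
    then show ?case using reach_support by blast
  next
    case (inv h)
    then show ?case using reach_support reach_inv by blast
  next
    case (eng h1 h2)
    then show ?case using reach_mult by blast
  qed
qed

abbreviation len :: "'a \<Rightarrow> nat" where
  "len \<equiv> word_length G \<mu>"

lemma len_eq_Least: "len g = (LEAST n. reach n g)"
  by (simp add: word_length_def graph_dist_def reach_def)

lemma reach_len: "g \<in> carrier G \<Longrightarrow> reach (len g) g"
  unfolding len_eq_Least using reach_exists by (metis LeastI_ex)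

lemma len_le: "reach n g \<Longrightarrow> len g \<le> n"
  unfolding len_eq_Least by (rule Least_le)

lemma len_one [simp]: "len \<one> = 0"
  using len_le[of 0 \<one>] by (simp add: reach_0)

lemma len_mult: "g \<in> carrier G \<Longrightarrow> h \<in> carrier G \<Longrightarrow> len (g \<otimes> h) \<le> len g + len h"
  by (intro len_le reach_mult reach_len)

lemma len_inv: "g \<in> carrier G \<Longrightarrow> len (inv g) = len g"
  using len_le[OF reach_inv[OF reach_len[of g]]] len_le[OF reach_inv[OF reach_len[of "inv g"]]] by simp

lemma finite_reach: "finite {g. reach n g}"
proof (induction n)
  case 0
  then show ?case by (simp add: reach_0)
next
  case (Suc n)
  have "{g. reach (Suc n) g} \<subseteq> (\<lambda>(h, s). h \<otimes> s) ` ({g. reach n g} \<times> set_pmf \<mu>)"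
    by (auto simp: reach_Suc)
  then show ?case using Suc finite_support by (meson finite_SigmaI finite_imageI finite_subset)
qed

definition ball_set :: "real \<Rightarrow> 'a set" where
  "ball_set t = {g \<in> carrier G. real (len g) < t}"

lemma finite_ball_set: "finite (ball_set t)"
proof (rule finite_subset)
  show "ball_set t \<subseteq> (\<Union>n\<le>nat \<lceil>t\<rceil>. {g. reach n g})"
  proof
    fix g assume "g \<in> ball_set t"
    then have "reach (len g) g" "len g \<le> nat \<lceil>t\<rceil>"
      using reach_len by (auto simp: ball_set_def) linarith
    then show "g \<in> (\<Union>n\<le>nat \<lceil>t\<rceil>. {g. reach n g})" by auto
  qed
qed (use finite_reach in auto)

lemma ball_card_eq: "ball_card G \<mu> t = card (ball_set t)"
  by (simp add: ball_card_def ball_set_def)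

lemma ball_set_mono: "t \<le> t' \<Longrightarrow> ball_set t \<subseteq> ball_set t'"
  by (auto simp: ball_set_def)

lemma ball_card_mono: "t \<le> t' \<Longrightarrow> ball_card G \<mu> t \<le> ball_card G \<mu> t'"
  unfolding ball_card_eq by (intro card_mono finite_ball_set ball_set_mono)

lemma ball_card_pos: "0 < t \<Longrightarrow> 0 < ball_card G \<mu> t"
  unfolding ball_card_eq card_gt_0_iff using finite_ball_set[of t]
  by (auto simp: ball_set_def intro!: exI[of _ \<one>])

section \<open>Translations and the Laplacian\<close>

text \<open>The identity off the carrier makes translation a bijection of the whole type, so
  composition with it preserves inner products.\<close>

definition lmul :: "'a \<Rightarrow> 'a \<Rightarrow> 'a" where
  "lmul s x = (if x \<in> carrier G then s \<otimes> x else x)"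

definition rmul :: "'a \<Rightarrow> 'a \<Rightarrow> 'a" where
  "rmul s x = (if x \<in> carrier G then x \<otimes> s else x)"

lemma lmul_inv: "s \<in> carrier G \<Longrightarrow> lmul s (lmul (inv s) x) = x"
  by (simp add: lmul_def m_assoc[symmetric])

lemma rmul_inv: "s \<in> carrier G \<Longrightarrow> rmul s (rmul (inv s) x) = x"
  by (simp add: rmul_def m_assoc)

lemma bij_lmul: "s \<in> carrier G \<Longrightarrow> bij (lmul s)"
  using lmul_inv[of s] lmul_inv[of "inv s"]
  by (intro o_bij[of "lmul (inv s)"]) (auto simp: fun_eq_iff)

lemma bij_rmul: "s \<in> carrier G \<Longrightarrow> bij (rmul s)"
  using rmul_inv[of s] rmul_inv[of "inv s"]
  by (intro o_bij[of "rmul (inv s)"]) (auto simp: fun_eq_iff)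

text \<open>\<open>lt s f\<close> is \<open>x \<mapsto> f (s x)\<close> on the carrier, so
  \<open>lt\<close> reverses products; it commutes with right translations.\<close>

definition lt :: "'a \<Rightarrow> ('a \<Rightarrow>\<^sub>0 real) \<Rightarrow> 'a \<Rightarrow>\<^sub>0 real" where
  "lt s = map_key (lmul s)"

definition rt :: "'a \<Rightarrow> ('a \<Rightarrow>\<^sub>0 real) \<Rightarrow> 'a \<Rightarrow>\<^sub>0 real" where
  "rt s = map_key (rmul s)"

lemma lookup_lt: "s \<in> carrier G \<Longrightarrow> lookup (lt s f) x = lookup f (lmul s x)"
  by (simp add: lt_def map_key.rep_eq bij_is_inj[OF bij_lmul])

lemma lookup_rt: "s \<in> carrier G \<Longrightarrow> lookup (rt s f) x = lookup f (rmul s x)"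
  by (simp add: rt_def map_key.rep_eq bij_is_inj[OF bij_rmul])

lemma linear_lt: "s \<in> carrier G \<Longrightarrow> linear (lt s)"
  unfolding lt_def by (rule linear_map_key[OF bij_is_inj[OF bij_lmul]])

lemma linear_rt: "s \<in> carrier G \<Longrightarrow> linear (rt s)"
  unfolding rt_def by (rule linear_map_key[OF bij_is_inj[OF bij_rmul]])

lemma inner_lt: "s \<in> carrier G \<Longrightarrow> inner (lt s f) (lt s g) = inner f g"
  unfolding lt_def by (rule inner_map_key_bij[OF bij_lmul])

lemma norm_lt: "s \<in> carrier G \<Longrightarrow> norm (lt s f) = norm f"
  unfolding lt_def by (rule norm_map_key_bij[OF bij_lmul])

lemma norm_rt: "s \<in> carrier G \<Longrightarrow> norm (rt s f) = norm f"
  unfolding rt_def by (rule norm_map_key_bij[OF bij_rmul])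

lemma lt_inv: "s \<in> carrier G \<Longrightarrow> lt (inv s) (lt s f) = f"
  by (rule poly_mapping_eqI) (simp add: lookup_lt lmul_inv)

lemma rt_single: "s \<in> carrier G \<Longrightarrow> g \<in> carrier G \<Longrightarrow> rt s (single g c) = single (g \<otimes> inv s) c"
proof (rule poly_mapping_eqI)
  fix x assume "s \<in> carrier G" "g \<in> carrier G"
  then show "lookup (rt s (single g c)) x = lookup (single (g \<otimes> inv s) c) x"
    by (cases "x \<in> carrier G") (auto simp: lookup_rt rmul_def lookup_single when_def m_assoc)
qed

lemma lt_rt: "s \<in> carrier G \<Longrightarrow> y \<in> carrier G \<Longrightarrow> lt s (rt y f) = rt y (lt s f)"
  by (rule poly_mapping_eqI) (simp add: lookup_lt lookup_rt lmul_def rmul_def m_assoc)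

lemma lt_lt: "s \<in> carrier G \<Longrightarrow> t \<in> carrier G \<Longrightarrow> lt s (lt t f) = lt (t \<otimes> s) f"
  by (rule poly_mapping_eqI) (simp add: lookup_lt lmul_def m_assoc)

definition P :: "('a \<Rightarrow>\<^sub>0 real) \<Rightarrow> 'a \<Rightarrow>\<^sub>0 real" where
  "P f = (\<Sum>s\<in>set_pmf \<mu>. pmf \<mu> s *\<^sub>R lt s f)"

definition Lap :: "('a \<Rightarrow>\<^sub>0 real) \<Rightarrow> 'a \<Rightarrow>\<^sub>0 real" where
  "Lap f = f - P f"

lemma lookup_P: "lookup (P f) x = (\<Sum>s\<in>set_pmf \<mu>. pmf \<mu> s * lookup f (lmul s x))"
  unfolding P_def lookup_sum by (rule sum.cong) (auto simp: lookup_lt support_closed)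

lemma linear_P: "linear P"
  unfolding P_def
  by (intro linear_compose_sum ballI)
    (auto intro!: linearI simp: linear_add[OF linear_lt[OF support_closed]]
      linear_cmul[OF linear_lt[OF support_closed]] scaleR_add_right)

lemma linear_Lap: "linear Lap"
  by (rule linearI) (simp_all add: Lap_def linear_add[OF linear_P] linear_cmul[OF linear_P] algebra_simps)

text \<open>The adjoint of \<open>lt s\<close> is \<open>lt (inv s)\<close>, and the weights are
  invariant under inversion.\<close>

lemma inner_P_sym: "inner (P f) g = inner f (P g)"
proof -
  have lt_adj: "inner (lt s f) g = inner f (lt (inv s) g)" if "s \<in> carrier G" for s
    using inner_lt[of "inv s" "lt s f" g] lt_inv[OF that] that by simp
  have "inner (P f) g = (\<Sum>s\<in>set_pmf \<mu>. pmf \<mu> s * inner f (lt (inv s) g))"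
    unfolding P_def inner_sum_left by (rule sum.cong) (auto simp: lt_adj support_closed)
  also have "\<dots> = (\<Sum>s\<in>set_pmf \<mu>. pmf \<mu> s * inner f (lt s g))"
    by (rule sum.reindex_bij_witness[of _ "\<lambda>s. inv s" "\<lambda>s. inv s"])
      (auto simp: inv_support support_closed mu_sym[symmetric])
  also have "\<dots> = inner f (P g)" by (simp add: P_def inner_sum_right)
  finally show ?thesis .
qed

lemma inner_Lap_sym: "inner (Lap f) g = inner f (Lap g)"
  by (simp add: Lap_def inner_diff_left inner_diff_right inner_P_sym)

lemma sum_pmf_support: "(\<Sum>s\<in>set_pmf \<mu>. pmf \<mu> s) = 1"
  by (rule sum_pmf_eq_1[OF finite_support order_refl])

text \<open>Translations are isometries, so each squared difference is
  \<open>2 |f|^2 - 2 <lt s f, f>\<close>, and the weights sum to 1.\<close>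

lemma Dirichlet_form: "inner (Lap f) f = (\<Sum>s\<in>set_pmf \<mu>. pmf \<mu> s * (norm (f - lt s f))\<^sup>2) / 2"
proof -
  have *: "(norm (f - lt s f))\<^sup>2 = 2 * inner f f - 2 * inner (lt s f) f" if "s \<in> set_pmf \<mu>" for s
    using inner_lt[OF support_closed[OF that], of f f]
    by (simp add: power2_norm_eq_inner inner_diff_left inner_diff_right inner_commute)
  have "(\<Sum>s\<in>set_pmf \<mu>. pmf \<mu> s * (norm (f - lt s f))\<^sup>2)
      = (\<Sum>s\<in>set_pmf \<mu>. 2 * inner f f * pmf \<mu> s - 2 * (pmf \<mu> s * inner (lt s f) f))"
    by (intro sum.cong refl) (simp add: * algebra_simps)
  also have "\<dots> = 2 * inner f f - 2 * inner (P f) f"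
    by (simp add: sum_subtractf sum_distrib_left[symmetric] sum_pmf_support P_def inner_sum_left)
  finally show ?thesis by (simp add: Lap_def inner_diff_left)
qed

lemma Dirichlet_nonneg: "0 \<le> inner (Lap f) f"
  unfolding Dirichlet_form by (intro divide_nonneg_nonneg sum_nonneg) auto

lemma P_rt: "y \<in> carrier G \<Longrightarrow> P (rt y f) = rt y (P f)"
  unfolding P_def
  by (simp add: linear_sum[OF linear_rt] linear_cmul[OF linear_rt])
    (rule sum.cong, auto simp: lt_rt support_closed)

lemma Lap_rt: "y \<in> carrier G \<Longrightarrow> Lap (rt y f) = rt y (Lap f)"
  by (simp add: Lap_def P_rt linear_diff[OF linear_rt])

end

section \<open>The bottom of the spectrum\<close>

lemma infsum_eq_sum:
  fixes f :: "'a \<Rightarrow> 'b::{comm_monoid_add,t2_space}"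
  assumes "finite S" "S \<subseteq> A" "\<And>x. x \<in> A - S \<Longrightarrow> f x = 0"
  shows "infsum f A = sum f S"
proof -
  have "infsum f A = infsum f S"
    by (rule infsum_cong_neutral) (use assms in auto)
  then show ?thesis using assms(1) by simp
qed

context symmetric_walk
begin

lemma norm_P_le: "norm (P f) \<le> norm f"
proof -
  have "norm (P f) \<le> (\<Sum>s\<in>set_pmf \<mu>. norm (pmf \<mu> s *\<^sub>R lt s f))"
    unfolding P_def by (rule norm_sum)
  also have "\<dots> = (\<Sum>s\<in>set_pmf \<mu>. pmf \<mu> s * norm f)"
    by (rule sum.cong) (auto simp: norm_lt support_closed)
  also have "\<dots> = norm f" by (simp add: sum_distrib_right[symmetric] sum_pmf_support)
  finally show ?thesis .
qed

lemma abs_inner_P_le: "\<bar>inner (P f) f\<bar> \<le> inner f f"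
proof -
  have "\<bar>inner (P f) f\<bar> \<le> norm (P f) * norm f" by (rule Cauchy_Schwarz_ineq2)
  also have "\<dots> \<le> norm f * norm f" by (intro mult_right_mono norm_P_le) auto
  finally show ?thesis by (simp add: power2_norm_eq_inner[symmetric] power2_eq_square)
qed

text \<open>The operator \<open>P\<close> acts by left translations, the Markov operator by right translations; inversion
  intertwines the two.\<close>

definition emb :: "('a \<Rightarrow>\<^sub>0 real) \<Rightarrow> 'a \<Rightarrow> complex" where
  "emb f u = (if u \<in> carrier G then complex_of_real (lookup f (inv u)) else 0)"

lemma finite_emb_support: "finite {u \<in> carrier G. emb f u \<noteq> 0}"
proof (rule finite_subset)
  show "{u \<in> carrier G. emb f u \<noteq> 0} \<subseteq> (\<lambda>u. inv u) ` keys f"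
  proof
    fix u assume "u \<in> {u \<in> carrier G. emb f u \<noteq> 0}"
    then have "u = inv (inv u)" "inv u \<in> keys f" by (auto simp: emb_def in_keys_iff)
    then show "u \<in> (\<lambda>u. inv u) ` keys f" by blast
  qed
qed simp

lemma emb_in_ell2: "emb f \<in> ell2 G"
proof -
  have "finite {x \<in> carrier G. (cmod (emb f x))\<^sup>2 \<noteq> 0}" using finite_emb_support by simp
  then show ?thesis
    by (auto simp: ell2_def emb_def intro!: finite_nonzero_values_imp_summable_on)
qed

lemma ell2_norm_emb:
  assumes "keys f \<subseteq> carrier G"
  shows "ell2_norm G (emb f) = norm f"
proof -
  have "(\<Sum>\<^sub>\<infinity>x\<in>carrier G. (cmod (emb f x))\<^sup>2) = (\<Sum>x\<in>(\<lambda>u. inv u) ` keys f. (cmod (emb f x))\<^sup>2)"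
  proof (rule infsum_eq_sum)
    fix x assume x: "x \<in> carrier G - (\<lambda>u. inv u) ` keys f"
    then have "x = inv (inv x)" by simp
    then have "inv x \<notin> keys f" using x by blast
    then show "(cmod (emb f x))\<^sup>2 = 0" by (simp add: emb_def in_keys_iff)
  qed (use assms in auto)
  also have "\<dots> = (\<Sum>x\<in>keys f. (lookup f x)\<^sup>2)"
  proof (subst sum.reindex)
    show "inj_on (\<lambda>u. inv u) (keys f)" using assms by (intro inj_onI) (metis inv_inv subsetD)
  qed (use assms in \<open>auto simp: emb_def subset_iff intro!: sum.cong\<close>)
  also have "\<dots> = (norm f)\<^sup>2" by (simp add: norm_poly_mapping_superset[of "keys f"])
  finally show ?thesis by (simp add: ell2_norm_def)
qed

text \<open>The walk steps from \<open>u\<close> to \<open>u s\<close>. Under inversion this is left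
  multiplication by \<open>inv s\<close>, and the symmetry of \<open>\<mu>\<close> replaces
  \<open>inv s\<close> by \<open>s\<close>.\<close>

lemma markov_op_emb: "markov_op G \<mu> (emb f) = emb (P f)"
proof
  fix u
  show "markov_op G \<mu> (emb f) u = emb (P f) u"
  proof (cases "u \<in> carrier G")
    case False
    then show ?thesis by (simp add: markov_op_def emb_def)
  next
    case u: True
    have "markov_op G \<mu> (emb f) u
        = (\<Sum>v\<in>(\<lambda>s. u \<otimes> s) ` set_pmf \<mu>. complex_of_real (walk_kernel G \<mu> u v) * emb f v)"
      unfolding markov_op_def if_P[OF u]
    proof (rule infsum_eq_sum)
      fix v assume v: "v \<in> carrier G - (\<lambda>s. u \<otimes> s) ` set_pmf \<mu>"
      then have "v = u \<otimes> (inv u \<otimes> v)" using u by (simp add: m_assoc[symmetric])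
      then have "inv u \<otimes> v \<notin> set_pmf \<mu>" using v by blast
      then show "complex_of_real (walk_kernel G \<mu> u v) * emb f v = 0"
        by (simp add: walk_kernel_def set_pmf_iff)
    qed (use finite_support support_closed u in auto)
    also have "\<dots> = (\<Sum>s\<in>set_pmf \<mu>. complex_of_real (pmf \<mu> s * lookup f (inv s \<otimes> inv u)))"
    proof (subst sum.reindex)
      show "inj_on (\<lambda>s. u \<otimes> s) (set_pmf \<mu>)"
        using u support_closed by (auto simp: inj_on_def)
    qed (use u support_closed in \<open>auto simp: walk_kernel_def emb_def m_assoc[symmetric] inv_mult_group intro!: sum.cong\<close>)
    also have "\<dots> = (\<Sum>s\<in>set_pmf \<mu>. complex_of_real (pmf \<mu> s * lookup f (s \<otimes> inv u)))"
      by (rule sum.reindex_bij_witness[of _ "\<lambda>s. inv s" "\<lambda>s. inv s"])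
        (auto simp: inv_support support_closed mu_sym[symmetric])
    also have "\<dots> = emb (P f) u"
      using u by (simp add: emb_def lookup_P lmul_def)
    finally show ?thesis .
  qed
qed

lemma P_keys: "keys f \<subseteq> carrier G \<Longrightarrow> keys (P f) \<subseteq> carrier G"
proof
  fix x assume f: "keys f \<subseteq> carrier G" and x: "x \<in> keys (P f)"
  show "x \<in> carrier G"
  proof (rule ccontr)
    assume "x \<notin> carrier G"
    then have "lookup (P f) x = lookup f x"
      by (simp add: lookup_P lmul_def sum_distrib_right[symmetric] sum_pmf_support)
    then show False using f x \<open>x \<notin> carrier G\<close> by (auto simp: in_keys_iff)
  qed
qed

text \<open>The resolvent \<open>R\<close> may leave the finitely supported functions, so it is
  applied only to \<open>(m - P) f\<close>, where it returns \<open>f\<close>; its bound then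
  becomes a lower bound for \<open>P - m\<close>.\<close>

lemma resolvent_bound:
  assumes "complex_of_real m \<notin> ell2_spectrum G (markov_op G \<mu>)"
  obtains B where "\<And>f. keys f \<subseteq> carrier G \<Longrightarrow> norm f \<le> B * norm (P f - m *\<^sub>R f)"
proof -
  let ?T = "markov_op G \<mu>"
  obtain R B where B: "\<And>f. f \<in> ell2 G \<Longrightarrow> ell2_norm G (R f) \<le> B * ell2_norm G f"
    and R: "\<And>f. f \<in> ell2 G \<Longrightarrow> R (\<lambda>x. complex_of_real m * f x - ?T f x) = f"
    using assms unfolding ell2_spectrum_def by blast
  have "norm f \<le> B * norm (P f - m *\<^sub>R f)" if f: "keys f \<subseteq> carrier G" for f
  proof -
    have "(\<lambda>x. complex_of_real m * emb f x - ?T (emb f) x) = emb (m *\<^sub>R f - P f)"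
      unfolding markov_op_emb by (auto simp: emb_def fun_eq_iff lookup_minus)
    then have "R (emb (m *\<^sub>R f - P f)) = emb f" using R[OF emb_in_ell2[of f]] by simp
    then have "ell2_norm G (emb f) \<le> B * ell2_norm G (emb (m *\<^sub>R f - P f))"
      using B[OF emb_in_ell2[of "m *\<^sub>R f - P f"]] by simp
    moreover have "keys (m *\<^sub>R f - P f) \<subseteq> carrier G"
    proof -
      have "keys (m *\<^sub>R f - P f) \<subseteq> keys f \<union> keys (P f)" by (auto simp: in_keys_iff lookup_minus)
      then show ?thesis using f P_keys[OF f] by blast
    qed
    ultimately show ?thesis using f by (simp add: ell2_norm_emb norm_minus_commute)
  qed
  then show ?thesis using that by blast
qed

text \<open>\<open>P\<close> fixes functions supported off the carrier and preserves support in the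
  carrier, so the cross terms vanish.\<close>

lemma inner_P_split:
  "inner (P f) f = inner (P (restr (carrier G) f)) (restr (carrier G) f) + (norm (restr (- carrier G) f))\<^sup>2"
proof -
  let ?c = "restr (carrier G) f" and ?o = "restr (- carrier G) f"
  have P_o: "P ?o = ?o"
    by (rule poly_mapping_eqI)
      (auto simp: lookup_P lmul_def lookup_restr sum_distrib_right[symmetric] sum_pmf_support
        support_closed intro!: sum.neutral)
  have orth: "inner ?o g = 0" if "keys g \<subseteq> carrier G" for g
    unfolding inner_poly_mapping_def
    using that by (intro sum.neutral) (auto simp: lookup_restr in_keys_iff split: if_splits)
  have orth': "inner g ?o = 0" if "keys g \<subseteq> carrier G" for g
    using orth[OF that] by (simp add: inner_commute)
  have kc: "keys ?c \<subseteq> carrier G" by (auto simp: in_keys_iff lookup_restr split: if_splits)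
  have "inner (P f) f = inner (P (?c + ?o)) (?c + ?o)" by (simp only: restr_add_compl)
  also have "\<dots> = inner (P ?c) ?c + inner ?o ?o"
    by (simp add: linear_add[OF linear_P] P_o inner_add_left inner_add_right orth[OF kc]
        orth[OF P_keys[OF kc]] orth'[OF kc] orth'[OF P_keys[OF kc]])
  finally show ?thesis by (simp add: power2_norm_eq_inner)
qed

lemma norm_restr_split: "inner f f = (norm (restr S f))\<^sup>2 + (norm (restr (- S) f))\<^sup>2"
proof -
  have "inner (restr S f) (restr (- S) f) = 0"
    unfolding inner_poly_mapping_def by (intro sum.neutral) (auto simp: lookup_restr)
  moreover have "inner f f = inner (restr S f + restr (- S) f) (restr S f + restr (- S) f)"
    by (simp only: restr_add_compl)
  ultimately show ?thesis
    by (simp add: inner_add_left inner_add_right power2_norm_eq_inner inner_commute)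
qed

text \<open>The infimum \<open>m\<close> of the quadratic form of \<open>P\<close> belongs to the spectrum: \<open>P - m\<close> is a positive form, so
  \<open>\<parallel>(P - m) f\<parallel>\<^sup>2 \<le> 2 \<langle>(P - m) f, f\<rangle>\<close>, and a bounded inverse of \<open>P - m\<close> would keep the form away from 0.\<close>

lemma spectrum_lower_bound:
  assumes "ell2_spectrum G (markov_op G \<mu>) \<subseteq> complex_of_real ` {a<..1}"
  obtains m where "a < m" "m \<le> 1" "\<And>f. m * inner f f \<le> inner (P f) f"
proof -
  define S where "S = {inner (P f) f | f. keys f \<subseteq> carrier G \<and> norm f = 1}"
  define m where "m = Inf S"
  have unit: "\<bar>inner (P f) f\<bar> \<le> 1" if "norm f = 1" for f
    using abs_inner_P_le[of f] that by (simp add: power2_norm_eq_inner[symmetric])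
  have bdd: "bdd_below S"
    by (rule bdd_belowI[of _ "-1"]) (use unit in \<open>auto simp: S_def abs_le_iff\<close>)
  have mem: "inner (P (single \<one> 1)) (single \<one> 1) \<in> S"
    unfolding S_def by (rule CollectI, intro exI[of _ "single \<one> 1"]) simp
  have m1: "m \<le> 1"
  proof -
    have "m \<le> inner (P (single \<one> 1)) (single \<one> 1)" unfolding m_def by (rule cInf_lower[OF mem bdd])
    also have "\<dots> \<le> 1" using unit[of "single \<one> 1"] by simp
    finally show ?thesis .
  qed
  have m2: "-1 \<le> m"
    unfolding m_def by (rule cInf_greatest) (use mem unit in \<open>auto simp: S_def abs_le_iff\<close>)
  have low_c: "m * inner f f \<le> inner (P f) f" if f: "keys f \<subseteq> carrier G" for f
  proof (cases "f = 0")
    case True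
    then show ?thesis by simp
  next
    case False
    define g where "g = (1 / norm f) *\<^sub>R f"
    have "keys g \<subseteq> carrier G" "norm g = 1" using f False by (auto simp: g_def in_keys_iff)
    then have "inner (P g) g \<in> S" by (auto simp: S_def)
    then have "m \<le> inner (P g) g" unfolding m_def by (rule cInf_lower[OF _ bdd])
    also have "inner (P g) g = inner (P f) f / (norm f)\<^sup>2"
      by (simp add: g_def linear_cmul[OF linear_P] power2_eq_square)
    finally show ?thesis using False by (simp add: field_simps power2_norm_eq_inner)
  qed
  have low: "m * inner f f \<le> inner (P f) f" for f
  proof -
    have "keys (restr (carrier G) f) \<subseteq> carrier G" by (auto simp: in_keys_iff lookup_restr split: if_splits)
    from low_c[OF this] have "m * (norm (restr (carrier G) f))\<^sup>2 \<le> inner (P (restr (carrier G) f)) (restr (carrier G) f)"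
      by (simp add: power2_norm_eq_inner)
    \<comment> \<open>Off the carrier \<open>P\<close> is the identity, and
      \<open>m \<le> 1\<close>.\<close>
    moreover have "m * (norm (restr (- carrier G) f))\<^sup>2 \<le> 1 * (norm (restr (- carrier G) f))\<^sup>2"
      by (intro mult_right_mono m1) auto
    ultimately show ?thesis
      unfolding inner_P_split[of f] norm_restr_split[of f "carrier G"] by (simp add: algebra_simps)
  qed
  define T where "T f = P f - m *\<^sub>R f" for f
  interpret T: positive_operator T 2
  proof (rule positive_operator.intro)
    show "linear T"
      by (rule linearI) (simp_all add: T_def linear_add[OF linear_P] linear_cmul[OF linear_P] algebra_simps)
    show "inner (T f) g = inner f (T g)" for f g
      by (simp add: T_def inner_diff_left inner_diff_right inner_P_sym)
    show "0 \<le> inner (T f) f" for f using low[of f] by (simp add: T_def inner_diff_left)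
    show "inner (T f) f \<le> 2 * inner f f" for f
    proof -
      have "(-1) * inner f f \<le> m * inner f f" using m2 by (intro mult_right_mono) auto
      then show ?thesis using abs_inner_P_le[of f] by (simp add: T_def inner_diff_left)
    qed
  qed simp
  have "complex_of_real m \<in> ell2_spectrum G (markov_op G \<mu>)"
  proof (rule ccontr)
    assume "\<not> ?thesis"
    then obtain B where B: "\<And>f. keys f \<subseteq> carrier G \<Longrightarrow> norm f \<le> B * norm (T f)"
      unfolding T_def using resolvent_bound by blast
    \<comment> \<open>Chosen so that \<open>2 B^2 \<epsilon> < 1\<close>.\<close>
    define \<epsilon> where "\<epsilon> = 1 / (2 * B\<^sup>2 + 1)"
    have \<epsilon>: "0 < \<epsilon>" unfolding \<epsilon>_def by (intro divide_pos_pos) (auto intro: add_nonneg_pos)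
    obtain f where f: "keys f \<subseteq> carrier G" "norm f = 1" "inner (P f) f < m + \<epsilon>"
      using cInf_lessD[of S "m + \<epsilon>"] mem \<epsilon> unfolding m_def[symmetric] by (auto simp: S_def)
    have ff: "inner f f = 1" using f(2) by (simp add: power2_norm_eq_inner[symmetric])
    have "1 \<le> B * norm (T f)" using B[OF f(1)] f(2) by simp
    then have "1\<^sup>2 \<le> (B * norm (T f))\<^sup>2" by (intro power_mono) auto
    also have "\<dots> = B\<^sup>2 * (norm (T f))\<^sup>2" by (simp add: power_mult_distrib)
    also have "\<dots> \<le> B\<^sup>2 * (2 * \<epsilon>)"
    proof (rule mult_left_mono)
      have "inner (T f) f \<le> \<epsilon>" using f(3) ff by (simp add: T_def inner_diff_left)
      then show "(norm (T f))\<^sup>2 \<le> 2 * \<epsilon>" using T.norm_L_le[of f] by linarith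
    qed simp
    also have "\<dots> < 1"
    proof -
      have "0 < 2 * B\<^sup>2 + 1" by (auto intro: add_nonneg_pos)
      then show ?thesis by (simp add: \<epsilon>_def field_simps)
    qed
    finally show False by simp
  qed
  then have "a < m" using assms by auto
  then show ?thesis using that m1 low by blast
qed

lemma Lap_positive_operator:
  assumes "\<And>f. m * inner f f \<le> inner (P f) f" "1 - m \<le> b" "0 < b"
  shows "positive_operator Lap b"
proof (rule positive_operator.intro)
  show "inner (Lap f) f \<le> b * inner f f" for f
  proof -
    have "inner (Lap f) f \<le> (1 - m) * inner f f"
      using assms(1)[of f] by (simp add: Lap_def inner_diff_left algebra_simps)
    also have "\<dots> \<le> b * inner f f" by (intro mult_right_mono assms) auto
    finally show ?thesis .
  qed
qed (use linear_Lap inner_Lap_sym Dirichlet_nonneg assms in auto)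

end

section \<open>On-diagonal decay\<close>

text \<open>Discrete form of \<open>u' = - \<kappa> u^(1+\<alpha>)\<close>, for which
  \<open>u^(-\<alpha>)\<close> grows linearly. The induction keeps
  \<open>u^\<alpha> c (n + 1) \<le> 1\<close>, a form that admits \<open>u = 0\<close>; a step uses
  \<open>1 - x \<le> exp (- x)\<close> and \<open>1 + x \<le> exp x\<close>.\<close>

lemma decay_of_difference_inequality:
  fixes u :: "nat \<Rightarrow> real"
  assumes nonneg: "\<And>n. 0 \<le> u n" and init: "u 0 \<le> 1" and \<kappa>: "0 < \<kappa>" and \<alpha>: "0 < \<alpha>"
    and step: "\<And>n. u (Suc n) \<le> u n - \<kappa> * u n * u n powr \<alpha>"
  shows "u n \<le> (min 1 (\<alpha> * \<kappa>) * real (Suc n)) powr (- 1 / \<alpha>)"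
proof -
  define c where "c = min 1 (\<alpha> * \<kappa>)"
  have c: "0 < c" "c \<le> 1" "c \<le> \<alpha> * \<kappa>" using \<kappa> \<alpha> by (simp_all add: c_def)
  have inv: "u n powr \<alpha> * (c * real (Suc n)) \<le> 1" for n
  proof (induction n)
    case 0
    have "u 0 powr \<alpha> * c \<le> 1 * 1"
      using nonneg[of 0] init c \<alpha> by (intro mult_mono) (auto simp: powr_le1)
    then show ?case by simp
  next
    case (Suc n)
    define p where "p = u n powr \<alpha>"
    have p: "0 \<le> p" by (simp add: p_def)
    have le: "u (Suc n) \<le> u n * (1 - \<kappa> * p)" using step[of n] by (simp add: p_def algebra_simps)
    show ?case
    proof (cases "u (Suc n) = 0")
      case True
      then show ?thesis by simp
    next
      case False
      then have pos: "0 < u n * (1 - \<kappa> * p)" using le nonneg[of "Suc n"] by linarith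
      then have q: "0 < 1 - \<kappa> * p" "0 < u n" using nonneg[of n] by (auto simp: zero_less_mult_iff)
      have "u (Suc n) powr \<alpha> \<le> (u n * (1 - \<kappa> * p)) powr \<alpha>"
        using le nonneg[of "Suc n"] \<alpha> by (intro powr_mono2) auto
      also have "\<dots> = p * (1 - \<kappa> * p) powr \<alpha>" using q by (simp add: powr_mult p_def)
      also have "\<dots> \<le> p * exp (- (\<kappa> * p)) powr \<alpha>"
        using exp_ge_add_one_self[of "- (\<kappa> * p)"] q p \<alpha> by (intro mult_left_mono powr_mono2) auto
      also have "\<dots> = p * exp (- (\<alpha> * \<kappa> * p))" by (simp add: powr_def mult_ac)
      finally have "u (Suc n) powr \<alpha> * exp (\<alpha> * \<kappa> * p) \<le> p" by (simp add: exp_minus field_simps)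
      moreover have "u (Suc n) powr \<alpha> * (1 + \<alpha> * \<kappa> * p) \<le> u (Suc n) powr \<alpha> * exp (\<alpha> * \<kappa> * p)"
        by (intro mult_left_mono exp_ge_add_one_self) auto
      ultimately have *: "u (Suc n) powr \<alpha> * (1 + \<alpha> * \<kappa> * p) \<le> p" by linarith
      have den: "0 < 1 + \<alpha> * \<kappa> * p" using \<alpha> \<kappa> p by (simp add: add_pos_nonneg)
      have "(u (Suc n) powr \<alpha> * (c * real (Suc (Suc n)))) * (1 + \<alpha> * \<kappa> * p)
          = (u (Suc n) powr \<alpha> * (1 + \<alpha> * \<kappa> * p)) * (c * real (Suc (Suc n)))" by (simp only: mult_ac)
      also have "\<dots> \<le> p * (c * real (Suc (Suc n)))" using c by (intro mult_right_mono *) auto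
      also have "\<dots> = p * (c * real (Suc n)) + c * p" by (simp add: algebra_simps)
      also have "\<dots> \<le> 1 + \<alpha> * \<kappa> * p"
        using Suc c p by (intro add_mono mult_right_mono) (auto simp: p_def)
      finally have "(u (Suc n) powr \<alpha> * (c * real (Suc (Suc n)))) * (1 + \<alpha> * \<kappa> * p) \<le> 1 * (1 + \<alpha> * \<kappa> * p)" by simp
      then show ?thesis using den by (rule mult_right_le_imp_le)
    qed
  qed
  have "u n powr \<alpha> \<le> 1 / (c * real (Suc n))"
    using inv[of n] c by (subst pos_le_divide_eq) auto
  then have "(u n powr \<alpha>) powr (1 / \<alpha>) \<le> (1 / (c * real (Suc n))) powr (1 / \<alpha>)"
    using \<alpha> by (intro powr_mono2) auto
  then show ?thesis
    using \<alpha> nonneg[of n] c by (simp add: powr_powr c_def powr_minus_divide powr_divide)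
qed

text \<open>A good choice of \<open>r\<close> in \<open>nash\<close> bounds \<open>m\<close> from
  below; \<open>moment\<close> passes from \<open>m\<close> to \<open>e\<close>, and a factor
  \<open>u^(k-1)\<close> cancels.\<close>

lemma Nash_to_differential:
  fixes u e m \<kappa> c d :: real
  assumes u: "0 < u" "u \<le> 1" and k: "1 \<le> k" and \<kappa>: "0 < \<kappa>" and c: "0 < c" "c \<le> 1" and d: "0 < d"
    and nash: "\<And>r. 1 \<le> r \<Longrightarrow> u \<le> \<kappa> * r\<^sup>2 * m + 2 / (c * r powr d)"
    and moment: "m ^ k \<le> e * u ^ (k - 1)"
  shows "(1 / (2 * \<kappa>)) ^ k * (c / 4) powr (2 * real k / d) * u * u powr (2 * real k / d) \<le> e"
proof -
  \<comment> \<open>Makes the volume term \<open>2 / (c r^d)\<close> equal to \<open>u / 2\<close>;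
    \<open>r \<ge> 1\<close> because \<open>c u \<le> 1\<close>.\<close>
  define r where "r = (4 / (c * u)) powr (1 / d)"
  have "c * u \<le> 1 * 1" using c u by (intro mult_mono) auto
  then have "1 \<le> 4 / (c * u)" using c u by (simp add: field_simps)
  then have r: "1 \<le> r" using d by (simp add: r_def ge_one_powr_ge_zero)
  have rd: "r powr d = 4 / (c * u)" using d c u by (simp add: r_def powr_powr)
  have "u \<le> \<kappa> * r\<^sup>2 * m + u / 2"
    using nash[OF r] c u unfolding rd by (simp add: field_simps)
  then have "u / (2 * \<kappa> * r\<^sup>2) \<le> m" using \<kappa> r by (simp add: field_simps)
  then have "(u / (2 * \<kappa> * r\<^sup>2)) ^ k \<le> m ^ k" using u \<kappa> by (intro power_mono) auto
  also note moment
  finally have "(1 / (2 * \<kappa>)) ^ k * (1 / (r\<^sup>2) ^ k) * u ^ k \<le> e * u ^ (k - 1)"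
    by (simp add: power_divide power_mult_distrib)
  moreover have "u ^ k = u * u ^ (k - 1)" using k by (cases k) auto
  ultimately have "((1 / (2 * \<kappa>)) ^ k * (1 / (r\<^sup>2) ^ k) * u) * u ^ (k - 1) \<le> e * u ^ (k - 1)"
    by (simp add: mult_ac)
  then have "(1 / (2 * \<kappa>)) ^ k * (1 / (r\<^sup>2) ^ k) * u \<le> e"
    by (rule mult_right_le_imp_le) (use u in auto)
  moreover have "1 / (r\<^sup>2) ^ k = (c / 4) powr (2 * real k / d) * u powr (2 * real k / d)"
  proof -
    have "(r\<^sup>2) ^ k = r powr (2 * real k)"
      using r powr_realpow[of r "2 * k"] by (simp add: power_mult)
    also have "\<dots> = (4 / (c * u)) powr (2 * real k / d)"
      using d by (simp add: r_def powr_powr)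
    finally have "1 / (r\<^sup>2) ^ k = (c * u / 4) powr (2 * real k / d)"
      using c u by (simp add: powr_divide)
    also have "\<dots> = (c / 4) powr (2 * real k / d) * u powr (2 * real k / d)"
      using c u powr_mult[of "c / 4" u] by simp
    finally show ?thesis .
  qed
  ultimately show ?thesis by (simp add: mult_ac)
qed

context symmetric_walk
begin

text \<open>\<open>B\<close> is convolution with the kernel \<open>B \<delta>\<close>, for
  \<open>\<delta>\<close> the point mass at the identity, and self-adjointness makes the kernel
  even: its value at \<open>g\<close> is the inner product with a right translate of
  \<open>\<delta>\<close>, and the translation moves to the other side.\<close>

lemma lookup_operator_inv:
  assumes sym: "\<And>f h. inner (B f) h = inner f (B h)"
    and comm: "\<And>y f. y \<in> carrier G \<Longrightarrow> B (rt y f) = rt y (B f)"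
    and g: "g \<in> carrier G"
  shows "lookup (B (single \<one> 1)) (inv g) = lookup (B (single \<one> 1)) g"
proof -
  have "lookup (B (single \<one> 1)) g = inner (B (single \<one> 1)) (rt (inv g) (single \<one> 1))"
    using g by (simp add: rt_single)
  also have "\<dots> = inner (rt (inv g) (B (single \<one> 1))) (single \<one> 1)"
    using g by (simp only: sym comm inv_closed) (rule inner_commute)
  also have "\<dots> = lookup (B (single \<one> 1)) (inv g)"
    using g by (simp add: lookup_rt rmul_def)
  finally show ?thesis by simp
qed

end

locale higher_order_walk = symmetric_walk G \<mu> + positive_operator "symmetric_walk.Lap G \<mu>" b
  for G :: "('a, 'b) monoid_scheme" (structure) and \<mu> :: "'a pmf" and b :: real +
  fixes k :: nat
  assumes k: "1 \<le> k" and b_power: "b ^ k < 2"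
begin

definition K :: "nat \<Rightarrow> 'a \<Rightarrow>\<^sub>0 real" where
  "K n = (A k ^^ n) (single \<one> 1)"

lemma norm_A_power_le: "norm ((A k ^^ n) f) \<le> norm f"
  by (rule norm_A_contraction) (use b_power in simp)

lemma K_add: "K (m + n) = (A k ^^ m) (K n)"
  by (simp add: K_def funpow_add)

lemma Lap_power_rt: "y \<in> carrier G \<Longrightarrow> (Lap ^^ j) (rt y f) = rt y ((Lap ^^ j) f)"
  by (induction j) (simp_all add: Lap_rt)

lemma A_power_rt: "y \<in> carrier G \<Longrightarrow> (A k ^^ n) (rt y f) = rt y ((A k ^^ n) f)"
  by (induction n) (simp_all add: A_def Lap_power_rt linear_diff[OF linear_rt])

lemma lookup_K_inv:
  assumes "g \<in> carrier G"
  shows "lookup (K n) (inv g) = lookup (K n) g"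
  unfolding K_def by (rule lookup_operator_inv[OF sym_A_power A_power_rt assms])

text \<open>Averaging uses right translations, which commute with \<open>A k\<close>, while the
  Dirichlet form controls left ones. Since \<open>K n\<close> is even, inversion exchanges the
  two.\<close>

lemma norm_K_rt_diff:
  assumes y: "y \<in> carrier G"
  shows "norm (K n - rt (inv y) (K n)) = norm (K n - lt y (K n))"
proof -
  define J where "J x = (if x \<in> carrier G then inv x else x)" for x
  have JJ: "J (J x) = x" for x by (simp add: J_def)
  have bij: "bij J" by (rule o_bij[of J]) (auto simp: fun_eq_iff JJ)
  have "map_key J (K n - rt (inv y) (K n)) = K n - lt y (K n)"
  proof (rule poly_mapping_eqI)
    fix x
    show "lookup (map_key J (K n - rt (inv y) (K n))) x = lookup (K n - lt y (K n)) x"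
    proof (cases "x \<in> carrier G")
      case False
      then show ?thesis
        using y by (simp add: map_key.rep_eq[OF bij_is_inj[OF bij]] lookup_minus lookup_rt lookup_lt
            J_def rmul_def lmul_def)
    next
      case True
      have "lookup (K n) (inv x \<otimes> inv y) = lookup (K n) (y \<otimes> x)"
        using lookup_K_inv[of "y \<otimes> x" n] True y by (simp add: inv_mult_group)
      then show ?thesis
        using True y by (simp add: map_key.rep_eq[OF bij_is_inj[OF bij]] lookup_minus lookup_rt lookup_lt
            J_def rmul_def lmul_def lookup_K_inv)
    qed
  qed
  then show ?thesis using norm_map_key_bij[OF bij, of "K n - rt (inv y) (K n)"] by simp
qed

definition min_mass :: real where
  "min_mass = Min (pmf \<mu> ` set_pmf \<mu>)"

lemma min_mass: "0 < min_mass" "s \<in> set_pmf \<mu> \<Longrightarrow> min_mass \<le> pmf \<mu> s"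
  using finite_support set_pmf_not_empty[of \<mu>] by (auto simp: min_mass_def pmf_positive)

text \<open>A generator contributes one term of the Dirichlet form, with weight at least
  \<open>min_mass\<close>.\<close>

lemma norm_lt_diff_support:
  assumes s: "s \<in> set_pmf \<mu>"
  shows "norm (f - lt s f) \<le> sqrt (2 / min_mass * inner (Lap f) f)"
proof -
  have "min_mass * (norm (f - lt s f))\<^sup>2 \<le> pmf \<mu> s * (norm (f - lt s f))\<^sup>2"
    by (intro mult_right_mono min_mass s) auto
  also have "\<dots> \<le> (\<Sum>s\<in>set_pmf \<mu>. pmf \<mu> s * (norm (f - lt s f))\<^sup>2)"
    by (rule member_le_sum[OF s]) (auto simp: finite_support)
  also have "\<dots> = 2 * inner (Lap f) f" by (simp add: Dirichlet_form)
  finally have "(norm (f - lt s f))\<^sup>2 \<le> 2 / min_mass * inner (Lap f) f"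
    using min_mass(1) by (simp add: field_simps)
  then show ?thesis by (rule real_le_rsqrt)
qed

text \<open>Triangle inequality along a path to \<open>g\<close>, one generator at a time.\<close>

lemma norm_lt_diff_reach:
  "reach n g \<Longrightarrow> norm (f - lt g f) \<le> real n * sqrt (2 / min_mass * inner (Lap f) f)"
proof (induction n arbitrary: g)
  case 0
  then have "g = \<one>" by (simp add: reach_0)
  then have "lt g f = f" by (intro poly_mapping_eqI) (simp add: lookup_lt lmul_def)
  then show ?case by simp
next
  case (Suc n)
  then obtain h s where h: "reach n h" "h \<in> carrier G" "s \<in> set_pmf \<mu>" "g = h \<otimes> s"
    by (auto simp: reach_Suc)
  have s: "s \<in> carrier G" using h(3) by (rule support_closed)
  have "lt g f = lt s (lt h f)" using h s by (simp add: lt_lt)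
  then have eq: "f - lt g f = (f - lt s f) + lt s (f - lt h f)"
    by (simp add: linear_diff[OF linear_lt[OF s]])
  have "norm (f - lt g f) \<le> norm (f - lt s f) + norm (f - lt h f)"
    unfolding eq using norm_triangle_ineq[of "f - lt s f" "lt s (f - lt h f)"] by (simp only: norm_lt[OF s])
  also have "\<dots> \<le> sqrt (2 / min_mass * inner (Lap f) f) + real n * sqrt (2 / min_mass * inner (Lap f) f)"
    by (intro add_mono norm_lt_diff_support Suc.IH h)
  finally show ?case by (simp add: algebra_simps)
qed

lemma norm_sum_single_ball: "(norm (\<Sum>y\<in>ball_set r. single y (1::real)))\<^sup>2 = real (card (ball_set r))"
proof -
  have *: "lookup (\<Sum>y\<in>ball_set r. single y (1::real)) x = (if x \<in> ball_set r then 1 else 0)" for x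
    by (simp add: lookup_sum lookup_single when_def finite_ball_set)
  then have "keys (\<Sum>y\<in>ball_set r. single y (1::real)) \<subseteq> ball_set r"
    by (auto simp: in_keys_iff split: if_splits)
  then have "(norm (\<Sum>y\<in>ball_set r. single y (1::real)))\<^sup>2
      = (\<Sum>x\<in>ball_set r. (lookup (\<Sum>y\<in>ball_set r. single y (1::real)) x)\<^sup>2)"
    by (rule norm_poly_mapping_superset[OF finite_ball_set])
  then show ?thesis by (simp add: *)
qed

text \<open>Averaging \<open>K n\<close> over a ball by right translations, which commute with \<open>A k\<close>, gives
  \<open>A k ^^ n\<close> applied to the normalised indicator of the ball, of norm at most \<open>V(r) powr (-1/2)\<close>.\<close>

lemma Nash_K:
  assumes r: "0 < r"
  shows "(norm (K n))\<^sup>2 \<le> 4 / min_mass * r\<^sup>2 * inner (Lap (K n)) (K n) + 2 / real (ball_card G \<mu> r)"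
proof -
  define B where "B = ball_set r"
  define V where "V = real (card B)"
  have V: "0 < V" using ball_card_pos[OF r] by (simp add: V_def B_def ball_card_eq)
  have B: "y \<in> carrier G" "reach (len y) y" "real (len y) \<le> r" if "y \<in> B" for y
    using that reach_len by (auto simp: B_def ball_set_def)
  define a where "a = (1 / V) *\<^sub>R (\<Sum>y\<in>B. rt (inv y) (K n))"
  define \<delta> where "\<delta> = sqrt (2 / min_mass * inner (Lap (K n)) (K n))"
  have \<delta>: "0 \<le> \<delta>" unfolding \<delta>_def by (intro real_sqrt_ge_zero mult_nonneg_nonneg Dirichlet_nonneg)
      (use min_mass in auto)
  have \<delta>2: "\<delta>\<^sup>2 = 2 / min_mass * inner (Lap (K n)) (K n)"
    unfolding \<delta>_def by (intro real_sqrt_pow2 mult_nonneg_nonneg Dirichlet_nonneg) (use min_mass in auto)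
  have "K n - a = (1 / V) *\<^sub>R (\<Sum>y\<in>B. K n - rt (inv y) (K n))"
    using V by (simp add: a_def sum_subtractf scaleR_diff_right V_def sum_constant_scaleR)
  then have "norm (K n - a) \<le> (1 / V) * (\<Sum>y\<in>B. norm (K n - rt (inv y) (K n)))"
    using V norm_sum[of "\<lambda>y. K n - rt (inv y) (K n)" B] by (simp add: divide_right_mono)
  also have "\<dots> \<le> (1 / V) * (\<Sum>y\<in>B. r * \<delta>)"
  proof (intro mult_left_mono sum_mono)
    fix y assume y: "y \<in> B"
    have "norm (K n - rt (inv y) (K n)) \<le> real (len y) * \<delta>"
      unfolding \<delta>_def norm_K_rt_diff[OF B(1)[OF y]] by (rule norm_lt_diff_reach[OF B(2)[OF y]])
    also have "\<dots> \<le> r * \<delta>" by (intro mult_right_mono B y \<delta>)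
    finally show "norm (K n - rt (inv y) (K n)) \<le> r * \<delta>" .
  qed (use V in auto)
  also have "\<dots> = r * \<delta>" using V by (simp add: V_def)
  finally have diff: "norm (K n - a) \<le> r * \<delta>" .
  have "a = (A k ^^ n) ((1 / V) *\<^sub>R (\<Sum>y\<in>B. single y 1))"
  proof -
    have "rt (inv y) (K n) = (A k ^^ n) (single y 1)" if "y \<in> B" for y
      using B(1)[OF that] by (simp add: K_def A_power_rt[symmetric] rt_single)
    then show ?thesis
      by (simp add: a_def linear_cmul[OF linear_A_power] linear_sum[OF linear_A_power])
  qed
  then have "norm a \<le> norm ((1 / V) *\<^sub>R (\<Sum>y\<in>B. single y (1::real)))"
    by (simp only: norm_A_power_le)
  then have "(norm a)\<^sup>2 \<le> (norm ((1 / V) *\<^sub>R (\<Sum>y\<in>B. single y (1::real))))\<^sup>2"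
    by (intro power_mono) auto
  also have "\<dots> = (1 / V)\<^sup>2 * V"
    by (simp only: norm_scaleR power_mult_distrib B_def norm_sum_single_ball V_def power2_abs)
  also have "\<dots> = 1 / V" using V by (simp add: power2_eq_square)
  finally have avg: "(norm a)\<^sup>2 \<le> 1 / V" .
  have "norm (K n) \<le> norm (K n - a) + norm a" using norm_triangle_ineq[of "K n - a" a] by simp
  also have "\<dots> \<le> r * \<delta> + norm a" using diff by simp
  finally have "(norm (K n))\<^sup>2 \<le> (r * \<delta> + norm a)\<^sup>2" by (intro power_mono) auto
  also have "\<dots> \<le> 2 * (r * \<delta>)\<^sup>2 + 2 * (norm a)\<^sup>2"
    using sum_squares_bound[of "r * \<delta>" "norm a"] by (simp add: power2_sum)
  also have "\<dots> \<le> 2 * (r * \<delta>)\<^sup>2 + 2 * (1 / V)" using avg by simp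
  finally show ?thesis
    by (simp add: power_mult_distrib \<delta>2 V_def B_def ball_card_eq mult_ac)
qed

lemma norm_K_on_diagonal:
  assumes d: "0 < d" and c: "0 < c" and volume: "\<And>r. 1 \<le> r \<Longrightarrow> c * r powr d \<le> real (ball_card G \<mu> r)"
  obtains C where "0 < C" "\<And>n. norm (K n) \<le> C * real (Suc n) powr (- d / (4 * real k))"
proof -
  \<comment> \<open>Truncated at 1 so that the radius chosen in \<open>Nash_to_differential\<close>
    is at least 1.\<close>
  define c' where "c' = min c 1"
  have c': "0 < c'" "c' \<le> 1" "c' \<le> c" using c by (auto simp: c'_def)
  define \<kappa> where "\<kappa> = 4 / min_mass"
  have \<kappa>: "0 < \<kappa>" using min_mass(1) by (simp add: \<kappa>_def)
  define u where "u n = (norm (K n))\<^sup>2" for n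
  \<comment> \<open>\<open>u n\<close> decays like \<open>n^(-1/\<alpha>) = n^(-d/(2k))\<close>; the
    norm, its square root, has half this exponent.\<close>
  define \<alpha> where "\<alpha> = 2 * real k / d"
  have \<alpha>: "0 < \<alpha>" using d k by (simp add: \<alpha>_def)
  define \<eta> where "\<eta> = (1 / (2 * \<kappa>)) ^ k * (c' / 4) powr \<alpha>"
  have \<eta>: "0 < \<eta>" using \<kappa> c' by (simp add: \<eta>_def)
  have u1: "u n \<le> 1" for n
  proof -
    have "norm (K n) \<le> norm (single \<one> (1::real))" unfolding K_def by (rule norm_A_power_le)
    then show ?thesis by (simp add: u_def power_le_one)
  qed
  have step: "u (Suc n) \<le> u n - (2 - b ^ k) * \<eta> * u n * u n powr \<alpha>" for n
  proof -
    have "u (Suc n) \<le> u n - (2 - b ^ k) * moment (K n) k"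
      using norm_A_le[of k "K n"] by (simp add: u_def K_def)
    moreover have "\<eta> * u n * u n powr \<alpha> \<le> moment (K n) k"
    proof (cases "u n = 0")
      case True
      then show ?thesis by (simp add: moment_nonneg)
    next
      case False
      then have un: "0 < u n" by (simp add: u_def)
      show ?thesis unfolding \<eta>_def \<alpha>_def
      proof (rule Nash_to_differential[OF un u1 k \<kappa> c'(1,2) d, where m = "inner (Lap (K n)) (K n)"])
        fix r :: real assume r: "1 \<le> r"
        have "c' * r powr d \<le> c * r powr d" using c' by (intro mult_right_mono) auto
        also note volume[OF r]
        finally have "2 / real (ball_card G \<mu> r) \<le> 2 / (c' * r powr d)"
          using c' r by (intro divide_left_mono) (auto intro!: mult_pos_pos ball_card_pos)
        then show "u n \<le> \<kappa> * r\<^sup>2 * inner (Lap (K n)) (K n) + 2 / (c' * r powr d)"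
          using Nash_K[of r n] r unfolding u_def \<kappa>_def by linarith
      next
        show "inner (Lap (K n)) (K n) ^ k \<le> moment (K n) k * u n ^ (k - 1)"
          unfolding u_def by (rule moment_power_le[OF k])
      qed
    qed
    then have "(2 - b ^ k) * (\<eta> * u n * u n powr \<alpha>) \<le> (2 - b ^ k) * moment (K n) k"
      using b_power by (intro mult_left_mono) auto
    ultimately show ?thesis by (simp add: mult.assoc)
  qed
  define \<theta> where "\<theta> = min 1 (\<alpha> * ((2 - b ^ k) * \<eta>))"
  have \<theta>: "0 < \<theta>" using \<alpha> \<eta> b_power by (simp add: \<theta>_def)
  have bound: "u n \<le> (\<theta> * real (Suc n)) powr (- 1 / \<alpha>)" for n
    unfolding \<theta>_def
    by (rule decay_of_difference_inequality) (use u1 step \<eta> \<alpha> b_power in \<open>auto simp: u_def mult.assoc\<close>)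
  have "norm (K n) \<le> \<theta> powr (- d / (4 * real k)) * real (Suc n) powr (- d / (4 * real k))" for n
  proof -
    have "norm (K n) = sqrt (u n)" by (simp add: u_def)
    also have "\<dots> \<le> sqrt ((\<theta> * real (Suc n)) powr (- 1 / \<alpha>))" by (rule real_sqrt_le_mono[OF bound])
    also have "\<dots> = ((\<theta> * real (Suc n)) powr (- 1 / \<alpha>)) powr (1 / 2)"
      using \<theta> by (simp add: powr_half_sqrt)
    also have "\<dots> = (\<theta> * real (Suc n)) powr (- d / (4 * real k))"
      by (simp add: powr_powr \<alpha>_def)
    also have "\<dots> = \<theta> powr (- d / (4 * real k)) * real (Suc n) powr (- d / (4 * real k))"
      using \<theta> by (simp add: powr_mult)
    finally show ?thesis .
  qed
  then show ?thesis using that[of "\<theta> powr (- d / (4 * real k))"] \<theta> by auto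
qed

end

section \<open>Off-diagonal decay\<close>

lemma keys_diff_subset: "keys (f - g) \<subseteq> keys f \<union> keys (g :: 'a \<Rightarrow>\<^sub>0 'b::ab_group_add)"
  by (auto simp: in_keys_iff lookup_minus)

lemma keys_scaleR_subset: "keys (r *\<^sub>R f) \<subseteq> keys (f :: 'a \<Rightarrow>\<^sub>0 'b::real_vector)"
  by (auto simp: in_keys_iff)

context symmetric_walk
begin

section \<open>Finite propagation speed\<close>

lemma keys_Lap_ball:
  assumes "keys f \<subseteq> ball_set t"
  shows "keys (Lap f) \<subseteq> ball_set (t + 1)"
proof -
  have "keys (P f) \<subseteq> ball_set (t + 1)"
  proof
    fix x assume "x \<in> keys (P f)"
    then have "\<exists>s\<in>set_pmf \<mu>. lookup f (lmul s x) \<noteq> 0"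
      unfolding in_keys_iff lookup_P by (metis (no_types, lifting) mult_zero_right sum.neutral)
    then obtain s where s: "s \<in> set_pmf \<mu>" "lmul s x \<in> ball_set t"
      using assms by (auto simp: in_keys_iff)
    have sc: "s \<in> carrier G" using s(1) by (rule support_closed)
    have x: "x \<in> carrier G"
      using s(2) by (cases "x \<in> carrier G") (auto simp: lmul_def ball_set_def)
    then have sx: "real (len (s \<otimes> x)) < t" using s(2) by (auto simp: lmul_def ball_set_def)
    have "len x = len (inv s \<otimes> (s \<otimes> x))" using x sc by (simp add: m_assoc[symmetric])
    also have "\<dots> \<le> len (inv s) + len (s \<otimes> x)" by (rule len_mult) (use x sc in auto)
    also have "len (inv s) \<le> 1" using len_le[OF reach_support[OF s(1)]] len_inv[OF sc] by simp
    finally show "x \<in> ball_set (t + 1)" using sx x by (simp add: ball_set_def)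
  qed
  moreover have "ball_set t \<subseteq> ball_set (t + 1)" by (rule ball_set_mono) simp
  ultimately show ?thesis
    using assms keys_diff_subset[of f "P f"] unfolding Lap_def by blast
qed

end

context higher_order_walk
begin

lemma keys_Q_ball:
  assumes "keys f \<subseteq> ball_set t"
  shows "keys (Q f) \<subseteq> ball_set (t + 1)"
proof -
  have "ball_set t \<subseteq> ball_set (t + 1)" by (rule ball_set_mono) simp
  then show ?thesis
    using assms keys_Lap_ball[OF assms] keys_diff_subset[of f "(2 / b) *\<^sub>R Lap f"]
      keys_scaleR_subset[of "2 / b" "Lap f"]
    unfolding Q_def by blast
qed

lemma keys_T_ball:
  assumes "keys f \<subseteq> ball_set t"
  shows "keys (T j f) \<subseteq> ball_set (t + real j)"
proof (induction j rule: induct_nat_012)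
  case 0
  then show ?case using assms by simp
next
  case 1
  then show ?case using keys_Q_ball[OF assms] by simp
next
  case (ge2 j)
  have "keys (Q (T (Suc j) f)) \<subseteq> ball_set (t + real (Suc (Suc j)))"
    using keys_Q_ball[OF ge2(2)] by (simp add: algebra_simps)
  moreover have "keys (T j f) \<subseteq> ball_set (t + real (Suc (Suc j)))"
    using ge2(1) ball_set_mono[of "t + real j" "t + real (Suc (Suc j))"] by auto
  ultimately show ?case
    unfolding T_Suc_Suc
    using keys_diff_subset[of "2 *\<^sub>R Q (T (Suc j) f)" "T j f"] keys_scaleR_subset[of 2 "Q (T (Suc j) f)"]
    by blast
qed

definition tail :: "nat \<Rightarrow> real \<Rightarrow> real" where
  "tail n \<rho> = (\<Sum>j\<in>{j \<in> keys (laurent_coeffs b k n). \<rho> \<le> real_of_int \<bar>j\<bar>}. \<bar>lookup (laurent_coeffs b k n) j\<bar>)"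

text \<open>Terms with \<open>|j| < \<sigma>\<close> stay supported in
  \<open>ball_set (t + \<sigma>)\<close> and are cut off. The other \<open>T (nat |j|)\<close> are
  contractions, so only their coefficients count.\<close>

lemma norm_A_power_far:
  assumes f: "keys f \<subseteq> ball_set t"
  shows "norm (restr (- ball_set (t + \<sigma>)) ((A k ^^ n) f)) \<le> tail n \<sigma> * norm f"
proof -
  let ?c = "laurent_coeffs b k n" and ?X = "- ball_set (t + \<sigma>)"
  let ?J = "{j \<in> keys ?c. \<sigma> \<le> real_of_int \<bar>j\<bar>}"
  have zero: "restr ?X (T (nat \<bar>j\<bar>) f) = 0" if "\<not> \<sigma> \<le> real_of_int \<bar>j\<bar>" for j
  proof (rule poly_mapping_eqI)
    fix x
    have "ball_set (t + real (nat \<bar>j\<bar>)) \<subseteq> ball_set (t + \<sigma>)" by (rule ball_set_mono) (use that in simp)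
    then show "lookup (restr ?X (T (nat \<bar>j\<bar>) f)) x = lookup 0 x"
      using keys_T_ball[OF f, of "nat \<bar>j\<bar>"] by (auto simp: lookup_restr in_keys_iff)
  qed
  have "restr ?X ((A k ^^ n) f) = (\<Sum>j\<in>keys ?c. lookup ?c j *\<^sub>R restr ?X (T (nat \<bar>j\<bar>) f))"
    unfolding A_power_eq_lin_ext lin_ext_def
    by (simp add: linear_sum[OF linear_restr] linear_cmul[OF linear_restr])
  also have "\<dots> = (\<Sum>j\<in>?J. lookup ?c j *\<^sub>R restr ?X (T (nat \<bar>j\<bar>) f))"
    by (rule sum.mono_neutral_right) (use zero in auto)
  also have "norm \<dots> \<le> (\<Sum>j\<in>?J. \<bar>lookup ?c j\<bar> * norm f)"
  proof (rule sum_norm_le)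
    fix j
    show "norm (lookup ?c j *\<^sub>R restr ?X (T (nat \<bar>j\<bar>) f)) \<le> \<bar>lookup ?c j\<bar> * norm f"
      unfolding norm_scaleR real_norm_def
      by (intro mult_left_mono order_trans[OF norm_restr_le norm_T_le]) auto
  qed
  finally show ?thesis by (simp add: tail_def sum_distrib_right)
qed

section \<open>Mass of the kernel outside balls\<close>

definition far :: "nat \<Rightarrow> real \<Rightarrow> real" where
  "far n \<rho> = norm (restr (- ball_set \<rho>) (K n))"

lemma far_nonneg: "0 \<le> far n \<rho>"
  by (simp add: far_def)

lemma far_le_norm: "far n \<rho> \<le> norm (K n)"
  unfolding far_def by (rule norm_restr_le)

lemma far_0: "0 < \<rho> \<Longrightarrow> far 0 \<rho> = 0"
proof -
  assume "0 < \<rho>"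
  then have "restr (- ball_set \<rho>) (K 0) = 0"
    by (intro poly_mapping_eqI) (auto simp: lookup_restr K_def lookup_single when_def ball_set_def)
  then show ?thesis by (simp add: far_def)
qed

text \<open>\<open>K n\<close> is split at radius \<open>t\<close>. The inner part must travel the
  distance \<open>\<sigma>\<close> under \<open>A k ^^ m\<close>, at cost
  \<open>tail m \<sigma>\<close>; the outer part is controlled by contraction. The factor
  \<open>norm (K n)\<close> brings in the on-diagonal decay.\<close>

lemma far_add_le: "far (m + n) (t + \<sigma>) \<le> tail m \<sigma> * norm (K n) + far n t"
proof -
  let ?X = "- ball_set (t + \<sigma>)" and ?B = "ball_set t"
  have "restr ?X (K (m + n)) = restr ?X ((A k ^^ m) (restr ?B (K n))) + restr ?X ((A k ^^ m) (restr (- ?B) (K n)))"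
    unfolding K_add linear_add[OF linear_restr, symmetric] linear_add[OF linear_A_power, symmetric]
    by (simp only: restr_add_compl)
  then have "far (m + n) (t + \<sigma>) \<le> norm (restr ?X ((A k ^^ m) (restr ?B (K n))))
      + norm (restr ?X ((A k ^^ m) (restr (- ?B) (K n))))"
    by (simp add: far_def norm_triangle_ineq)
  moreover have "norm (restr ?X ((A k ^^ m) (restr ?B (K n)))) \<le> tail m \<sigma> * norm (restr ?B (K n))"
    by (rule norm_A_power_far) (auto simp: in_keys_iff lookup_restr split: if_splits)
  moreover have "tail m \<sigma> * norm (restr ?B (K n)) \<le> tail m \<sigma> * norm (K n)"
    by (intro mult_left_mono norm_restr_le) (auto simp: tail_def sum_nonneg)
  moreover have "norm (restr ?X ((A k ^^ m) (restr (- ?B) (K n)))) \<le> far n t"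
    unfolding far_def by (rule order_trans[OF norm_restr_le norm_A_power_le])
  ultimately show ?thesis by linarith
qed

text \<open>The tail estimate is bootstrapped along \<open>n \<mapsto> n div 2\<close>. The radius shrinks only by the factor
  \<open>\<kappa> = (3/4) powr (q/2)\<close>, more slowly than the length scale \<open>n powr q\<close>, so the exponent improves by
  \<open>\<tau> powr \<gamma> > 1\<close>, which beats the loss \<open>2 powr D\<close> in the prefactor beyond the radius \<open>y0\<close>.\<close>

lemma far_bound:
  fixes D C1 :: real
  assumes D: "0 \<le> D" and C1: "0 < C1" and diag: "\<And>n. norm (K n) \<le> C1 * real (Suc n) powr (- D)"
  defines "q \<equiv> 1 / (2 * real k)" and "\<gamma> \<equiv> 2 * real k / (2 * real k - 1)"
  obtains C c where "0 < C" "0 < c"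
    "\<And>n \<rho>. 0 \<le> \<rho> \<Longrightarrow>
      far n \<rho> \<le> C * real (Suc n) powr (- D) * exp (- c * (\<rho> / real (Suc n) powr q) powr \<gamma>)"
proof -
  obtain Ct ct where Ct: "0 < Ct" and ct: "0 < ct"
    and tail: "\<And>n \<rho>. real (Suc n) powr q \<le> \<rho> \<Longrightarrow> tail n \<rho> \<le> Ct * exp (- ct * (\<rho> / real (Suc n) powr q) powr \<gamma>)"
    by (rule laurent_tail_bound[OF b_pos b_power k, folded tail_def q_def \<gamma>_def]) (rule that)
  have q: "0 < q" using k by (simp add: q_def)
  have \<gamma>: "1 \<le> \<gamma>" using k by (simp add: \<gamma>_def field_simps)
  define \<kappa> where "\<kappa> = (3 / 4 :: real) powr (q / 2)"
  define \<tau> where "\<tau> = (4 / 3 :: real) powr (q / 2)"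
  have \<kappa>: "0 < \<kappa>" "\<kappa> < 1" using q powr_less_mono2[of "q / 2" "3 / 4" 1] by (simp_all add: \<kappa>_def)
  have \<tau>: "1 < \<tau>" using q by (simp add: \<tau>_def gr_one_powr)
  have \<kappa>\<tau>: "\<kappa> * (4 / 3) powr q = \<tau>"
  proof -
    have "(4 / 3 :: real) powr q = \<tau> * \<tau>" unfolding \<tau>_def by (subst powr_add[symmetric]) simp
    moreover have "\<kappa> * \<tau> = 1" unfolding \<kappa>_def \<tau>_def by (subst powr_mult[symmetric]) simp_all
    ultimately show ?thesis by simp
  qed
  have \<tau>\<gamma>: "1 < \<tau> powr \<gamma>" using \<tau> \<gamma> by (intro gr_one_powr) auto
  \<comment> \<open>\<open>tail\<close> is used at radius \<open>(1 - \<kappa>) \<rho>\<close>,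
    which turns its rate \<open>ct\<close> into \<open>c\<close>.\<close>
  define c where "c = ct * (1 - \<kappa>) powr \<gamma>"
  have c: "0 < c" using ct \<kappa> by (simp add: c_def)
  \<comment> \<open>The first bound puts \<open>(1 - \<kappa>) \<rho>\<close> above the length
    scale, where the estimate of \<open>tail\<close> holds; the second makes the improved exponent
    outweigh \<open>2 powr D\<close> with a factor 1/2 to spare.\<close>
  define y0 where "y0 = max (1 / (1 - \<kappa>)) (ln (2 * 2 powr D) / (c * (\<tau> powr \<gamma> - 1)))"
  have "1 \<le> 1 / (1 - \<kappa>)" using \<kappa> by (simp add: field_simps)
  then have y0: "1 \<le> y0" "1 / (1 - \<kappa>) \<le> y0" by (auto simp: y0_def)
  have y0': "ln (2 * 2 powr D) \<le> c * (\<tau> powr \<gamma> - 1) * y0"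
  proof -
    have "ln (2 * 2 powr D) / (c * (\<tau> powr \<gamma> - 1)) \<le> y0" by (simp add: y0_def)
    then show ?thesis using c \<tau>\<gamma> by (simp add: pos_divide_le_eq mult.commute)
  qed
  \<comment> \<open>The first entry covers \<open>y < y0\<close> by the on-diagonal bound alone; the
    second lets the inner part take at most half of the claim.\<close>
  define C where "C = max (C1 * exp (c * y0 powr \<gamma>)) (2 * Ct * C1 * 2 powr D)"
  have C: "0 < C" "C1 * exp (c * y0 powr \<gamma>) \<le> C" "Ct * C1 * 2 powr D \<le> C / 2"
    using Ct C1 by (auto simp: C_def less_max_iff_disj)
  have main: "far n \<rho> \<le> C * real (Suc n) powr (- D) * exp (- c * (\<rho> / real (Suc n) powr q) powr \<gamma>)"
    if "0 \<le> \<rho>" for n \<rho>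
    using that
  proof (induction n arbitrary: \<rho> rule: less_induct)
    case (less n)
    define N where "N = real (Suc n)"
    have N: "1 \<le> N" by (simp add: N_def)
    define y where "y = \<rho> / N powr q"
    have y: "0 \<le> y" using less.prems by (simp add: y_def)
    have \<rho>: "\<rho> = y * N powr q" using N by (simp add: y_def)
    consider "y < y0" | "y0 \<le> y" "n = 0" | "y0 \<le> y" "1 \<le> n" by linarith
    then have "far n \<rho> \<le> C * N powr (- D) * exp (- c * y powr \<gamma>)"
    proof cases
      case 1
      have "far n \<rho> \<le> C1 * N powr (- D)"
        unfolding N_def by (rule order_trans[OF far_le_norm diag])
      also have "\<dots> = C1 * exp (c * y powr \<gamma>) * N powr (- D) * exp (- c * y powr \<gamma>)"
        by (simp add: exp_minus)
      also have "\<dots> \<le> C * N powr (- D) * exp (- c * y powr \<gamma>)"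
      proof (intro mult_right_mono)
        have "C1 * exp (c * y powr \<gamma>) \<le> C1 * exp (c * y0 powr \<gamma>)"
          using 1 y c C1 \<gamma> by (intro mult_left_mono) (auto intro!: powr_mono2)
        then show "C1 * exp (c * y powr \<gamma>) \<le> C" using C(2) by linarith
      qed auto
      finally show ?thesis .
    next
      case 2
      have "0 < \<rho>" using 2 y0 N by (simp add: \<rho>)
      then show ?thesis using far_0 2 C by simp
    next
      case 3
      have y1: "1 \<le> y" using 3 y0 by linarith
      have \<rho>0: "0 < \<rho>" using y1 N by (simp add: \<rho>)
      define n' where "n' = n div 2"
      define m where "m = n - n'"
      have nm: "n = m + n'" "n' < n" using 3 by (auto simp: m_def n'_def)
      define N' where "N' = real (Suc n')"
      \<comment> \<open>Because of the shift by one, halving \<open>n\<close> shrinks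
        \<open>N\<close> only to \<open>3/4 N\<close> in this bound; this is the origin of the 3/4
        in \<open>\<kappa>\<close>.\<close>
      have N': "N' \<le> 3 / 4 * N" "N \<le> 2 * N'" "1 \<le> N'" using 3 by (auto simp: N'_def N_def n'_def)
      have M: "1 \<le> real (Suc m)" "real (Suc m) \<le> N" by (auto simp: N_def m_def)
      have N'D: "N' powr (- D) \<le> 2 powr D * N powr (- D)"
      proof -
        have "N powr D \<le> (2 * N') powr D" using N' N D by (intro powr_mono2) auto
        also have "\<dots> = 2 powr D * N' powr D" using N' by (simp add: powr_mult)
        finally show ?thesis using N N' by (simp add: powr_minus_divide field_simps)
      qed
      have tail_le: "tail m ((1 - \<kappa>) * \<rho>) \<le> Ct * exp (- c * y powr \<gamma>)"
      proof -
        have MN: "real (Suc m) powr q \<le> N powr q" using M q by (intro powr_mono2) auto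
        have "1 / (1 - \<kappa>) \<le> y" using 3 y0 by linarith
        then have "1 \<le> (1 - \<kappa>) * y" using \<kappa> by (subst (asm) pos_divide_le_eq) (auto simp: mult.commute)
        then have "N powr q \<le> (1 - \<kappa>) * y * N powr q" using N by (simp add: mult_le_cancel_right1)
        then have "real (Suc m) powr q \<le> (1 - \<kappa>) * \<rho>" using MN by (simp add: \<rho> mult.assoc)
        then have "tail m ((1 - \<kappa>) * \<rho>) \<le> Ct * exp (- ct * ((1 - \<kappa>) * \<rho> / real (Suc m) powr q) powr \<gamma>)"
          by (rule tail)
        also have "\<dots> \<le> Ct * exp (- c * y powr \<gamma>)"
        proof -
          have "(1 - \<kappa>) * y \<le> (1 - \<kappa>) * \<rho> / real (Suc m) powr q"
          proof -
            have "(1 - \<kappa>) * y = (1 - \<kappa>) * \<rho> / N powr q" by (simp add: y_def)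
            also have "\<dots> \<le> (1 - \<kappa>) * \<rho> / real (Suc m) powr q"
              using MN \<kappa> \<rho>0 N by (intro divide_left_mono mult_pos_pos) auto
            finally show ?thesis .
          qed
          then have "((1 - \<kappa>) * y) powr \<gamma> \<le> ((1 - \<kappa>) * \<rho> / real (Suc m) powr q) powr \<gamma>"
            using \<kappa> y \<gamma> by (intro powr_mono2) auto
          then have "(1 - \<kappa>) powr \<gamma> * y powr \<gamma> \<le> ((1 - \<kappa>) * \<rho> / real (Suc m) powr q) powr \<gamma>"
            using \<kappa> y by (simp add: powr_mult)
          then have "ct * ((1 - \<kappa>) powr \<gamma> * y powr \<gamma>) \<le> ct * ((1 - \<kappa>) * \<rho> / real (Suc m) powr q) powr \<gamma>"
            using ct by (intro mult_left_mono) auto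
          then show ?thesis using Ct by (simp add: c_def mult.assoc)
        qed
        finally show ?thesis .
      qed
      have near: "tail m ((1 - \<kappa>) * \<rho>) * norm (K n') \<le> C / 2 * N powr (- D) * exp (- c * y powr \<gamma>)"
      proof -
        have "norm (K n') \<le> C1 * (2 powr D * N powr (- D))"
          using diag[of n'] N'D C1 unfolding N'_def by (meson less_imp_le mult_left_mono order_trans)
        then have "tail m ((1 - \<kappa>) * \<rho>) * norm (K n')
            \<le> (Ct * exp (- c * y powr \<gamma>)) * (C1 * (2 powr D * N powr (- D)))"
          using tail_le Ct by (intro mult_mono) auto
        also have "\<dots> = (Ct * C1 * 2 powr D) * (N powr (- D) * exp (- c * y powr \<gamma>))"
          by (simp only: mult_ac)
        also have "\<dots> \<le> C / 2 * (N powr (- D) * exp (- c * y powr \<gamma>))"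
          by (intro mult_right_mono C) auto
        finally show ?thesis by (simp only: mult.assoc)
      qed
      have rest: "far n' (\<kappa> * \<rho>) \<le> C / 2 * N powr (- D) * exp (- c * y powr \<gamma>)"
      proof -
        have "far n' (\<kappa> * \<rho>) \<le> C * N' powr (- D) * exp (- c * (\<kappa> * \<rho> / N' powr q) powr \<gamma>)"
          unfolding N'_def using nm less.prems \<kappa> by (intro less.IH) auto
        also have "\<dots> \<le> C * (2 powr D * N powr (- D)) * exp (- c * (\<tau> powr \<gamma> * y powr \<gamma>))"
        proof (intro mult_mono)
          have "N' powr q \<le> (3 / 4 * N) powr q" using N' q by (intro powr_mono2) auto
          also have "\<dots> = (3 / 4) powr q * N powr q" by (rule powr_mult)
          finally have N'q: "N' powr q \<le> (3 / 4) powr q * N powr q" .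
          have "\<tau> * y = \<kappa> * \<rho> / ((3 / 4) powr q * N powr q)"
            unfolding \<kappa>\<tau>[symmetric] y_def by (simp add: powr_divide)
          also have "\<dots> \<le> \<kappa> * \<rho> / N' powr q"
            using N'q \<kappa> \<rho>0 N N' by (intro divide_left_mono mult_pos_pos) auto
          finally have "(\<tau> * y) powr \<gamma> \<le> (\<kappa> * \<rho> / N' powr q) powr \<gamma>"
            using \<tau> y \<gamma> by (intro powr_mono2) auto
          then have "\<tau> powr \<gamma> * y powr \<gamma> \<le> (\<kappa> * \<rho> / N' powr q) powr \<gamma>"
            using \<tau> y by (simp add: powr_mult)
          then show "exp (- c * (\<kappa> * \<rho> / N' powr q) powr \<gamma>) \<le> exp (- c * (\<tau> powr \<gamma> * y powr \<gamma>))"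
            using c by simp
        qed (use C N'D in auto)
        also have "\<dots> = C * N powr (- D) * exp (- c * y powr \<gamma>) * (2 powr D * exp (- (c * (\<tau> powr \<gamma> - 1) * y powr \<gamma>)))"
        proof -
          have "exp (- c * (\<tau> powr \<gamma> * y powr \<gamma>)) = exp (- c * y powr \<gamma>) * exp (- (c * (\<tau> powr \<gamma> - 1) * y powr \<gamma>))"
            unfolding exp_add[symmetric] by (simp add: algebra_simps)
          then show ?thesis by simp
        qed
        also have "\<dots> \<le> C * N powr (- D) * exp (- c * y powr \<gamma>) * (1 / 2)"
        proof (rule mult_left_mono)
          have "y0 \<le> y powr \<gamma>" using 3 y1 \<gamma> powr_mono[of 1 \<gamma> y] by simp
          then have "c * (\<tau> powr \<gamma> - 1) * y0 \<le> c * (\<tau> powr \<gamma> - 1) * y powr \<gamma>"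
            using c \<tau>\<gamma> by (intro mult_left_mono) auto
          then have "exp (- (c * (\<tau> powr \<gamma> - 1) * y powr \<gamma>)) \<le> exp (- ln (2 * 2 powr D))"
            using y0' by simp
          also have "\<dots> = 1 / (2 * 2 powr D)" by (simp add: exp_minus inverse_eq_divide)
          finally show "2 powr D * exp (- (c * (\<tau> powr \<gamma> - 1) * y powr \<gamma>)) \<le> 1 / 2"
            by (simp add: field_simps)
        qed (use C in auto)
        finally show ?thesis by simp
      qed
      have "far n \<rho> = far (m + n') (\<kappa> * \<rho> + (1 - \<kappa>) * \<rho>)" using nm by (simp add: algebra_simps)
      also have "\<dots> \<le> tail m ((1 - \<kappa>) * \<rho>) * norm (K n') + far n' (\<kappa> * \<rho>)" by (rule far_add_le)
      finally show ?thesis using near rest by simp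
    qed
    then show ?case by (simp only: N_def y_def)
  qed
  show ?thesis by (rule that[OF C(1) c main])
qed

text \<open>The value is the inner product of \<open>K n\<close> with \<open>M\<close>, a copy of
  \<open>K m\<close> centred at \<open>g\<close>. No point is closer than \<open>|g| / 2\<close> to
  both centres, so at each point one of the two kernels is in its far region.\<close>

lemma abs_lookup_K_add_le:
  assumes g: "g \<in> carrier G"
  shows "\<bar>lookup (K (m + n)) g\<bar>
    \<le> far n (real (len g) / 2) * norm (K m) + norm (K n) * far m (real (len g) / 2)"
proof -
  define B where "B = ball_set (real (len g) / 2)"
  define M where "M = rt (inv g) (K m)"
  have M: "M = (A k ^^ m) (single g 1)"
    using g by (simp add: M_def K_def A_power_rt[symmetric] rt_single)
  have "lookup (K (m + n)) g = inner (K n) M"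
    by (simp add: K_add M sym_A_power[symmetric])
  also have "\<dots> = inner (restr (- B) (K n)) M + inner (restr B (K n)) M"
    unfolding inner_add_left[symmetric] by (simp only: add.commute restr_add_compl)
  also have "inner (restr B (K n)) M = inner (K n) (restr B M)"
    by (subst (1 2) inner_poly_mapping_superset[of "keys (K n)"])
      (auto simp: lookup_restr in_keys_iff split: if_splits intro!: sum.cong)
  finally have "\<bar>lookup (K (m + n)) g\<bar> \<le> norm (restr (- B) (K n)) * norm M + norm (K n) * norm (restr B M)"
    using Cauchy_Schwarz_ineq2[of "restr (- B) (K n)" M] Cauchy_Schwarz_ineq2[of "K n" "restr B M"] by linarith
  moreover have "norm M = norm (K m)" using g by (simp add: M_def norm_rt)
  moreover have "norm (restr B M) \<le> far m (real (len g) / 2)"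
  proof -
    have "restr B M = restr B (rt (inv g) (restr (- B) (K m)))"
    proof (rule poly_mapping_eqI)
      fix x
      show "lookup (restr B M) x = lookup (restr B (rt (inv g) (restr (- B) (K m)))) x"
      proof (cases "x \<in> B")
        case False
        then show ?thesis by (simp add: lookup_restr)
      next
        case True
        then have x: "x \<in> carrier G" "real (len x) < real (len g) / 2" by (auto simp: B_def ball_set_def)
        \<comment> \<open>\<open>g = inv (x \<otimes> inv g) \<otimes> x\<close> in lengths: if
          \<open>x\<close> is short, then \<open>x \<otimes> inv g\<close> is long.\<close>
        have "len g = len (inv x \<otimes> (x \<otimes> inv g))"
          using x g by (simp add: m_assoc[symmetric] len_inv)
        also have "\<dots> \<le> len x + len (x \<otimes> inv g)"
          using len_mult[of "inv x" "x \<otimes> inv g"] x g by (simp add: len_inv)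
        finally have "x \<otimes> inv g \<notin> B" using x by (simp add: B_def ball_set_def)
        then show ?thesis using x g True by (simp add: lookup_restr M_def lookup_rt rmul_def)
      qed
    qed
    then have "norm (restr B M) \<le> norm (rt (inv g) (restr (- B) (K m)))" by (simp only: norm_restr_le)
    then show ?thesis using g by (simp add: norm_rt far_def B_def)
  qed
  ultimately show ?thesis
    unfolding far_def B_def by (smt (verit) mult_left_mono norm_ge_zero)
qed

end

section \<open>Convolution powers\<close>

context symmetric_walk
begin

text \<open>Substituting \<open>x = g y^(-1)\<close> and using that the kernel is even, the
  convolution becomes \<open><H, B \<delta>_g>\<close> with \<open>\<delta>_g\<close> the point mass
  at \<open>g\<close>, and self-adjointness moves \<open>B\<close> to \<open>H\<close>.\<close>

lemma conv_operator:
  assumes sym: "\<And>f h. inner (B f) h = inner f (B h)"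
    and comm: "\<And>y f. y \<in> carrier G \<Longrightarrow> B (rt y f) = rt y (B f)"
    and f: "\<And>x. x \<in> carrier G \<Longrightarrow> f x = lookup (B (single \<one> 1)) x"
    and h: "\<And>x. x \<in> carrier G \<Longrightarrow> h x = lookup H x"
    and H: "keys H \<subseteq> carrier G" and g: "g \<in> carrier G"
  shows "conv G f h g = lookup (B H) g"
proof -
  have inv_mult: "inv (g \<otimes> inv y) = y \<otimes> inv g" "inv (g \<otimes> inv y) \<otimes> g = y" if "y \<in> carrier G" for y
    using that g by (simp_all add: inv_mult_group m_assoc)
  have "conv G f h g = (\<Sum>x\<in>(\<lambda>y. g \<otimes> inv y) ` keys H. f x * h (inv x \<otimes> g))"
    unfolding conv_def
  proof (rule infsum_eq_sum)
    fix x assume x: "x \<in> carrier G - (\<lambda>y. g \<otimes> inv y) ` keys H"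
    then have "x = g \<otimes> inv (inv x \<otimes> g)"
      using g by (simp add: inv_mult_group m_assoc[symmetric])
    then have "inv x \<otimes> g \<notin> keys H" using x by blast
    then show "f x * h (inv x \<otimes> g) = 0" using x g by (simp add: h in_keys_iff)
  qed (use H g in auto)
  also have "\<dots> = (\<Sum>y\<in>keys H. f (g \<otimes> inv y) * h (inv (g \<otimes> inv y) \<otimes> g))"
  proof (subst sum.reindex)
    show "inj_on (\<lambda>y. g \<otimes> inv y) (keys H)"
      by (rule inj_on_inverseI[of _ "\<lambda>x. inv x \<otimes> g"]) (use H inv_mult in auto)
  qed simp
  also have "\<dots> = (\<Sum>y\<in>keys H. lookup H y * lookup (rt (inv g) (B (single \<one> 1))) y)"
  proof (rule sum.cong[OF refl])
    fix y assume "y \<in> keys H"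
    then have y: "y \<in> carrier G" using H by blast
    have "f (g \<otimes> inv y) = lookup (B (single \<one> 1)) (inv (g \<otimes> inv y))"
      using y g by (simp only: f m_closed inv_closed lookup_operator_inv[OF sym comm])
    also have "\<dots> = lookup (rt (inv g) (B (single \<one> 1))) y"
      using y g by (simp add: inv_mult lookup_rt rmul_def)
    finally have "f (g \<otimes> inv y) = lookup (rt (inv g) (B (single \<one> 1))) y" .
    then show "f (g \<otimes> inv y) * h (inv (g \<otimes> inv y) \<otimes> g) = lookup H y * lookup (rt (inv g) (B (single \<one> 1))) y"
      by (simp only: inv_mult(2)[OF y] h[OF y] mult.commute)
  qed
  also have "\<dots> = inner H (rt (inv g) (B (single \<one> 1)))" by (simp add: inner_poly_mapping_def)
  also have "\<dots> = inner H (B (single g 1))" using g by (simp add: comm[symmetric] rt_single)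
  also have "\<dots> = lookup (B H) g" by (simp add: sym[symmetric])
  finally show ?thesis .
qed

text \<open>Applied twice: with \<open>Lap\<close> for the inner power that defines
  \<open>mu_k\<close>, and with \<open>A k\<close> for the powers of \<open>mu_k\<close>.\<close>

lemma conv_pow_operator:
  assumes sym: "\<And>f h. inner (B f) h = inner f (B h)"
    and comm: "\<And>y f. y \<in> carrier G \<Longrightarrow> B (rt y f) = rt y (B f)"
    and keys: "\<And>f. keys f \<subseteq> carrier G \<Longrightarrow> keys (B f) \<subseteq> carrier G"
    and f: "\<And>x. x \<in> carrier G \<Longrightarrow> f x = lookup (B (single \<one> 1)) x"
    and g: "g \<in> carrier G"
  shows "conv_pow G f n g = lookup ((B ^^ n) (single \<one> 1)) g"
  using g
proof (induction n arbitrary: g)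
  case 0
  then show ?case by (simp add: point_mass_def lookup_single when_def indicator_def)
next
  case (Suc n)
  have "keys ((B ^^ n) (single \<one> 1)) \<subseteq> carrier G"
    by (induction n) (auto intro!: keys simp del: in_keys_iff)
  then have "conv G f (conv_pow G f n) g = lookup (B ((B ^^ n) (single \<one> 1))) g"
    using Suc by (intro conv_operator[OF sym comm f]) auto
  then show ?case by simp
qed

lemma keys_Lap: "keys f \<subseteq> carrier G \<Longrightarrow> keys (Lap f) \<subseteq> carrier G"
  unfolding Lap_def using keys_diff_subset[of f "P f"] P_keys[of f] by blast

lemma lookup_Lap_single_one:
  assumes x: "x \<in> carrier G"
  shows "lookup (Lap (single \<one> 1)) x = point_mass G x - pmf \<mu> x"
proof -
  have "lookup (P (single \<one> 1)) x = (\<Sum>s\<in>set_pmf \<mu>. if s = inv x then pmf \<mu> s else 0)"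
    unfolding lookup_P
  proof (rule sum.cong[OF refl])
    fix s assume "s \<in> set_pmf \<mu>"
    then have s: "s \<in> carrier G" by (rule support_closed)
    then have "s \<otimes> x = \<one> \<longleftrightarrow> s = inv x" using x inv_equality[of s x] by (auto simp: inv_equality)
    then show "pmf \<mu> s * lookup (single \<one> 1) (lmul s x) = (if s = inv x then pmf \<mu> s else 0)"
      using x by (auto simp: lmul_def lookup_single when_def)
  qed
  also have "\<dots> = pmf \<mu> (inv x)" using finite_support by (simp add: set_pmf_iff)
  also have "\<dots> = pmf \<mu> x" using mu_sym[OF x] by simp
  finally show ?thesis
    by (simp add: Lap_def lookup_minus point_mass_def lookup_single when_def indicator_def)
qed

text \<open>Asymptotics along large integers are extended to all real \<open>t \<ge> 1\<close>.
  Positivity of \<open>d\<close> comes from infinitude: for \<open>d \<le> 0\<close> balls would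
  have at most \<open>c2\<close> elements, while some ball contains a set with more.\<close>

lemma volume_bounds:
  fixes d :: real
  assumes inf: "infinite (carrier G)"
    and theta: "(\<lambda>n::nat. real (ball_card G \<mu> (real n))) \<in> \<Theta>(\<lambda>n. real n powr d)"
  obtains c C where "0 < d" "0 < c" "0 < C"
    "\<And>t. 1 \<le> t \<Longrightarrow> c * t powr d \<le> real (ball_card G \<mu> t)"
    "\<And>t. 1 \<le> t \<Longrightarrow> real (ball_card G \<mu> t) \<le> C * t powr d"
proof -
  let ?V = "\<lambda>t. real (ball_card G \<mu> t)"
  obtain c2 where c2: "0 < c2" "\<forall>\<^sub>F n in sequentially. norm (?V (real n)) \<le> c2 * norm (real n powr d)"
    using bigthetaD1[OF theta] by (elim landau_o.bigE)
  obtain c1 where c1: "0 < c1" "\<forall>\<^sub>F n in sequentially. c1 * norm (real n powr d) \<le> norm (?V (real n))"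
    using bigthetaD2[OF theta] by (elim landau_omega.bigE)
  obtain n0 where n0: "\<And>n. n0 \<le> n \<Longrightarrow> ?V (real n) \<le> c2 * real n powr d \<and> c1 * real n powr d \<le> ?V (real n)"
    using eventually_conj[OF c2(2) c1(2)] by (auto simp: eventually_sequentially)
  \<comment> \<open>For \<open>t \<ge> p\<close> the integer part of \<open>t\<close> is at least
    \<open>n0\<close> and at least \<open>t / 2\<close>.\<close>
  define p where "p = real n0 + 2"
  have p: "2 \<le> p" by (simp add: p_def)
  have d: "0 < d"
  proof (rule ccontr)
    assume nd: "\<not> 0 < d"
    obtain S where S: "S \<subseteq> carrier G" "finite S" "card S = nat \<lceil>c2\<rceil> + 1"
      using infinite_arbitrarily_large[OF inf] by metis
    define n where "n = n0 + 1 + (\<Sum>x\<in>S. len x)"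
    have "1 \<le> n" by (simp add: n_def)
    then have n1: "1 \<le> real n" by simp
    have "len x < n" if "x \<in> S" for x
      using member_le_sum[of x S len] that S by (simp add: n_def)
    then have "S \<subseteq> ball_set (real n)" using S by (auto simp: ball_set_def)
    then have "card S \<le> ball_card G \<mu> (real n)"
      unfolding ball_card_eq by (rule card_mono[OF finite_ball_set])
    then have "real (card S) \<le> c2 * real n powr d" using n0[of n] by (simp add: n_def)
    also have "\<dots> \<le> c2 * 1"
    proof (rule mult_left_mono)
      have "real n powr d \<le> real n powr 0" using nd n1 by (intro powr_mono) auto
      then show "real n powr d \<le> 1" using n1 by simp
    qed (use c2 in simp)
    finally show False using S(3) by linarith
  qed
  \<comment> \<open>The first entry serves \<open>t \<ge> p\<close>, the second
    \<open>t < p\<close>, where the ball has at least one element.\<close>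
  define c where "c = min (c1 / 2 powr d) (1 / p powr d)"
  have c: "0 < c" using c1 p by (simp add: c_def)
  have lower: "c * t powr d \<le> ?V t" if t: "1 \<le> t" for t
  proof (cases "p \<le> t")
    case True
    define n where "n = nat \<lfloor>t\<rfloor>"
    have n: "n0 \<le> n" "real n \<le> t" "t / 2 \<le> real n"
      using True unfolding n_def p_def by linarith+
    have "c * t powr d \<le> c1 / 2 powr d * t powr d" by (intro mult_right_mono) (auto simp: c_def)
    also have "\<dots> = c1 * (t / 2) powr d" using t by (simp add: powr_divide)
    also have "\<dots> \<le> c1 * real n powr d" using c1 d t n by (intro mult_left_mono powr_mono2) auto
    also have "\<dots> \<le> ?V (real n)" using n0[OF n(1)] by simp
    also have "\<dots> \<le> ?V t" using ball_card_mono[OF n(2)] by simp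
    finally show ?thesis .
  next
    case False
    have "c * t powr d \<le> 1 / p powr d * p powr d"
      using False t d p by (intro mult_mono powr_mono2) (auto simp: c_def)
    also have "\<dots> = 1" using p by simp
    also have "1 \<le> ?V t" using ball_card_pos[of t] t by linarith
    finally show ?thesis .
  qed
  have upper: "?V t \<le> c2 * p powr d * t powr d" if t: "1 \<le> t" for t
  proof -
    define n where "n = nat \<lceil>t\<rceil> + n0"
    have "real n \<le> t + 1 + real n0" using t unfolding n_def by linarith
    also have "\<dots> \<le> p * t" using mult_left_mono[OF t, of "1 + real n0"] by (simp add: p_def algebra_simps)
    finally have n: "real n \<le> p * t" .
    have "t \<le> real n" unfolding n_def by linarith
    then have "?V t \<le> ?V (real n)" by (simp add: ball_card_mono)
    also have "\<dots> \<le> c2 * real n powr d" using n0[of n] by (simp add: n_def)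
    also have "\<dots> \<le> c2 * (p * t) powr d" using n c2 d by (intro mult_left_mono powr_mono2) auto
    finally show ?thesis using t p by (simp add: powr_mult)
  qed
  show ?thesis by (rule that[OF d c _ lower upper]) (use c2 p in auto)
qed

end

context higher_order_walk
begin

lemma conv_pow_mu_k:
  assumes g: "g \<in> carrier G"
  shows "conv_pow G (mu_k G \<mu> k) n g = lookup (K n) g"
proof -
  have keys_L: "keys ((Lap ^^ j) f) \<subseteq> carrier G" if "keys f \<subseteq> carrier G" for j f
    using that by (induction j) (simp_all add: keys_Lap)
  have mu_k: "mu_k G \<mu> k x = lookup (A k (single \<one> 1)) x" if x: "x \<in> carrier G" for x
    using conv_pow_operator[OF inner_Lap_sym Lap_rt keys_Lap lookup_Lap_single_one[symmetric] x, of k] x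
    by (simp add: mu_k_def A_def lookup_minus point_mass_def lookup_single when_def indicator_def)
  have keys_A: "keys (A k f) \<subseteq> carrier G" if "keys f \<subseteq> carrier G" for f
    unfolding A_def using keys_diff_subset[of f "(Lap ^^ k) f"] keys_L[OF that, of k] that by blast
  have A_rt: "A k (rt y f) = rt y (A k f)" if "y \<in> carrier G" for y f
    using A_power_rt[OF that, of 1 f] by simp
  show ?thesis
    unfolding K_def by (rule conv_pow_operator[OF sym_A A_rt keys_A mu_k g])
qed

text \<open>Splitting \<open>n\<close> into halves, each half contributes \<open>n^(-D)\<close>; the
  product \<open>n^(-2D) = n^(-d/(2k))\<close> is comparable to the inverse volume at radius
  \<open>n^(1/(2k))\<close>.\<close>

lemma off_diagonal_bound:
  fixes d c C :: real
  defines "q \<equiv> 1 / (2 * real k)" and "\<gamma> \<equiv> 2 * real k / (2 * real k - 1)"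
  assumes d: "0 < d" and c: "0 < c" and C: "0 < C"
    and lower: "\<And>t. 1 \<le> t \<Longrightarrow> c * t powr d \<le> real (ball_card G \<mu> t)"
    and upper: "\<And>t. 1 \<le> t \<Longrightarrow> real (ball_card G \<mu> t) \<le> C * t powr d"
  obtains C6 c6 where "0 < C6" "0 < c6"
    "\<And>n g. 1 \<le> n \<Longrightarrow> g \<in> carrier G \<Longrightarrow> \<bar>lookup (K n) g\<bar>
      \<le> C6 / real (ball_card G \<mu> (real n powr q)) * exp (- c6 * (real (len g) / real n powr q) powr \<gamma>)"
proof -
  define D where "D = d / (4 * real k)"
  have D: "0 < D" using d k by (simp add: D_def)
  have qD: "q * d = 2 * D" by (simp add: q_def D_def)
  have q: "0 < q" "q \<le> 1" using k by (simp_all add: q_def)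
  have \<gamma>: "1 \<le> \<gamma>" using k by (simp add: \<gamma>_def field_simps)
  obtain C1 where C1: "0 < C1" and diag: "\<And>n. norm (K n) \<le> C1 * real (Suc n) powr (- D)"
    using norm_K_on_diagonal[OF d c lower] unfolding D_def by (metis minus_divide_left)
  obtain C2 c2 where C2: "0 < C2" and c2: "0 < c2" and far: "\<And>n \<rho>. 0 \<le> \<rho> \<Longrightarrow>
      far n \<rho> \<le> C2 * real (Suc n) powr (- D) * exp (- c2 * (\<rho> / real (Suc n) powr q) powr \<gamma>)"
    by (rule far_bound[OF less_imp_le[OF D] C1 diag, folded q_def \<gamma>_def]) (rule that)
  \<comment> \<open>One factor 1/2 comes from the radius \<open>len g / 2\<close>, the other from
    \<open>(2 n)^q \<le> 2 n^q\<close>, which bounds the length scale of either half.\<close>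
  define c6 where "c6 = c2 * (1 / 4) powr \<gamma>"
  define C6 where "C6 = 2 * C2 * C1 * (2 powr D)\<^sup>2 * C"
  have main: "\<bar>lookup (K n) g\<bar>
      \<le> C6 / real (ball_card G \<mu> (real n powr q)) * exp (- c6 * (real (len g) / real n powr q) powr \<gamma>)"
    if n: "1 \<le> n" and g: "g \<in> carrier G" for n g
  proof -
    define N where "N = real (Suc n)"
    have N: "1 \<le> N" "real n \<le> N" "N \<le> 2 * real n" using n by (simp_all add: N_def)
    define \<rho> where "\<rho> = real (len g) / 2"
    have \<rho>: "0 \<le> \<rho>" by (simp add: \<rho>_def)
    define E where "E = exp (- c6 * (real (len g) / real n powr q) powr \<gamma>)"
    define m where "m = n div 2"
    define X where "X = 2 powr D * N powr (- D)"
    have X: "0 \<le> X" by (simp add: X_def)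
    have pre: "real (Suc l) powr (- D) \<le> X" if "N \<le> 2 * real (Suc l)" for l
    proof -
      have "N powr D \<le> (2 * real (Suc l)) powr D" using that N D by (intro powr_mono2) auto
      also have "\<dots> = 2 powr D * real (Suc l) powr D" by (rule powr_mult)
      finally show ?thesis using N by (simp add: X_def powr_minus_divide field_simps)
    qed
    have norm_le: "norm (K l) \<le> C1 * X" if "N \<le> 2 * real (Suc l)" for l
      using diag[of l] mult_left_mono[OF pre[OF that], of C1] C1 by linarith
    have far_le: "far l \<rho> \<le> C2 * X * E" if l: "N \<le> 2 * real (Suc l)" "real (Suc l) \<le> N" for l
    proof -
      have "far l \<rho> \<le> C2 * real (Suc l) powr (- D) * exp (- c2 * (\<rho> / real (Suc l) powr q) powr \<gamma>)"
        by (rule far[OF \<rho>])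
      also have "\<dots> \<le> C2 * X * E"
      proof (intro mult_mono mult_left_mono pre l)
        have "real (Suc l) powr q \<le> (2 * real n) powr q" using l N q by (intro powr_mono2) auto
        also have "\<dots> = 2 powr q * real n powr q" by (rule powr_mult)
        also have "\<dots> \<le> 2 * real n powr q" using q powr_mono[of q 1 2] by (intro mult_right_mono) auto
        finally have "\<rho> / (2 * real n powr q) \<le> \<rho> / real (Suc l) powr q"
          using \<rho> n by (intro divide_left_mono mult_pos_pos) auto
        then have "1 / 4 * (real (len g) / real n powr q) \<le> \<rho> / real (Suc l) powr q"
          by (simp add: \<rho>_def)
        then have "(1 / 4 * (real (len g) / real n powr q)) powr \<gamma> \<le> (\<rho> / real (Suc l) powr q) powr \<gamma>"
          using \<gamma> by (intro powr_mono2) auto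
        then have "(1 / 4) powr \<gamma> * (real (len g) / real n powr q) powr \<gamma> \<le> (\<rho> / real (Suc l) powr q) powr \<gamma>"
          by (simp only: powr_mult)
        then have "c2 * ((1 / 4) powr \<gamma> * (real (len g) / real n powr q) powr \<gamma>) \<le> c2 * (\<rho> / real (Suc l) powr q) powr \<gamma>"
          using c2 by (intro mult_left_mono) auto
        then show "exp (- c2 * (\<rho> / real (Suc l) powr q) powr \<gamma>) \<le> E"
          by (simp add: E_def c6_def mult.assoc)
      qed (use C2 X in auto)
      finally show ?thesis .
    qed
    have l: "N \<le> 2 * real (Suc m)" "real (Suc m) \<le> N" "N \<le> 2 * real (Suc (n - m))" "real (Suc (n - m)) \<le> N"
    proof -
      have "n + 1 \<le> 2 * (m + 1)" "m \<le> n" "2 * m \<le> n" by (auto simp: m_def)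
      then show "N \<le> 2 * real (Suc m)" "real (Suc m) \<le> N" "N \<le> 2 * real (Suc (n - m))" "real (Suc (n - m)) \<le> N"
        by (auto simp: N_def of_nat_diff)
    qed
    have "\<bar>lookup (K n) g\<bar> \<le> far (n - m) \<rho> * norm (K m) + norm (K (n - m)) * far m \<rho>"
      using abs_lookup_K_add_le[OF g, of m "n - m"] by (simp add: m_def \<rho>_def)
    also have "\<dots> \<le> (C2 * X * E) * (C1 * X) + (C1 * X) * (C2 * X * E)"
      using C1 C2 X by (intro add_mono mult_mono norm_le far_le l) (auto simp: E_def far_nonneg)
    also have "\<dots> = 2 * C2 * C1 * (2 powr D)\<^sup>2 * (N powr (- D))\<^sup>2 * E"
      by (simp add: X_def power2_eq_square mult_ac)
    also have "\<dots> \<le> 2 * C2 * C1 * (2 powr D)\<^sup>2 * (C / real (ball_card G \<mu> (real n powr q))) * E"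
    proof (intro mult_right_mono mult_left_mono)
      have nq: "1 \<le> real n powr q" using n q by (simp add: ge_one_powr_ge_zero)
      have "(N powr (- D))\<^sup>2 = N powr (- (2 * D))"
        by (simp add: power2_eq_square flip: powr_add)
      also have "\<dots> \<le> real n powr (- (2 * D))" using N n D by (intro powr_mono2') auto
      also have "\<dots> = 1 / (real n powr q) powr d" by (simp add: powr_minus_divide powr_powr qD)
      also have "\<dots> \<le> C / real (ball_card G \<mu> (real n powr q))"
        using upper[OF nq] ball_card_pos[of "real n powr q"] nq n by (simp add: field_simps)
      finally show "(N powr (- D))\<^sup>2 \<le> C / real (ball_card G \<mu> (real n powr q))" .
    qed (use C1 C2 in \<open>auto simp: E_def\<close>)
    finally show ?thesis by (simp add: C6_def E_def)
  qed
  show ?thesis by (rule that[OF _ _ main]) (use C C1 C2 c2 in \<open>auto simp: C6_def c6_def\<close>)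
qed

end

theorem theorem5p1:
  fixes G :: "('a, 'b) monoid_scheme" and S :: "'a set" and \<mu> :: "'a pmf"
    and k :: nat and a d :: real
  assumes "group G" and "infinite (carrier G)"
    and "finite S" and "S \<subseteq> carrier G" and "generate G S = carrier G"
    and "\<And>g. g \<in> carrier G \<Longrightarrow> pmf \<mu> g = pmf \<mu> (inv\<^bsub>G\<^esub> g)"
    and "set_pmf \<mu> \<subseteq> S" and "generate G (set_pmf \<mu>) = carrier G"
    and "k \<ge> 1"
    and "{a<..1} \<subseteq> {-1..1}"
    and "ell2_spectrum G (markov_op G \<mu>) \<subseteq> complex_of_real ` {a<..1}"
    and "(1 - a) / 2 < 2 powr (-1 + 1 / real k)"
    and "(\<lambda>n::nat. real (ball_card G \<mu> (real n))) \<in> \<Theta>(\<lambda>n. real n powr d)"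
  shows "\<exists>C6>0. \<exists>c6>0. \<forall>n\<ge>1. \<forall>g\<in>carrier G.
    \<bar>conv_pow G (mu_k G \<mu> k) n g\<bar>
      \<le> C6 / real (ball_card G \<mu> (real n powr (1 / (2 * real k))))
        * exp (- c6 * (real (word_length G \<mu> g) / real n powr (1 / (2 * real k)))
                        powr (2 * real k / (2 * real k - 1)))"
proof -
  interpret symmetric_walk G \<mu>
  proof (rule symmetric_walk.intro[OF assms(1)], rule symmetric_walk_axioms.intro)
    show "finite (set_pmf \<mu>)" using assms(3,7) by (rule rev_finite_subset)
    show "set_pmf \<mu> \<subseteq> carrier G" using assms(7,4) by (rule subset_trans)
  qed (fact assms(6,8))+
  obtain m where m: "a < m" "m \<le> 1" "\<And>f. m * inner f f \<le> inner (P f) f"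
    using spectrum_lower_bound[OF assms(11)] by metis
  \<comment> \<open>The maximum with 1 keeps \<open>b\<close> positive; in the case
    \<open>b = 1\<close> the bound \<open>b^k < 2\<close> is immediate.\<close>
  define b where "b = max 1 (1 - m)"
  have "b ^ k < 2"
  proof (cases "1 - m \<le> 1")
    case True
    then show ?thesis by (simp add: b_def)
  next
    case False
    have "1 - a < 2 powr (1 / real k)"
    proof -
      have "(2::real) powr (-1 + 1 / real k) = 2 powr (1 / real k) / 2"
        unfolding powr_add by (simp add: powr_minus)
      then show ?thesis using assms(12) by simp
    qed
    then have "1 - m < 2 powr (1 / real k)" using m by linarith
    then have "(1 - m) ^ k < (2 powr (1 / real k)) ^ k"
      using False assms(9) by (intro power_strict_mono) auto
    also have "\<dots> = 2" using assms(9) by (simp add: powr_power)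
    finally show ?thesis using False by (simp add: b_def)
  qed
  moreover have "positive_operator Lap b"
    by (rule Lap_positive_operator[OF m(3)]) (auto simp: b_def)
  ultimately interpret higher_order_walk G \<mu> b k
    using assms(9) symmetric_walk_axioms
    by (intro higher_order_walk.intro higher_order_walk_axioms.intro)
  obtain c C where "0 < d" "0 < c" "0 < C"
    "\<And>t. 1 \<le> t \<Longrightarrow> c * t powr d \<le> real (ball_card G \<mu> t)"
    "\<And>t. 1 \<le> t \<Longrightarrow> real (ball_card G \<mu> t) \<le> C * t powr d"
    by (rule volume_bounds[OF assms(2,13)]) (rule that)
  from off_diagonal_bound[OF this] obtain C6 c6 where "0 < C6" "0 < c6"
    "\<And>n g. 1 \<le> n \<Longrightarrow> g \<in> carrier G \<Longrightarrow> \<bar>lookup (K n) g\<bar>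
      \<le> C6 / real (ball_card G \<mu> (real n powr (1 / (2 * real k))))
        * exp (- c6 * (real (len g) / real n powr (1 / (2 * real k))) powr (2 * real k / (2 * real k - 1)))"
    by blast
  then show ?thesis
    by (intro exI[of _ C6] exI[of _ c6] conjI allI impI ballI) (simp_all only: conv_pow_mu_k)
qed

end
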